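(* Let $Q=\{z\in\mathbb{C}^4 : z_0^2+z_1^2+z_2^2+z_3^2=1\}\cong T^*S^3$, and for $c=(c_1,c_2,c_3)\in\mathbb{R}^3$ let $L_c\subset Q$ be the $T^2$-invariant special Lagrangian $3$-fold given by $$u'(|z|^2)\operatorname{Im}(z_0\bar z_1)=c_1,\qquad u'(|z|^2)\operatorname{Im}(z_2\bar z_3)=c_2,\qquad \operatorname{Im}(z_0^2+z_1^2)=c_3.$$ Let $Q_0=\{z\in\mathbb{C}^4: z_0^2+z_1^2+z_2^2+z_3^2=0\}$ be the conifold with its singular Calabi-Yau structure $(\omega_{cone},\Omega_{cone})$. As $\rho=|\xi|\to\infty$, the special Lagrangian family $L_c$ is asymptotic to a special Lagrangian cone on flat tori in the conifold; for a fixed $c$, $L_c$ has two components, each of them asymptotic to the special Lagrangian cone in the conifold. More precisely, in the limit $\rho\to\infty$ the equations of $L_c$ become, in the coordinates $(\rho,t,\varphi,\psi)$ described in the context, one of the cases: a) $\sin\varphi=0,\ \sin t=0$; b) $\sin\varphi=0,\ \cos t=0$; c) $\cos t=0,\ \sin\psi=0$; d) $\cos\psi=0,\ \sin t=0$. In case a) the limit of the unit vectors $z/|z|$, after applying the $T^2$-action, is the torus $$\Sigma=\left\{\tfrac1{\sqrt2}(\cos\theta_1,\sin\theta_1,i\cos\theta_2,i\sin\theta_2):\theta_1,\theta_2\in[0,2\pi)\right\}\subset Q_0,$$ and case b) gives the same special Lagrangian cone as case a). In case c) the limit is the torus $$\Sigma=\left\{\tfrac1{\sqrt2}(i\cos\theta_1,i\sin\theta_1,\cos\theta_2,\sin\theta_2):\theta_1,\theta_2\in[0,2\pi)\right\}\subset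 Q_0,$$ and case d) gives the same special Lagrangian cone as case c). In each case the cone $C(\Sigma)=\{sz: z\in\Sigma,\ s\in\mathbb{R}\}$ is special Lagrangian in $Q_0$.
   Context: Let $|z|^2=\sum_{j}|z_j|^2$. Fix a constant $\kappa>0$ and let $u$ be the smooth function $$u(r^2)=\int_0^{\cosh^{-1}(r^2)}\left[\tfrac{3\kappa}{2}\left(\tfrac{\sinh(2\sigma)}{2}-\sigma\right)\right]^{1/3}d\sigma ;$$ $u'(|z|^2)$ denotes the derivative of $u$ with respect to its argument $r^2$, evaluated at $r^2=|z|^2$. The Calabi-Yau structure on $Q$ is given by the Kähler form $\omega_{St}=i\partial\bar\partial\,u(|z|^2)$ and the holomorphic volume form $\Omega_{St}(v_1,v_2,v_3)=(dz_0\wedge dz_1\wedge dz_2\wedge dz_3)(z,v_1,v_2,v_3)$. $Q$ is identified with $T^*S^3=\{(x,\xi)\in\mathbb{R}^4\times\mathbb{R}^4:|x|=1,\ x\cdot\xi=0\}$ by $z=x\cosh|\xi|+i\frac{\sinh|\xi|}{|\xi|}\xi$. $T^2\subset SO(4)$ is the maximal torus of block-diagonal matrices $\mathrm{diag}(R_{\theta_1},R_{\theta_2})$ with $R_\theta$ the rotation of $\mathbb{R}^2$ by $\theta$, acting by $z\mapsto gz$. Up to this action, any point of $Q$ has the form $$z=(\cos t\cosh\rho-i\sinh\rho\cos\varphi\sin t,\ i\sinh\rho\sin\varphi\cos\psi,\ \sin t\cosh\rho+i\sinh\rho\cos\varphi\cos t,\ i\sinh\rho\sin\varphi\sin\psi)$$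 with $\rho=|\xi|\ge0$, so $|z|^2=\cosh(2\rho)$, and the equations of $L_c$ become $u'(\cosh 2\rho)\sinh(2\rho)\cos t\sin\varphi\cos\psi=c_1$, $u'(\cosh 2\rho)\sinh(2\rho)\sin t\sin\varphi\sin\psi=c_2$, $\sinh(2\rho)\sin(2t)\cos\varphi=c_3$. On the conifold $Q_0$ (singular at $0$) the Candelas-de la Ossa Ricci-flat Kähler form is $\omega_{cone}=i\partial\bar\partial\,u_{cone}(|z|^2)$ with $u_{cone}(r^2)=\frac32 r^{4/3}$, and the holomorphic volume form $\Omega_{cone}$ is defined by $\frac12 d(z_0^2+z_1^2+z_2^2+z_3^2)\wedge\Omega_{cone}=dz_0\wedge dz_1\wedge dz_2\wedge dz_3$. A real $3$-dimensional submanifold $L$ of $Q$ (resp. $Q_0$) is special Lagrangian if the Kähler form and the imaginary part of the holomorphic volume form vanish on $L$.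
   Formalization: "Two components" is proved for the part |z|>R of L_c, R large (L_c is connected); L_c is special Lagrangian off points with z0=z1=0 or z2=z3=0, cones off 0; case b) has the torus of c), d) that of a), and "same cone" means up to SO(4). *)

theory Defs
  imports "HOL-Analysis.Analysis"
begin

section \<open>Vectors in \<open>\<complex>\<^sup>4\<close>\<close>

text \<open>
  The index type \<^typ>\<open>4\<close> has the elements 0, 1, 2, 3 (with 4 = 0), so \<open>z $ 0, \<dots>, z $ 3\<close> are the
  coordinates of \<open>z\<close>, and \<^term>\<open>norm z\<close> is the Hermitian norm.
\<close>

definition vec4 :: "'a \<Rightarrow> 'a \<Rightarrow> 'a \<Rightarrow> 'a \<Rightarrow> 'a ^ 4" where
  "vec4 a b c d = (\<chi> i. if i = 0 then a else if i = 1 then b else if i = 2 then c else d)"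

definition quad :: "complex ^ 4 \<Rightarrow> complex" where
  "quad z = (z $ 0)\<^sup>2 + (z $ 1)\<^sup>2 + (z $ 2)\<^sup>2 + (z $ 3)\<^sup>2"

definition quadric :: "(complex ^ 4) set" where
  "quadric = {z. quad z = 1}"

definition conifold :: "(complex ^ 4) set" where
  "conifold = {z. quad z = 0}"


section \<open>The form \<open>i \<partial>\<partial>\<close>-bar of a function\<close>

text \<open>
  Wirtinger derivatives, taken within the domain \<open>S\<close> of the function.  The Stenzel potential is only
  defined on the closed set \<open>|z| \<ge> 1\<close>, whose boundary contains the zero section of \<open>T\<^sup>*S\<^sup>3\<close>; derivatives
  within that set are unique at boundary points too.  On open \<open>S\<close> these are the ordinary derivatives.
\<close>

definition wirt ::
  "(complex ^ 4) set \<Rightarrow> 4 \<Rightarrow> (complex ^ 4 \<Rightarrow> complex) \<Rightarrow> complex ^ 4 \<Rightarrow> complex" where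
  "wirt S j f z =
     (frechet_derivative f (at z within S) (axis j 1)
       - \<i> * frechet_derivative f (at z within S) (axis j \<i>)) / 2"

definition wirt_bar ::
  "(complex ^ 4) set \<Rightarrow> 4 \<Rightarrow> (complex ^ 4 \<Rightarrow> complex) \<Rightarrow> complex ^ 4 \<Rightarrow> complex" where
  "wirt_bar S j f z =
     (frechet_derivative f (at z within S) (axis j 1)
       + \<i> * frechet_derivative f (at z within S) (axis j \<i>)) / 2"

text \<open>
  The 2-form \<open>i \<Sum> (\<partial>\<^sup>2f / \<partial>z\<^sub>j \<partial>z\<^sub>k-bar) dz\<^sub>j \<and> dz\<^sub>k-bar\<close>, evaluated on the tangent vectors \<open>v, w\<close>.
\<close>

definition i_ddbar ::
  "(complex ^ 4) set \<Rightarrow> (complex ^ 4 \<Rightarrow> real) \<Rightarrow>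
     complex ^ 4 \<Rightarrow> complex ^ 4 \<Rightarrow> complex ^ 4 \<Rightarrow> complex" where
  "i_ddbar S f z v w =
     \<i> * (\<Sum>j\<in>UNIV. \<Sum>k\<in>UNIV.
            wirt S j (wirt_bar S k (\<lambda>p. complex_of_real (f p))) z
              * (v $ j * cnj (w $ k) - w $ j * cnj (v $ k)))"


section \<open>The two Calabi-Yau structures\<close>

text \<open>The form \<open>dz\<^sub>0 \<and> dz\<^sub>1 \<and> dz\<^sub>2 \<and> dz\<^sub>3\<close>, with the determinant convention for wedge products.\<close>

definition vol4 ::
  "complex ^ 4 \<Rightarrow> complex ^ 4 \<Rightarrow> complex ^ 4 \<Rightarrow> complex ^ 4 \<Rightarrow> complex" where
  "vol4 v0 v1 v2 v3 = det (vec4 v0 v1 v2 v3)"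

text \<open>The potential \<open>u\<close> as a function of \<open>s = r\<^sup>2 \<ge> 1\<close>; at \<open>s = 1\<close> the derivative is one-sided.\<close>

definition u_St :: "real \<Rightarrow> real \<Rightarrow> real" where
  "u_St \<kappa> s =
     integral {0..arcosh s} (\<lambda>\<sigma>. root 3 (3 * \<kappa> / 2 * (sinh (2 * \<sigma>) / 2 - \<sigma>)))"

definition u_St' :: "real \<Rightarrow> real \<Rightarrow> real" where
  "u_St' \<kappa> s = vector_derivative (u_St \<kappa>) (at s within {1..})"

definition omega_St ::
  "real \<Rightarrow> complex ^ 4 \<Rightarrow> complex ^ 4 \<Rightarrow> complex ^ 4 \<Rightarrow> complex" where
  "omega_St \<kappa> = i_ddbar {z. 1 \<le> norm z} (\<lambda>z. u_St \<kappa> ((norm z)\<^sup>2))"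

definition Omega_St ::
  "complex ^ 4 \<Rightarrow> complex ^ 4 \<Rightarrow> complex ^ 4 \<Rightarrow> complex ^ 4 \<Rightarrow> complex" where
  "Omega_St z v1 v2 v3 = vol4 z v1 v2 v3"

definition u_cone :: "real \<Rightarrow> real" where
  "u_cone s = 3 / 2 * s powr (2 / 3)"

definition omega_cone ::
  "complex ^ 4 \<Rightarrow> complex ^ 4 \<Rightarrow> complex ^ 4 \<Rightarrow> complex" where
  "omega_cone = i_ddbar (- {0}) (\<lambda>z. u_cone ((norm z)\<^sup>2))"

text \<open>
  The identity \<open>1/2 d(quad) \<and> \<Omega> = dz\<^sub>0 \<and> dz\<^sub>1 \<and> dz\<^sub>2 \<and> dz\<^sub>3\<close> at \<open>z\<close>, evaluated on \<open>v\<^sub>0, v\<^sub>1, v\<^sub>2, v\<^sub>3\<close> with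
  \<open>v\<^sub>1, v\<^sub>2, v\<^sub>3\<close> tangent to the conifold and \<open>v\<^sub>0\<close> arbitrary in \<open>\<complex>\<^sup>4\<close>: the terms with \<open>d(quad)\<close> applied to a
  tangent vector vanish, and \<open>1/2 d(quad)(v\<^sub>0) = \<Sum> z\<^sub>j v\<^sub>0\<^sub>j\<close>.  For \<open>z \<noteq> 0\<close> this determines the value of
  \<open>\<Omega>\<close> on the tangent vectors \<open>v\<^sub>1, v\<^sub>2, v\<^sub>3\<close>; the value on other vectors is irrelevant.
\<close>

definition Omega_cone ::
  "complex ^ 4 \<Rightarrow> complex ^ 4 \<Rightarrow> complex ^ 4 \<Rightarrow> complex ^ 4 \<Rightarrow> complex" where
  "Omega_cone z v1 v2 v3 =
     (THE a. \<forall>v0. (\<Sum>j\<in>UNIV. z $ j * v0 $ j) * a = vol4 v0 v1 v2 v3)"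


section \<open>Special Lagrangian submanifolds and flat tori\<close>

primrec Ck_on ::
  "nat \<Rightarrow> 'a::real_normed_vector set \<Rightarrow> ('a \<Rightarrow> 'b::real_normed_vector) \<Rightarrow> bool" where
  "Ck_on 0 U f \<longleftrightarrow> continuous_on U f"
| "Ck_on (Suc k) U f \<longleftrightarrow>
     (\<forall>x\<in>U. f differentiable (at x)) \<and>
     (\<forall>v. Ck_on k U (\<lambda>x. frechet_derivative f (at x) v))"

definition smooth_on ::
  "'a::real_normed_vector set \<Rightarrow> ('a \<Rightarrow> 'b::real_normed_vector) \<Rightarrow> bool" where
  "smooth_on U f \<longleftrightarrow> (\<forall>k. Ck_on k U f)"

text \<open>Embedded submanifolds of real dimension 3 = 8 - 5, by local defining functions.\<close>

definition submanifold3 :: "(complex ^ 4) set \<Rightarrow> bool" where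
  "submanifold3 L \<longleftrightarrow>
     (\<forall>p\<in>L. \<exists>U (F :: complex ^ 4 \<Rightarrow> real ^ 5).
        open U \<and> p \<in> U \<and> smooth_on U F \<and> L \<inter> U = {z \<in> U. F z = 0} \<and>
        (\<forall>z\<in>L \<inter> U. surj (frechet_derivative F (at z))))"

definition tangent_space :: "(complex ^ 4) set \<Rightarrow> complex ^ 4 \<Rightarrow> (complex ^ 4) set" where
  "tangent_space L p =
     {v. \<exists>\<gamma> :: real \<Rightarrow> complex ^ 4.
           \<gamma> 0 = p \<and> range \<gamma> \<subseteq> L \<and> (\<gamma> has_vector_derivative v) (at 0)}"

definition special_lagrangian ::
  "(complex ^ 4) set \<Rightarrow>
   (complex ^ 4 \<Rightarrow> complex ^ 4 \<Rightarrow> complex ^ 4 \<Rightarrow> complex) \<Rightarrow>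
   (complex ^ 4 \<Rightarrow> complex ^ 4 \<Rightarrow> complex ^ 4 \<Rightarrow> complex ^ 4 \<Rightarrow> complex) \<Rightarrow>
   (complex ^ 4) set \<Rightarrow> bool" where
  "special_lagrangian X \<omega> \<Omega> L \<longleftrightarrow>
     L \<subseteq> X \<and> submanifold3 L \<and>
     (\<forall>z\<in>L. \<forall>v\<in>tangent_space L z. \<forall>w\<in>tangent_space L z. \<omega> z v w = 0) \<and>
     (\<forall>z\<in>L. \<forall>v1\<in>tangent_space L z. \<forall>v2\<in>tangent_space L z. \<forall>v3\<in>tangent_space L z.
        Im (\<Omega> z v1 v2 v3) = 0)"

definition kaehler_metric ::
  "(complex ^ 4 \<Rightarrow> complex ^ 4 \<Rightarrow> complex ^ 4 \<Rightarrow> complex) \<Rightarrow>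
     complex ^ 4 \<Rightarrow> complex ^ 4 \<Rightarrow> complex ^ 4 \<Rightarrow> real" where
  "kaehler_metric \<omega> z v w = Re (\<omega> z v (\<i> *s w))"

text \<open>
  \<open>S\<close> is an embedded copy of \<open>\<real>\<^sup>2 / (2\<pi>\<int>)\<^sup>2\<close> on which the metric has constant positive definite
  coefficients \<open>B\<close>.
\<close>

definition flat_torus ::
  "(complex ^ 4 \<Rightarrow> complex ^ 4 \<Rightarrow> complex ^ 4 \<Rightarrow> real) \<Rightarrow> (complex ^ 4) set \<Rightarrow> bool" where
  "flat_torus g S \<longleftrightarrow>
     (\<exists>(F :: real \<times> real \<Rightarrow> complex ^ 4) (B :: real \<times> real \<Rightarrow> real \<times> real \<Rightarrow> real).
        smooth_on UNIV F \<and> range F = S \<and>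
        (\<forall>a b a' b'. F (a, b) = F (a', b') \<longleftrightarrow>
           (\<exists>k l :: int. a' = a + 2 * pi * of_int k \<and> b' = b + 2 * pi * of_int l)) \<and>
        (\<forall>v. v \<noteq> 0 \<longrightarrow> B v v > 0) \<and>
        (\<forall>x v w. g (F x) (frechet_derivative F (at x) v) (frechet_derivative F (at x) w) = B v w))"


section \<open>Symmetries\<close>

definition torus_act :: "real \<Rightarrow> real \<Rightarrow> complex ^ 4 \<Rightarrow> complex ^ 4" where
  "torus_act \<theta>1 \<theta>2 z =
     vec4 (of_real (cos \<theta>1) * z $ 0 - of_real (sin \<theta>1) * z $ 1)
          (of_real (sin \<theta>1) * z $ 0 + of_real (cos \<theta>1) * z $ 1)
          (of_real (cos \<theta>2) * z $ 2 - of_real (sin \<theta>2) * z $ 3)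
          (of_real (sin \<theta>2) * z $ 2 + of_real (cos \<theta>2) * z $ 3)"

definition torus_orbit :: "complex ^ 4 \<Rightarrow> (complex ^ 4) set" where
  "torus_orbit z = {torus_act \<theta>1 \<theta>2 z | \<theta>1 \<theta>2. True}"

definition SO4_act :: "real ^ 4 ^ 4 \<Rightarrow> complex ^ 4 \<Rightarrow> complex ^ 4" where
  "SO4_act g z = (\<chi> i. \<Sum>j\<in>UNIV. of_real (g $ i $ j) * z $ j)"

text \<open>
  Equality of subsets of the conifold up to \<open>SO(4)\<close>, which acts on the conifold and on the quadric by
  automorphisms of the Calabi-Yau structures.  Equality as sets fails for the cones over the limit tori
  of cases a), b) below: they are \<open>C\<close> and \<open>i C\<close>, interchanged by \<open>(z\<^sub>0, z\<^sub>1, z\<^sub>2, z\<^sub>3) \<mapsto> (z\<^sub>2, z\<^sub>3, z\<^sub>0, z\<^sub>1)\<close>;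
  likewise for c), d).
\<close>

definition SO4_congruent :: "(complex ^ 4) set \<Rightarrow> (complex ^ 4) set \<Rightarrow> bool" where
  "SO4_congruent C C' \<longleftrightarrow>
     (\<exists>g :: real ^ 4 ^ 4. orthogonal_matrix g \<and> det g = 1 \<and> SO4_act g ` C = C')"


section \<open>The family \<open>L\<^sub>c\<close> and its asymptotics\<close>

definition L_fam :: "real \<Rightarrow> real \<Rightarrow> real \<Rightarrow> real \<Rightarrow> (complex ^ 4) set" where
  "L_fam \<kappa> c1 c2 c3 =
     {z \<in> quadric.
        u_St' \<kappa> ((norm z)\<^sup>2) * Im (z $ 0 * cnj (z $ 1)) = c1 \<and>
        u_St' \<kappa> ((norm z)\<^sup>2) * Im (z $ 2 * cnj (z $ 3)) = c2 \<and>
        Im ((z $ 0)\<^sup>2 + (z $ 1)\<^sup>2) = c3}"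

text \<open>
  The points of the quadric where the torus action is not free.  \<open>L\<^sub>c\<close> meets this set only if
  \<open>c\<^sub>3 = 0\<close> and \<open>c\<^sub>1 c\<^sub>2 = 0\<close>; at such points two smooth sheets of \<open>L\<^sub>c\<close> cross.
\<close>

definition non_free_locus :: "(complex ^ 4) set" where
  "non_free_locus = {z. (z $ 0 = 0 \<and> z $ 1 = 0) \<or> (z $ 2 = 0 \<and> z $ 3 = 0)}"

definition coord_pt :: "real \<Rightarrow> real \<Rightarrow> real \<Rightarrow> real \<Rightarrow> complex ^ 4" where
  "coord_pt \<rho> t \<phi> \<psi> =
     vec4 (Complex (cos t * cosh \<rho>) (- (sinh \<rho> * cos \<phi> * sin t)))
          (\<i> * of_real (sinh \<rho> * sin \<phi> * cos \<psi>))
          (Complex (sin t * cosh \<rho>) (sinh \<rho> * cos \<phi> * cos t))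
          (\<i> * of_real (sinh \<rho> * sin \<phi> * sin \<psi>))"

definition limit_eqs :: "real \<Rightarrow> real \<Rightarrow> real \<Rightarrow> bool" where
  "limit_eqs t \<phi> \<psi> \<longleftrightarrow>
     cos t * sin \<phi> * cos \<psi> = 0 \<and> sin t * sin \<phi> * sin \<psi> = 0 \<and> sin (2 * t) * cos \<phi> = 0"

definition case_a :: "real \<Rightarrow> real \<Rightarrow> real \<Rightarrow> bool" where
  "case_a t \<phi> \<psi> \<longleftrightarrow> sin \<phi> = 0 \<and> sin t = 0"

definition case_b :: "real \<Rightarrow> real \<Rightarrow> real \<Rightarrow> bool" where
  "case_b t \<phi> \<psi> \<longleftrightarrow> sin \<phi> = 0 \<and> cos t = 0"

definition case_c :: "real \<Rightarrow> real \<Rightarrow> real \<Rightarrow> bool" where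
  "case_c t \<phi> \<psi> \<longleftrightarrow> cos t = 0 \<and> sin \<psi> = 0"

definition case_d :: "real \<Rightarrow> real \<Rightarrow> real \<Rightarrow> bool" where
  "case_d t \<phi> \<psi> \<longleftrightarrow> cos \<psi> = 0 \<and> sin t = 0"

text \<open>
  Whenever \<open>\<rho> \<rightarrow> \<infinity>\<close> and the angles converge to a solution of \<open>P\<close>, the unit vectors \<open>z / |z|\<close> converge,
  and the torus action sweeps out \<open>\<Sigma>\<close> from the limit.
\<close>

definition limit_torus ::
  "(real \<Rightarrow> real \<Rightarrow> real \<Rightarrow> bool) \<Rightarrow> (complex ^ 4) set \<Rightarrow> bool" where
  "limit_torus P \<Sigma> \<longleftrightarrow>
     (\<forall>(\<rho> :: nat \<Rightarrow> real) (t :: nat \<Rightarrow> real) (\<phi> :: nat \<Rightarrow> real) (\<psi> :: nat \<Rightarrow> real) t0 \<phi>0 \<psi>0.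
        filterlim \<rho> at_top sequentially \<and> t \<longlonglongrightarrow> t0 \<and> \<phi> \<longlonglongrightarrow> \<phi>0 \<and> \<psi> \<longlonglongrightarrow> \<psi>0 \<and> P t0 \<phi>0 \<psi>0 \<longrightarrow>
        (\<exists>p. (\<lambda>n. sgn (coord_pt (\<rho> n) (t n) (\<phi> n) (\<psi> n))) \<longlonglongrightarrow> p \<and> torus_orbit p = \<Sigma>))"

definition Sigma_a :: "(complex ^ 4) set" where
  "Sigma_a =
     {(1 / sqrt 2) *\<^sub>R vec4 (of_real (cos \<theta>1)) (of_real (sin \<theta>1))
                          (\<i> * of_real (cos \<theta>2)) (\<i> * of_real (sin \<theta>2))
       | \<theta>1 \<theta>2. \<theta>1 \<in> {0..<2 * pi} \<and> \<theta>2 \<in> {0..<2 * pi}}"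

definition Sigma_c :: "(complex ^ 4) set" where
  "Sigma_c =
     {(1 / sqrt 2) *\<^sub>R vec4 (\<i> * of_real (cos \<theta>1)) (\<i> * of_real (sin \<theta>1))
                          (of_real (cos \<theta>2)) (of_real (sin \<theta>2))
       | \<theta>1 \<theta>2. \<theta>1 \<in> {0..<2 * pi} \<and> \<theta>2 \<in> {0..<2 * pi}}"

definition cone_over :: "(complex ^ 4) set \<Rightarrow> (complex ^ 4) set" where
  "cone_over \<Sigma> = {s *\<^sub>R z | s z. z \<in> \<Sigma>}"

text \<open>
  The slices of \<open>L\<close> and \<open>C\<close> by the sphere of radius \<open>R\<close>, rescaled to unit length, have Hausdorff
  distance tending to 0 as \<open>R \<rightarrow> \<infinity>\<close>.
\<close>

definition asymptotic_to_cone :: "(complex ^ 4) set \<Rightarrow> (complex ^ 4) set \<Rightarrow> bool" where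
  "asymptotic_to_cone L C \<longleftrightarrow>
     (\<forall>\<epsilon>>0. \<exists>R0. \<forall>R\<ge>R0.
        (\<forall>z\<in>L. norm z = R \<longrightarrow> (\<exists>w\<in>C. norm w = R \<and> dist z w < \<epsilon> * R)) \<and>
        (\<forall>w\<in>C. norm w = R \<longrightarrow> (\<exists>z\<in>L. norm z = R \<and> dist z w < \<epsilon> * R)))"

end

theory Submission
  imports Defs "HOL-Real_Asymp.Real_Asymp"
begin

text \<open>
  The functions \<open>u'(|z|\<^sup>2) Im (z\<^sub>0 cnj z\<^sub>1)\<close> and \<open>u'(|z|\<^sup>2) Im (z\<^sub>2 cnj z\<^sub>3)\<close> are moment maps of the torus
  action, and \<open>Im (z\<^sub>0\<^sup>2 + z\<^sub>1\<^sup>2)\<close> is a primitive of \<open>Im \<Omega>\<close> contracted with the two generators \<open>X\<^sub>1\<close>, \<open>X\<^sub>2\<close>.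
  Hence a tangent space of \<open>L\<^sub>c\<close> is spanned by \<open>X\<^sub>1\<close>, \<open>X\<^sub>2\<close> and one further vector, and both forms vanish on it.
  Regularity of the level sets comes from \<open>u' + s u'' > 0\<close>, which makes the Gram matrix of \<open>X\<^sub>1\<close>, \<open>X\<^sub>2\<close> definite.

  For the ends, a torus orbit in a free pair \<open>(z\<^sub>0, z\<^sub>1)\<close> is determined by \<open>z\<^sub>0\<^sup>2 + z\<^sub>1\<^sup>2\<close>,
  \<open>|z\<^sub>0|\<^sup>2 + |z\<^sub>1|\<^sup>2\<close> and \<open>Im (z\<^sub>0 cnj z\<^sub>1)\<close>.  On \<open>L\<^sub>c\<close> these are fixed by \<open>|z|\<close> up to one unknown
  \<open>Y = 2 Re (z\<^sub>0\<^sup>2 + z\<^sub>1\<^sup>2) - 1\<close>, which solves a quadratic equation whose two roots have opposite signs for large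
  \<open>|z|\<close>.  Each root gives one orbit for each \<open>|z|\<close>, depending continuously on it; the rescaled orbits converge
  to the two tori.
\<close>

section \<open>Linear algebra in \<open>\<complex>\<^sup>4\<close>\<close>

lemma UNIV_4_eq: "(UNIV :: 4 set) = {0, 1, 2, 3}"
proof -
  have "(4::4) = 0" by simp
  then show ?thesis using UNIV_4 by auto
qed

lemma sum_UNIV_4: "(\<Sum>j\<in>(UNIV::4 set). f j) = f 0 + f 1 + f 2 + (f 3 :: 'a::comm_monoid_add)"
  unfolding UNIV_4_eq by (simp add: add.assoc)

lemma all_4: "(\<forall>i::4. P i) \<longleftrightarrow> P 0 \<and> P 1 \<and> P 2 \<and> P 3"
  using UNIV_4_eq by (metis (full_types) UNIV_I empty_iff insert_iff)

lemma vec4_nth [simp]: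
  "vec4 a b c d $ 0 = a" "vec4 a b c d $ 1 = b" "vec4 a b c d $ 2 = c" "vec4 a b c d $ 3 = d"
  by (simp_all add: vec4_def)

lemma vec4_eqI: "(z::'a^4) $ 0 = w $ 0 \<Longrightarrow> z $ 1 = w $ 1 \<Longrightarrow> z $ 2 = w $ 2 \<Longrightarrow> z $ 3 = w $ 3 \<Longrightarrow> z = w"
  by (simp add: vec_eq_iff all_4)

lemma norm_sq_4: "(norm (z::complex^4))\<^sup>2 = (cmod (z$0))\<^sup>2 + (cmod (z$1))\<^sup>2 + (cmod (z$2))\<^sup>2 + (cmod (z$3))\<^sup>2"
  by (simp add: norm_vec_def L2_set_def sum_UNIV_4 sum_nonneg)

lemma inner_4: "(z::complex^4) \<bullet> v = Re (cnj (z$0) * v$0 + cnj (z$1) * v$1 + cnj (z$2) * v$2 + cnj (z$3) * v$3)"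
  by (simp add: inner_vec_def sum_UNIV_4 inner_complex_def)

lemma det_4:
  "det (A::'a::comm_ring_1^4^4) =
     A$0$0 * (A$1$1 * (A$2$2 * A$3$3 - A$2$3 * A$3$2) - A$1$2 * (A$2$1 * A$3$3 - A$2$3 * A$3$1) + A$1$3 * (A$2$1 * A$3$2 - A$2$2 * A$3$1))
   - A$0$1 * (A$1$0 * (A$2$2 * A$3$3 - A$2$3 * A$3$2) - A$1$2 * (A$2$0 * A$3$3 - A$2$3 * A$3$0) + A$1$3 * (A$2$0 * A$3$2 - A$2$2 * A$3$0))
   + A$0$2 * (A$1$0 * (A$2$1 * A$3$3 - A$2$3 * A$3$1) - A$1$1 * (A$2$0 * A$3$3 - A$2$3 * A$3$0) + A$1$3 * (A$2$0 * A$3$1 - A$2$1 * A$3$0))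
   - A$0$3 * (A$1$0 * (A$2$1 * A$3$2 - A$2$2 * A$3$1) - A$1$1 * (A$2$0 * A$3$2 - A$2$2 * A$3$0) + A$1$2 * (A$2$0 * A$3$1 - A$2$1 * A$3$0))"
proof -
  have f: "finite {1::4,2,3}" "0 \<notin> {1::4,2,3}" "finite {2::4,3}" "1 \<notin> {2::4,3}" "finite {3::4}" "2 \<notin> {3::4}"
    by auto
  show ?thesis
    unfolding det_def UNIV_4_eq
    unfolding sum_over_permutations_insert[OF f(1,2)]
    unfolding sum_over_permutations_insert[OF f(3,4)]
    unfolding sum_over_permutations_insert[OF f(5,6)]
    unfolding permutes_sing
    by (simp add: sign_swap_id permutation_swap_id sign_compose sign_id permutation_compose swap_id_eq algebra_simps)
qed


section \<open>Smooth functions and submanifolds\<close>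

lemma Ck_on_cong:
  assumes "open U" "\<And>x. x \<in> U \<Longrightarrow> f x = g x" "Ck_on k U f"
  shows "Ck_on k U g"
  using assms(2,3)
proof (induction k arbitrary: f g)
  case 0
  then show ?case by (simp add: continuous_on_eq)
next
  case (Suc k)
  have d: "g differentiable (at x)" "frechet_derivative g (at x) = frechet_derivative f (at x)"
    if "x \<in> U" for x
  proof -
    have f: "f differentiable (at x)" using that Suc.prems by simp
    then have "(f has_derivative frechet_derivative f (at x)) (at x)"
      by (simp add: frechet_derivative_works)
    then have "(g has_derivative frechet_derivative f (at x)) (at x)"
      using has_derivative_transform_within_open[OF _ assms(1) that] Suc.prems(1) by blast
    then show "g differentiable (at x)" by (auto simp: differentiable_def)
    show "frechet_derivative g (at x) = frechet_derivative f (at x)"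
      using frechet_derivative_transform_within_open[OF f assms(1) that] Suc.prems(1) by auto
  qed
  have "Ck_on k U (\<lambda>x. frechet_derivative g (at x) v)" for v
    by (rule Suc.IH[of "\<lambda>x. frechet_derivative f (at x) v"]) (use d Suc.prems in auto)
  then show ?case using d by simp
qed

lemma Ck_on_SucI:
  assumes "open U" "\<And>x. x \<in> U \<Longrightarrow> (f has_derivative D x) (at x)" "\<And>v. Ck_on k U (\<lambda>x. D x v)"
  shows "Ck_on (Suc k) U f"
proof -
  have "Ck_on k U (\<lambda>x. frechet_derivative f (at x) v)" for v
    by (rule Ck_on_cong[OF assms(1) _ assms(3)[of v]]) (use frechet_derivative_at[OF assms(2)] in auto)
  then show ?thesis using assms(2) by (auto simp: differentiable_def)
qed

lemma Ck_on_SucD: "Ck_on (Suc k) U f \<Longrightarrow> Ck_on k U f"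
proof (induction k arbitrary: f)
  case 0
  then show ?case
    by (simp add: differentiable_imp_continuous_on differentiable_on_def differentiable_at_withinI)
qed auto

lemma smooth_on_imp_differentiable: "smooth_on U f \<Longrightarrow> x \<in> U \<Longrightarrow> f differentiable (at x)"
  unfolding smooth_on_def using Ck_on.simps(2) by blast

lemma smooth_on_cong:
  assumes "open U" "\<And>x. x \<in> U \<Longrightarrow> f x = g x" "smooth_on U f"
  shows "smooth_on U g"
  using assms Ck_on_cong unfolding smooth_on_def by blast

lemma Ck_on_const: "Ck_on k U (\<lambda>x. c)"
  by (induction k arbitrary: c) auto

lemma smooth_on_const [simp]: "smooth_on U (\<lambda>x. c)"
  by (simp add: smooth_on_def Ck_on_const)

lemma smooth_on_bounded_linear:
  assumes "bounded_linear L"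
  shows "smooth_on U L"
proof -
  have "frechet_derivative L (at x) = L" for x
    using frechet_derivative_at[OF bounded_linear_imp_has_derivative[OF assms]] by simp
  then have "Ck_on k U L" for k
    using assms
    by (cases k) (auto simp: Ck_on_const bounded_linear.linear linear_continuous_on bounded_linear_imp_differentiable)
  then show ?thesis by (simp add: smooth_on_def)
qed

lemma smooth_on_bounded_linear_compose:
  assumes "open U" "bounded_linear L" "smooth_on U f"
  shows "smooth_on U (\<lambda>x. L (f x))"
proof -
  have "Ck_on k U (\<lambda>x. L (f x))" if "Ck_on k U f" for k f
    using that
  proof (induction k arbitrary: f)
    case 0
    then show ?case using assms(2) by (auto intro: bounded_linear.continuous_on)
  next
    case (Suc k)
    show ?case
      by (rule Ck_on_SucI[OF assms(1), where D = "\<lambda>x v. L (frechet_derivative f (at x) v)"])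
        (use Suc in \<open>auto intro!: bounded_linear.has_derivative[OF assms(2)] simp: frechet_derivative_works\<close>)
  qed
  then show ?thesis using assms(3) by (simp add: smooth_on_def)
qed

lemma Ck_on_add:
  assumes "open U" "Ck_on k U f" "Ck_on k U g"
  shows "Ck_on k U (\<lambda>x. f x + g x)"
  using assms(2,3)
proof (induction k arbitrary: f g)
  case 0
  then show ?case by (auto intro: continuous_intros)
next
  case (Suc k)
  show ?case
    by (rule Ck_on_SucI[OF assms(1), where D = "\<lambda>x v. frechet_derivative f (at x) v + frechet_derivative g (at x) v"])
      (use Suc in \<open>auto intro!: has_derivative_add simp: frechet_derivative_works\<close>)
qed

lemma smooth_on_add:
  "open U \<Longrightarrow> smooth_on U f \<Longrightarrow> smooth_on U g \<Longrightarrow> smooth_on U (\<lambda>x. f x + g x)"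
  by (simp add: smooth_on_def Ck_on_add)

lemma smooth_on_minus: "open U \<Longrightarrow> smooth_on U f \<Longrightarrow> smooth_on U (\<lambda>x. - f x)"
  using smooth_on_bounded_linear_compose[OF _ bounded_linear_minus[OF bounded_linear_ident]] by blast

lemma smooth_on_diff:
  "open U \<Longrightarrow> smooth_on U f \<Longrightarrow> smooth_on U g \<Longrightarrow> smooth_on U (\<lambda>x. f x - g x)"
  using smooth_on_add[of U f "\<lambda>x. - g x"] smooth_on_minus[of U g] by simp

lemma Ck_on_mult:
  fixes f g :: "'a::real_normed_vector \<Rightarrow> real"
  assumes "open U" "Ck_on k U f" "Ck_on k U g"
  shows "Ck_on k U (\<lambda>x. f x * g x)"
  using assms(2,3)
proof (induction k arbitrary: f g)
  case 0
  then show ?case by (auto intro: continuous_intros)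
next
  case (Suc k)
  have "Ck_on k U f" "Ck_on k U g"
    using Suc.prems Ck_on_SucD by blast+
  then have "Ck_on k U (\<lambda>x. f x * frechet_derivative g (at x) v + frechet_derivative f (at x) v * g x)" for v
    using Suc by (intro Ck_on_add[OF assms(1)] Suc.IH) auto
  moreover have "((\<lambda>x. f x * g x) has_derivative
      (\<lambda>v. f x * frechet_derivative g (at x) v + frechet_derivative f (at x) v * g x)) (at x)" if "x \<in> U" for x
    using Suc.prems that by (auto intro!: has_derivative_mult simp: frechet_derivative_works)
  ultimately show ?case by (intro Ck_on_SucI[OF assms(1)])
qed

lemma smooth_on_mult:
  fixes f g :: "'a::real_normed_vector \<Rightarrow> real"
  shows "open U \<Longrightarrow> smooth_on U f \<Longrightarrow> smooth_on U g \<Longrightarrow> smooth_on U (\<lambda>x. f x * g x)"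
  by (simp add: smooth_on_def Ck_on_mult)

lemma smooth_on_power:
  fixes f :: "'a::real_normed_vector \<Rightarrow> real"
  shows "open U \<Longrightarrow> smooth_on U f \<Longrightarrow> smooth_on U (\<lambda>x. f x ^ n)"
  by (induction n) (auto intro: smooth_on_mult)

lemma smooth_on_sum:
  assumes "open U" "finite I" "\<And>i. i \<in> I \<Longrightarrow> smooth_on U (f i)"
  shows "smooth_on U (\<lambda>x. \<Sum>i\<in>I. f i x)"
  using assms(2,3) by (induction I) (auto intro!: smooth_on_add[OF assms(1)])

lemma smooth_on_real_compose:
  fixes g :: "'a::real_normed_vector \<Rightarrow> real" and \<phi> :: "nat \<Rightarrow> real \<Rightarrow> real"
  assumes U: "open U" and g: "smooth_on U g" and I: "\<And>x. x \<in> U \<Longrightarrow> g x \<in> I"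
    and \<phi>: "\<And>n y. y \<in> I \<Longrightarrow> (\<phi> n has_real_derivative \<phi> (Suc n) y) (at y)"
  shows "smooth_on U (\<lambda>x. \<phi> 0 (g x))"
proof -
  have d: "((\<lambda>x. \<phi> n (g x)) has_derivative (\<lambda>v. \<phi> (Suc n) (g x) * frechet_derivative g (at x) v)) (at x)"
    if "x \<in> U" for n x
    using has_derivative_compose[of g "frechet_derivative g (at x)" x UNIV "\<phi> n" "(*) (\<phi> (Suc n) (g x))"]
      smooth_on_imp_differentiable[OF g that] \<phi>[OF I[OF that]]
    by (auto simp: frechet_derivative_works has_field_derivative_def)
  have "Ck_on k U (\<lambda>x. \<phi> n (g x))" for k n
  proof (induction k arbitrary: n)
    case 0
    have "(\<lambda>x. \<phi> n (g x)) differentiable (at x)" if "x \<in> U" for x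
      using d[OF that] by (auto simp: differentiable_def)
    then show ?case
      by (simp add: differentiable_imp_continuous_on differentiable_on_def differentiable_at_withinI)
  next
    case (Suc k)
    have "Ck_on k U (\<lambda>x. frechet_derivative g (at x) v)" for v
      using g unfolding smooth_on_def using Ck_on.simps(2) by blast
    then show ?case
      by (intro Ck_on_SucI[OF U d] Ck_on_mult[OF U] Suc)
  qed
  then show ?thesis by (simp add: smooth_on_def)
qed

lemma smooth_on_powr:
  fixes g :: "'a::real_normed_vector \<Rightarrow> real"
  assumes "open U" "smooth_on U g" "\<And>x. x \<in> U \<Longrightarrow> g x > 0"
  shows "smooth_on U (\<lambda>x. g x powr a)"
proof -
  define \<phi> where "\<phi> = (\<lambda>n x. (\<Prod>i<n. a - real i) * x powr (a - real n))"
  have "smooth_on U (\<lambda>x. \<phi> 0 (g x))"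
  proof (rule smooth_on_real_compose[OF assms(1,2), where I = "{0<..}"])
    show "(\<phi> n has_real_derivative \<phi> (Suc n) y) (at y)" if "y \<in> {0<..}" for n y
      unfolding \<phi>_def using that by (auto intro!: derivative_eq_intros simp: algebra_simps)
  qed (use assms in auto)
  then show ?thesis by (simp add: \<phi>_def)
qed

lemma smooth_on_ln:
  fixes g :: "'a::real_normed_vector \<Rightarrow> real"
  assumes "open U" "smooth_on U g" "\<And>x. x \<in> U \<Longrightarrow> g x > 0"
  shows "smooth_on U (\<lambda>x. ln (g x))"
proof -
  define \<phi> where "\<phi> = (\<lambda>n x. if n = 0 then ln x else (\<Prod>i<n - 1. - 1 - real i) * x powr (- real n))"
  have "smooth_on U (\<lambda>x. \<phi> 0 (g x))"
  proof (rule smooth_on_real_compose[OF assms(1,2), where I = "{0<..}"])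
    show "(\<phi> n has_real_derivative \<phi> (Suc n) y) (at y)" if "y \<in> {0<..}" for n y
    proof (cases n)
      case 0
      then show ?thesis using that
        by (auto simp: \<phi>_def powr_minus_divide intro!: derivative_eq_intros)
    next
      case (Suc m)
      then show ?thesis using that
        unfolding \<phi>_def by (auto intro!: derivative_eq_intros simp: algebra_simps)
    qed
  qed (use assms in auto)
  then show ?thesis by (simp add: \<phi>_def)
qed

lemma smooth_on_cos:
  fixes g :: "'a::real_normed_vector \<Rightarrow> real"
  assumes "open U" "smooth_on U g"
  shows "smooth_on U (\<lambda>x. cos (g x))"
proof -
  define \<phi> where "\<phi> = (\<lambda>n x. cos (x + real n * (pi / 2)))"
  have "smooth_on U (\<lambda>x. \<phi> 0 (g x))"
  proof (rule smooth_on_real_compose[OF assms, where I = UNIV])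
    show "(\<phi> n has_real_derivative \<phi> (Suc n) y) (at y)" for n y
    proof -
      have "cos (y + real (Suc n) * (pi / 2)) = cos ((y + real n * (pi / 2)) + pi / 2)"
        by (simp add: field_simps)
      also have "\<dots> = - sin (y + real n * (pi / 2))"
        by (simp only: cos_add cos_pi_half sin_pi_half)
      finally show ?thesis
        unfolding \<phi>_def by (auto intro!: derivative_eq_intros)
    qed
  qed auto
  then show ?thesis by (simp add: \<phi>_def)
qed

lemma smooth_on_sin:
  fixes g :: "'a::real_normed_vector \<Rightarrow> real"
  assumes "open U" "smooth_on U g"
  shows "smooth_on U (\<lambda>x. sin (g x))"
proof -
  have "smooth_on U (\<lambda>x. cos (pi / 2 - g x))"
    using assms by (intro smooth_on_cos smooth_on_diff) auto
  then show ?thesis by (simp add: cos_sin_eq[symmetric] sin_cos_eq)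
qed

definition regular_equations :: "(complex ^ 4) set \<Rightarrow> complex ^ 4 \<Rightarrow> bool" where
  "regular_equations L p \<longleftrightarrow> (\<exists>U (f :: 5 \<Rightarrow> complex ^ 4 \<Rightarrow> real) D.
    open U \<and> p \<in> U \<and> (\<forall>i. smooth_on U (f i)) \<and> (\<forall>z\<in>U. \<forall>i. (f i has_derivative D i z) (at z))
    \<and> L \<inter> U = {z \<in> U. \<forall>i. f i z = 0} \<and> (\<forall>z\<in>L \<inter> U. \<forall>y. \<exists>v. \<forall>i. D i z v = y i))"

lemma submanifold3I:
  assumes "\<And>p. p \<in> L \<Longrightarrow> regular_equations L p"
  shows "submanifold3 L"
  unfolding submanifold3_def
proof
  fix p assume "p \<in> L"
  from assms[OF this] obtain U and f :: "5 \<Rightarrow> complex ^ 4 \<Rightarrow> real" and D where *: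
    "open U \<and> p \<in> U \<and> (\<forall>i. smooth_on U (f i)) \<and> (\<forall>z\<in>U. \<forall>i. (f i has_derivative D i z) (at z))
    \<and> L \<inter> U = {z \<in> U. \<forall>i. f i z = 0} \<and> (\<forall>z\<in>L \<inter> U. \<forall>y. \<exists>v. \<forall>i. D i z v = y i)"
    unfolding regular_equations_def by (elim exE)
  then have U: "open U" "p \<in> U" and f: "\<And>i. smooth_on U (f i)"
    and D: "\<And>z i. z \<in> U \<Longrightarrow> (f i has_derivative D i z) (at z)"
    and L: "L \<inter> U = {z \<in> U. \<forall>i. f i z = 0}"
    by simp_all
  have s: "\<exists>v. \<forall>i::5. D i z v = y i" if "z \<in> L \<inter> U" for z y
    using * that by (elim conjE) (drule (1) bspec, erule spec)
  define F where "F = (\<lambda>z. \<Sum>i\<in>(UNIV::5 set). f i z *\<^sub>R (axis i 1 :: real^5))"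
  have nth: "(\<Sum>i\<in>(UNIV::5 set). h i *\<^sub>R (axis i 1 :: real^5)) = (\<chi> i. h i)" for h
    by (simp add: vec_eq_iff axis_def if_distrib cong: if_cong)
  have "smooth_on U F" unfolding F_def
    by (intro smooth_on_sum[OF U(1)] smooth_on_bounded_linear_compose[OF U(1) bounded_linear_scaleR_left f]) auto
  moreover have "L \<inter> U = {z \<in> U. F z = 0}"
    unfolding L F_def nth by (simp add: vec_eq_iff)
  moreover have "surj (frechet_derivative F (at z))" if z: "z \<in> L \<inter> U" for z
  proof -
    have "(F has_derivative (\<lambda>v. \<Sum>i\<in>(UNIV::5 set). D i z v *\<^sub>R (axis i 1 :: real^5))) (at z)"
      unfolding F_def using D z by (auto intro!: derivative_intros)
    then have "frechet_derivative F (at z) = (\<lambda>v. \<chi> i. D i z v)"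
      using frechet_derivative_at unfolding nth by metis
    moreover have "\<exists>v. (\<chi> i. D i z v) = y" for y :: "real^5"
      using s[OF z, of "\<lambda>i. y $ i"] by (auto simp: vec_eq_iff)
    ultimately show ?thesis unfolding surj_def by (metis (no_types))
  qed
  ultimately show "\<exists>U (F :: complex ^ 4 \<Rightarrow> real ^ 5).
        open U \<and> p \<in> U \<and> smooth_on U F \<and> L \<inter> U = {z \<in> U. F z = 0} \<and>
        (\<forall>z\<in>L \<inter> U. surj (frechet_derivative F (at z)))"
    using U by blast
qed

lemma tangent_space_derivative_eq_0:
  fixes f :: "complex ^ 4 \<Rightarrow> real"
  assumes "v \<in> tangent_space L p" "(f has_derivative D) (at p)" "\<And>z. z \<in> L \<Longrightarrow> f z = 0"
  shows "D v = 0"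
proof -
  obtain \<gamma> :: "real \<Rightarrow> complex ^ 4" where \<gamma>: "\<gamma> 0 = p" "range \<gamma> \<subseteq> L" "(\<gamma> has_vector_derivative v) (at 0)"
    using assms(1) by (auto simp: tangent_space_def)
  have "((\<lambda>t. f (\<gamma> t)) has_derivative (\<lambda>t. D (t *\<^sub>R v))) (at 0)"
    using has_derivative_compose[of \<gamma> "\<lambda>t. t *\<^sub>R v" 0 UNIV f D] \<gamma> assms(2)
    by (auto simp: has_vector_derivative_def)
  moreover have "(\<lambda>t. f (\<gamma> t)) = (\<lambda>t. 0)"
    using \<gamma> assms(3) by auto
  ultimately have "(\<lambda>t. D (t *\<^sub>R v)) = (\<lambda>t. 0)"
    using has_derivative_unique[OF _ has_derivative_const[of 0]] by metis
  then show ?thesis by (metis scaleR_one)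
qed


section \<open>Radial Kaehler forms\<close>

definition radial_form :: "real \<Rightarrow> real \<Rightarrow> complex ^ 4 \<Rightarrow> complex ^ 4 \<Rightarrow> complex ^ 4 \<Rightarrow> real" where
  "radial_form a b z v w =
     - 2 * (a * Im (\<Sum>j\<in>UNIV. v $ j * cnj (w $ j))
          + b * Im ((\<Sum>j\<in>UNIV. cnj (z $ j) * v $ j) * cnj (\<Sum>j\<in>UNIV. cnj (z $ j) * w $ j)))"

lemma frechet_derivative_eq_within:
  fixes f :: "'a::euclidean_space \<Rightarrow> 'b::real_normed_vector"
  assumes "(f has_derivative D) (at x within S)"
    and "\<And>i e. i \<in> Basis \<Longrightarrow> 0 < e \<Longrightarrow> \<exists>d. 0 < \<bar>d\<bar> \<and> \<bar>d\<bar> < e \<and> x + d *\<^sub>R i \<in> S"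
  shows "frechet_derivative f (at x within S) = D"
proof -
  have "(f has_derivative frechet_derivative f (at x within S)) (at x within S)"
    using assms(1) differentiable_def frechet_derivative_works by blast
  then show ?thesis using frechet_derivative_unique_within assms by blast
qed

lemma i_ddbar_radial:
  fixes U :: "real \<Rightarrow> real"
  assumes z: "z \<in> S"
    and S: "\<And>p i e. p \<in> S \<Longrightarrow> i \<in> Basis \<Longrightarrow> 0 < e \<Longrightarrow> \<exists>d. 0 < \<bar>d\<bar> \<and> \<bar>d\<bar> < e \<and> p + d *\<^sub>R i \<in> S"
    and T: "\<And>p. p \<in> S \<Longrightarrow> (norm p)\<^sup>2 \<in> T"
    and U: "\<And>s. s \<in> T \<Longrightarrow> (U has_real_derivative U' s) (at s within T)"
    and U': "\<And>s. s \<in> T \<Longrightarrow> (U' has_real_derivative U'' s) (at s within T)"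
  shows "i_ddbar S (\<lambda>z. U ((norm z)\<^sup>2)) z v w =
    of_real (radial_form (U' ((norm z)\<^sup>2)) (U'' ((norm z)\<^sup>2)) z v w)"
proof -
  have n: "((\<lambda>p. (norm p)\<^sup>2) has_derivative (\<lambda>v. 2 * (p \<bullet> v))) (at p within S)" for p :: "complex ^ 4"
    unfolding power2_norm_eq_inner by (auto intro!: derivative_eq_intros simp: inner_commute)
  have comp: "((\<lambda>p. V ((norm p)\<^sup>2)) has_derivative (\<lambda>v. V' ((norm p)\<^sup>2) * (2 * (p \<bullet> v)))) (at p within S)"
    if "p \<in> S" and V: "\<And>s. s \<in> T \<Longrightarrow> (V has_real_derivative V' s) (at s within T)" for p V V'
  proof -
    have "(V has_derivative (*) (V' ((norm p)\<^sup>2))) (at ((norm p)\<^sup>2) within (\<lambda>p. (norm p)\<^sup>2) ` S)"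
      by (rule has_derivative_subset[OF V[OF T[OF that(1)], unfolded has_field_derivative_def]]) (use T in auto)
    from has_derivative_in_compose[OF n this] show ?thesis .
  qed
  have ax: "p \<bullet> axis k c = Re (cnj c * p $ k)" for p :: "complex ^ 4" and k c
    by (simp add: inner_axis inner_complex_def algebra_simps)
  have axn: "axis j c $ k = (if k = j then c else 0)" for j k :: 4 and c :: complex
    by (auto simp: axis_def)
  have wb: "wirt_bar S k (\<lambda>p. complex_of_real (U ((norm p)\<^sup>2))) p = of_real (U' ((norm p)\<^sup>2)) * p $ k"
    if "p \<in> S" for p k
  proof -
    have "((\<lambda>p. complex_of_real (U ((norm p)\<^sup>2))) has_derivative
        (\<lambda>v. of_real (U' ((norm p)\<^sup>2) * (2 * (p \<bullet> v))))) (at p within S)"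
      using comp[OF that U] by (rule has_derivative_of_real)
    from frechet_derivative_eq_within[OF this S[OF that]] show ?thesis
      unfolding wirt_bar_def by (simp add: ax complex_eq_iff algebra_simps)
  qed
  have w: "wirt S j (wirt_bar S k (\<lambda>p. complex_of_real (U ((norm p)\<^sup>2)))) z =
      of_real (U'' ((norm z)\<^sup>2)) * z $ k * cnj (z $ j) + (if j = k then of_real (U' ((norm z)\<^sup>2)) else 0)" for j k
  proof -
    have "((\<lambda>p. complex_of_real (U' ((norm p)\<^sup>2)) * p $ k) has_derivative
        (\<lambda>v. of_real (U' ((norm z)\<^sup>2)) * v $ k + of_real (U'' ((norm z)\<^sup>2) * (2 * (z \<bullet> v))) * z $ k)) (at z within S)"
      using has_derivative_of_real[OF comp[OF z U']]
      by (auto intro!: has_derivative_mult bounded_linear_imp_has_derivative[OF bounded_linear_vec_nth])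
    then have "(wirt_bar S k (\<lambda>p. complex_of_real (U ((norm p)\<^sup>2))) has_derivative
        (\<lambda>v. of_real (U' ((norm z)\<^sup>2)) * v $ k + of_real (U'' ((norm z)\<^sup>2) * (2 * (z \<bullet> v))) * z $ k)) (at z within S)"
      by (rule has_derivative_transform[OF z wb, rotated])
    from frechet_derivative_eq_within[OF this S[OF z]] show ?thesis
      unfolding wirt_def by (auto simp: ax axn complex_eq_iff field_simps)
  qed
  let ?a = "complex_of_real (U' ((norm z)\<^sup>2))" and ?b = "complex_of_real (U'' ((norm z)\<^sup>2))"
  let ?h = "\<lambda>v. \<Sum>j\<in>UNIV. cnj (z $ j) * v $ j"
  have e: "(\<Sum>j\<in>UNIV. \<Sum>k\<in>UNIV. (?b * z $ k * cnj (z $ j) + (if j = k then ?a else 0)) * (v $ j * cnj (w $ k)))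
      = ?b * (?h v * cnj (?h w)) + ?a * (\<Sum>j\<in>UNIV. v $ j * cnj (w $ j))" for v w :: "complex ^ 4"
    by (simp add: sum_UNIV_4 algebra_simps)
  have "(\<Sum>j\<in>UNIV. \<Sum>k\<in>UNIV. (?b * z $ k * cnj (z $ j) + (if j = k then ?a else 0)) * (v $ j * cnj (w $ k) - w $ j * cnj (v $ k)))
    = (?b * (?h v * cnj (?h w)) + ?a * (\<Sum>j\<in>UNIV. v $ j * cnj (w $ j)))
    - (?b * (?h w * cnj (?h v)) + ?a * (\<Sum>j\<in>UNIV. w $ j * cnj (v $ j)))"
    unfolding right_diff_distrib sum_subtractf e ..
  also have "\<dots> = (?b * (?h v * cnj (?h w)) + ?a * (\<Sum>j\<in>UNIV. v $ j * cnj (w $ j)))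
    - cnj (?b * (?h v * cnj (?h w)) + ?a * (\<Sum>j\<in>UNIV. v $ j * cnj (w $ j)))"
    by (simp add: mult.commute)
  also have "\<i> * \<dots> = of_real (radial_form (U' ((norm z)\<^sup>2)) (U'' ((norm z)\<^sup>2)) z v w)"
    unfolding radial_form_def complex_diff_cnj by (simp add: complex_eq_iff del: cnj_sum Im_sum)
  finally show ?thesis
    unfolding i_ddbar_def w .
qed


section \<open>The Stenzel potential\<close>

definition St_G :: "real \<Rightarrow> real \<Rightarrow> real" where
  "St_G \<kappa> \<sigma> = 3 * \<kappa> / 2 * (sinh (2 * \<sigma>) / 2 - \<sigma>)"

definition du_St :: "real \<Rightarrow> real \<Rightarrow> real" where
  "du_St \<kappa> s = (if s = 1 then root 3 \<kappa> else root 3 (St_G \<kappa> (arcosh s)) / sqrt (s\<^sup>2 - 1))"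

text \<open>The value at \<open>s = 1\<close>, the zero section, is the limit of the second derivative as \<open>s\<close> tends to 1.\<close>

definition ddu_St :: "real \<Rightarrow> real \<Rightarrow> real" where
  "ddu_St \<kappa> s = (if s = 1 then - root 3 \<kappa> / 5 else
     \<kappa> / (root 3 (St_G \<kappa> (arcosh s)))\<^sup>2 - root 3 (St_G \<kappa> (arcosh s)) * s / sqrt (s\<^sup>2 - 1) ^ 3)"

lemma St_G_deriv: "(St_G \<kappa> has_real_derivative 3 * \<kappa> * (sinh \<sigma>)\<^sup>2) (at \<sigma> within S)"
proof -
  have "(\<kappa> * (3 * (cosh (\<sigma> * 2) * 2 / 2 - 1)) / 2) = 3 * \<kappa> * (sinh \<sigma>)\<^sup>2"
    using cosh_double[of \<sigma>] cosh_square_eq[of \<sigma>] by (simp add: mult.commute algebra_simps)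
  then show ?thesis
    unfolding St_G_def by (auto intro!: derivative_eq_intros simp: mult_ac)
qed

lemma St_G_0 [simp]: "St_G \<kappa> 0 = 0"
  by (simp add: St_G_def)

lemma St_G_pos:
  assumes "\<kappa> > 0" "\<sigma> > 0"
  shows "St_G \<kappa> \<sigma> > 0"
proof -
  have "St_G \<kappa> 0 < St_G \<kappa> \<sigma>"
  proof (rule DERIV_pos_imp_increasing_open[OF assms(2)])
    show "\<exists>y. (St_G \<kappa> has_real_derivative y) (at x) \<and> 0 < y" if "0 < x" for x
      using St_G_deriv[of \<kappa> x UNIV] that assms(1) by (intro exI[of _ "3 * \<kappa> * (sinh x)\<^sup>2"]) simp
    show "continuous_on {0..\<sigma>} (St_G \<kappa>)"
      using St_G_deriv by (auto intro!: continuous_at_imp_continuous_on DERIV_isCont)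
  qed
  then show ?thesis by simp
qed

lemma continuous_on_root_St_G: "continuous_on S (\<lambda>\<sigma>. root 3 (St_G \<kappa> \<sigma>))"
  unfolding St_G_def by (intro continuous_intros) auto

lemma root_St_G_eq:
  assumes "\<kappa> > 0" "\<sigma> > 0"
  shows "root 3 (St_G \<kappa> \<sigma>) = root 3 \<kappa> * (3 / 2 * (sinh (2 * \<sigma>) / 2 - \<sigma>)) powr (1 / 3)"
proof -
  have "3 / 2 * (sinh (2 * \<sigma>) / 2 - \<sigma>) > 0"
    using St_G_pos[OF _ assms(2), of 1] by (simp add: St_G_def)
  then have "root 3 (3 / 2 * (sinh (2 * \<sigma>) / 2 - \<sigma>)) = (3 / 2 * (sinh (2 * \<sigma>) / 2 - \<sigma>)) powr (1 / 3)"
    by (subst root_powr_inverse) auto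
  then show ?thesis
    using real_root_mult[of 3 \<kappa> "3 / 2 * (sinh (2 * \<sigma>) / 2 - \<sigma>)"]
    by (simp add: St_G_def algebra_simps)
qed

lemma filterlim_arcosh_at_right_1: "filterlim arcosh (at_right 0) (at_right (1::real))"
proof -
  have "eventually (\<lambda>s::real. s > 1) (at_right 1)"
    by (simp add: eventually_at_right_less)
  then have "eventually (\<lambda>s::real. arcosh s \<in> {0<..} \<and> arcosh s \<noteq> 0) (at_right 1)"
    by eventually_elim auto
  then show ?thesis
    using tendsto_arcosh_at_left_1 by (simp add: filterlim_at)
qed

lemma tendsto_root_St_G_over_sinh:
  assumes "\<kappa> > 0"
  shows "((\<lambda>\<sigma>. root 3 (St_G \<kappa> \<sigma>) / sinh \<sigma>) \<longlongrightarrow> root 3 \<kappa>) (at_right 0)"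
proof -
  have "((\<lambda>\<sigma>::real. (3 / 2 * (sinh (2 * \<sigma>) / 2 - \<sigma>)) powr (1 / 3) / sinh \<sigma>) \<longlongrightarrow> 1) (at_right 0)"
    by real_asymp
  from tendsto_mult[OF tendsto_const[of "root 3 \<kappa>"] this]
  have "((\<lambda>\<sigma>. root 3 \<kappa> * (3 / 2 * (sinh (2 * \<sigma>) / 2 - \<sigma>)) powr (1 / 3) / sinh \<sigma>) \<longlongrightarrow> root 3 \<kappa>) (at_right 0)"
    by simp
  moreover have "eventually (\<lambda>\<sigma>::real. \<sigma> > 0) (at_right 0)"
    by (simp add: eventually_at_right_less)
  then have "eventually (\<lambda>\<sigma>. root 3 \<kappa> * (3 / 2 * (sinh (2 * \<sigma>) / 2 - \<sigma>)) powr (1 / 3) / sinh \<sigma>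
      = root 3 (St_G \<kappa> \<sigma>) / sinh \<sigma>) (at_right 0)"
    by eventually_elim (simp add: root_St_G_eq[OF assms])
  ultimately show ?thesis using tendsto_cong by fast
qed

lemma tendsto_du_St_quotient:
  assumes "\<kappa> > 0"
  shows "((\<lambda>\<sigma>. (root 3 (St_G \<kappa> \<sigma>) / sinh \<sigma> - root 3 \<kappa>) / (cosh \<sigma> - 1)) \<longlongrightarrow> - root 3 \<kappa> / 5) (at_right 0)"
proof -
  have "((\<lambda>\<sigma>::real. ((3 / 2 * (sinh (2 * \<sigma>) / 2 - \<sigma>)) powr (1 / 3) / sinh \<sigma> - 1) / (cosh \<sigma> - 1)) \<longlongrightarrow> - 1 / 5) (at_right 0)"
    by real_asymp
  from tendsto_mult[OF tendsto_const[of "root 3 \<kappa>"] this]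
  have "((\<lambda>\<sigma>. root 3 \<kappa> * (((3 / 2 * (sinh (2 * \<sigma>) / 2 - \<sigma>)) powr (1 / 3) / sinh \<sigma> - 1) / (cosh \<sigma> - 1)))
      \<longlongrightarrow> - root 3 \<kappa> / 5) (at_right 0)"
    by simp
  moreover have "eventually (\<lambda>\<sigma>::real. \<sigma> > 0) (at_right 0)"
    by (simp add: eventually_at_right_less)
  then have "eventually (\<lambda>\<sigma>. root 3 \<kappa> * (((3 / 2 * (sinh (2 * \<sigma>) / 2 - \<sigma>)) powr (1 / 3) / sinh \<sigma> - 1) / (cosh \<sigma> - 1))
      = (root 3 (St_G \<kappa> \<sigma>) / sinh \<sigma> - root 3 \<kappa>) / (cosh \<sigma> - 1)) (at_right 0)"
    by eventually_elim (simp add: root_St_G_eq[OF assms] right_diff_distrib)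
  ultimately show ?thesis using tendsto_cong by fast
qed

lemma has_real_derivative_at_1_within_Ici:
  fixes f :: "real \<Rightarrow> real"
  assumes "((\<lambda>\<sigma>. (f (cosh \<sigma>) - f 1) / (cosh \<sigma> - 1)) \<longlongrightarrow> d) (at_right 0)"
  shows "(f has_real_derivative d) (at 1 within {1..})"
proof -
  have "((\<lambda>s. (f (cosh (arcosh s)) - f 1) / (cosh (arcosh s) - 1)) \<longlongrightarrow> d) (at_right 1)"
    using filterlim_compose[OF assms filterlim_arcosh_at_right_1] by simp
  moreover have "eventually (\<lambda>s::real. s > 1) (at_right 1)"
    by (simp add: eventually_at_right_less)
  then have "eventually (\<lambda>s. (f (cosh (arcosh s)) - f 1) / (cosh (arcosh s) - 1) = (f s - f 1) / (s - 1)) (at_right 1)"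
    by eventually_elim simp
  ultimately have "((\<lambda>s. (f s - f 1) / (s - 1)) \<longlongrightarrow> d) (at_right 1)"
    using tendsto_cong by fast
  then show ?thesis
    by (simp add: has_field_derivative_iff at_within_Ici_at_right)
qed

lemma u_St_deriv:
  assumes \<kappa>: "\<kappa> > 0" and s: "s \<ge> 1"
  shows "(u_St \<kappa> has_real_derivative du_St \<kappa> s) (at s within {1..})"
proof -
  define I where "I = (\<lambda>x. integral {0..x} (\<lambda>\<sigma>. root 3 (St_G \<kappa> \<sigma>)))"
  have u: "u_St \<kappa> = (\<lambda>s. I (arcosh s))"
    unfolding u_St_def I_def St_G_def ..
  have I: "(I has_real_derivative root 3 (St_G \<kappa> t)) (at t)" if "t > 0" for t
  proof -
    have "(I has_real_derivative root 3 (St_G \<kappa> t)) (at t within {0..t + 1})"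
      unfolding I_def
      by (rule integral_has_real_derivative[OF continuous_on_root_St_G]) (use that in auto)
    moreover have "at t within {0..t + 1} = at t"
      using that by (intro at_within_interior) auto
    ultimately show ?thesis by simp
  qed
  show ?thesis
  proof (cases "s = 1")
    case False
    then have "s > 1" using s by simp
    then have "((\<lambda>s. I (arcosh s)) has_real_derivative root 3 (St_G \<kappa> (arcosh s)) * (1 / sqrt (s\<^sup>2 - 1))) (at s within {1..})"
      by (intro DERIV_chain2[OF I] arcosh_real_has_field_derivative) auto
    then show ?thesis unfolding u du_St_def using False by simp
  next
    case True
    have "(I \<longlongrightarrow> I 0) (at_right 0)"
    proof -
      have "(I has_real_derivative root 3 (St_G \<kappa> 0)) (at 0 within {0..1})"
        unfolding I_def
        by (rule integral_has_real_derivative[OF continuous_on_root_St_G]) auto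
      then have "continuous (at 0 within {0..1}) I"
        by (rule DERIV_continuous)
      then show ?thesis
        by (simp add: continuous_within at_within_Icc_at_right)
    qed
    then have I0: "(I \<longlongrightarrow> 0) (at_right 0)"
      by (simp add: I_def)
    have "((\<lambda>\<sigma>. I \<sigma> / (cosh \<sigma> - 1)) \<longlongrightarrow> root 3 \<kappa>) (at_right 0)"
    proof (rule lhopital_right_0[OF I0, where f' = "\<lambda>\<sigma>. root 3 (St_G \<kappa> \<sigma>)" and g' = sinh])
      show "((\<lambda>\<sigma>::real. cosh \<sigma> - 1) \<longlongrightarrow> 0) (at_right 0)"
        by real_asymp
      have pos: "eventually (\<lambda>\<sigma>::real. \<sigma> > 0) (at_right 0)"
        by (simp add: eventually_at_right_less)
      show "eventually (\<lambda>\<sigma>::real. cosh \<sigma> - 1 \<noteq> 0) (at_right 0)"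
        using pos by eventually_elim simp
      show "eventually (\<lambda>\<sigma>::real. sinh \<sigma> \<noteq> 0) (at_right 0)"
        using pos by eventually_elim simp
      show "eventually (\<lambda>\<sigma>. (I has_real_derivative root 3 (St_G \<kappa> \<sigma>)) (at \<sigma>)) (at_right 0)"
        using pos by eventually_elim (rule I)
      show "eventually (\<lambda>\<sigma>::real. ((\<lambda>\<sigma>. cosh \<sigma> - 1) has_real_derivative sinh \<sigma>) (at \<sigma>)) (at_right 0)"
        by (auto intro!: always_eventually derivative_eq_intros)
      show "((\<lambda>\<sigma>. root 3 (St_G \<kappa> \<sigma>) / sinh \<sigma>) \<longlongrightarrow> root 3 \<kappa>) (at_right 0)"
        by (rule tendsto_root_St_G_over_sinh[OF \<kappa>])
    qed
    moreover have "eventually (\<lambda>\<sigma>. I \<sigma> / (cosh \<sigma> - 1) = (u_St \<kappa> (cosh \<sigma>) - u_St \<kappa> 1) / (cosh \<sigma> - 1)) (at_right 0)"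
      unfolding u by (rule eventually_mono[OF eventually_at_right_less]) (simp add: arcosh_cosh_real I_def)
    ultimately have "((\<lambda>\<sigma>. (u_St \<kappa> (cosh \<sigma>) - u_St \<kappa> 1) / (cosh \<sigma> - 1)) \<longlongrightarrow> root 3 \<kappa>) (at_right 0)"
      using tendsto_cong by fast
    then show ?thesis
      using True has_real_derivative_at_1_within_Ici by (simp add: du_St_def)
  qed
qed

lemma u_St'_eq:
  assumes "\<kappa> > 0" "s \<ge> 1"
  shows "u_St' \<kappa> s = du_St \<kappa> s"
proof -
  have "at s within {1..} \<noteq> bot"
    using islimpt_subset[OF islimpt_greaterThanLessThan1[of s "s + 1"], of "{1..}"] assms(2)
    by (fastforce simp: trivial_limit_within)
  then show ?thesis
    unfolding u_St'_def
    using u_St_deriv[OF assms]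
    by (intro vector_derivative_within) (simp_all add: has_real_derivative_iff_has_vector_derivative)
qed

lemma du_St_deriv:
  assumes \<kappa>: "\<kappa> > 0" and s: "s \<ge> 1"
  shows "(du_St \<kappa> has_real_derivative ddu_St \<kappa> s) (at s within {1..})"
proof (cases "s = 1")
  case True
  have "eventually (\<lambda>\<sigma>. (root 3 (St_G \<kappa> \<sigma>) / sinh \<sigma> - root 3 \<kappa>) / (cosh \<sigma> - 1)
      = (du_St \<kappa> (cosh \<sigma>) - du_St \<kappa> 1) / (cosh \<sigma> - 1)) (at_right 0)"
    by (rule eventually_mono[OF eventually_at_right_less])
      (simp add: du_St_def arcosh_cosh_real cosh_square_eq)
  then have "((\<lambda>\<sigma>. (du_St \<kappa> (cosh \<sigma>) - du_St \<kappa> 1) / (cosh \<sigma> - 1)) \<longlongrightarrow> - root 3 \<kappa> / 5) (at_right 0)"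
    using tendsto_du_St_quotient[OF \<kappa>] tendsto_cong by fast
  then show ?thesis
    using True has_real_derivative_at_1_within_Ici by (simp add: ddu_St_def)
next
  case False
  then have s: "s > 1" using s by simp
  then have q: "s\<^sup>2 - 1 > 0" by (simp add: one_less_power)
  define r where "r = root 3 (St_G \<kappa> (arcosh s))"
  define t where "t = sqrt (s\<^sup>2 - 1)"
  have G: "St_G \<kappa> (arcosh s) > 0" using St_G_pos[OF \<kappa>] s by simp
  have rt: "r > 0" "t > 0" "t\<^sup>2 = s\<^sup>2 - 1" using G q by (auto simp: r_def t_def)
  have a: "(arcosh has_real_derivative 1 / t) (at s)"
    unfolding t_def using arcosh_real_has_field_derivative[OF s] .
  have "((\<lambda>s. St_G \<kappa> (arcosh s)) has_real_derivative 3 * \<kappa> * (sinh (arcosh s))\<^sup>2 * (1 / t)) (at s)"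
    by (rule DERIV_chain2[OF St_G_deriv a])
  moreover have "3 * \<kappa> * (sinh (arcosh s))\<^sup>2 * (1 / t) = 3 * \<kappa> * t"
  proof -
    have "sinh (arcosh s) = t" using s by (simp add: sinh_arcosh_real t_def)
    then show ?thesis using rt(2) by (simp add: power2_eq_square)
  qed
  ultimately have g: "((\<lambda>s. St_G \<kappa> (arcosh s)) has_real_derivative 3 * \<kappa> * t) (at s)"
    by simp
  have "(root 3 has_real_derivative inverse (3 * r ^ 2)) (at (St_G \<kappa> (arcosh s)))"
    using DERIV_real_root[of 3, OF _ G] by (simp add: r_def numeral_2_eq_2)
  from DERIV_chain2[OF this g]
  have 1: "((\<lambda>s. root 3 (St_G \<kappa> (arcosh s))) has_real_derivative \<kappa> * t / r\<^sup>2) (at s)"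
    by (simp add: field_simps)
  have 2: "((\<lambda>s. sqrt (s\<^sup>2 - 1)) has_real_derivative s / t) (at s)"
    using q by (auto intro!: derivative_eq_intros simp: t_def divide_simps)
  have 3: "((\<lambda>s. root 3 (St_G \<kappa> (arcosh s)) / sqrt (s\<^sup>2 - 1)) has_real_derivative
      (\<kappa> * t / r\<^sup>2 * t - r * (s / t)) / (t * t)) (at s)"
    using DERIV_divide[OF 1 2] rt(2) by (simp add: r_def t_def)
  have "(\<kappa> * t / r\<^sup>2 * t - r * (s / t)) / (t * t) = ddu_St \<kappa> s"
    unfolding ddu_St_def r_def[symmetric] t_def[symmetric]
    using rt(1,2) s by (simp add: field_simps power2_eq_square power3_eq_cube)
  with 3 have "((\<lambda>s. root 3 (St_G \<kappa> (arcosh s)) / sqrt (s\<^sup>2 - 1)) has_real_derivative ddu_St \<kappa> s) (at s)"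
    by simp
  then have "(du_St \<kappa> has_real_derivative ddu_St \<kappa> s) (at s)"
    by (rule has_field_derivative_transform_within_open[where S = "{1<..}"])
      (use s in \<open>auto simp: du_St_def\<close>)
  then show ?thesis by (rule has_field_derivative_at_within)
qed

lemma du_St_pos:
  assumes "\<kappa> > 0" "s \<ge> 1"
  shows "du_St \<kappa> s > 0"
proof (cases "s = 1")
  case False
  then have "s > 1" using assms by simp
  then have "s\<^sup>2 - 1 > 0" by (simp add: one_less_power)
  then show ?thesis
    using False St_G_pos[OF assms(1), of "arcosh s"] \<open>s > 1\<close> by (simp add: du_St_def)
qed (use assms in \<open>simp add: du_St_def\<close>)

lemma St_G_less:
  assumes "\<kappa> > 0" "\<sigma> > 0"
  shows "St_G \<kappa> \<sigma> < \<kappa> * (sinh \<sigma> ^ 3 * cosh \<sigma>)"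
proof -
  define F where "F = (\<lambda>\<sigma>. \<kappa> * (sinh \<sigma> ^ 3 * cosh \<sigma>) - St_G \<kappa> \<sigma>)"
  have D: "(F has_real_derivative 4 * \<kappa> * sinh x ^ 4) (at x)" for x
  proof -
    have "(F has_real_derivative \<kappa> * (3 * sinh x ^ 2 * cosh x * cosh x + sinh x ^ 3 * sinh x) - 3 * \<kappa> * (sinh x)\<^sup>2) (at x)"
      unfolding F_def by (auto intro!: derivative_eq_intros St_G_deriv)
    moreover have "\<kappa> * (3 * sinh x ^ 2 * cosh x * cosh x + sinh x ^ 3 * sinh x) - 3 * \<kappa> * (sinh x)\<^sup>2 = 4 * \<kappa> * sinh x ^ 4"
    proof -
      have "cosh x * cosh x = 1 + sinh x * sinh x"
        using cosh_square_eq[of x] by (simp add: power2_eq_square)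
      then show ?thesis by (simp add: mult.assoc) (simp add: algebra_simps power2_eq_square power3_eq_cube power4_eq_xxxx)
    qed
    ultimately show ?thesis by simp
  qed
  have "F 0 < F \<sigma>"
  proof (rule DERIV_pos_imp_increasing_open[OF assms(2)])
    show "\<exists>y. (F has_real_derivative y) (at x) \<and> 0 < y" if "0 < x" for x
      using D[of x] that assms(1) by (intro exI[of _ "4 * \<kappa> * sinh x ^ 4"]) simp
    show "continuous_on {0..\<sigma>} F"
      using D by (auto intro!: continuous_at_imp_continuous_on DERIV_isCont)
  qed
  then show ?thesis by (simp add: F_def)
qed

lemma du_St_ddu_St_pos:
  assumes \<kappa>: "\<kappa> > 0" and s: "s \<ge> 1"
  shows "du_St \<kappa> s + s * ddu_St \<kappa> s > 0"
proof (cases "s = 1")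
  case False
  then have s: "s > 1" using s by simp
  then have q: "s\<^sup>2 - 1 > 0" by (simp add: one_less_power)
  define r where "r = root 3 (St_G \<kappa> (arcosh s))"
  define t where "t = sqrt (s\<^sup>2 - 1)"
  have G: "St_G \<kappa> (arcosh s) > 0" using St_G_pos[OF \<kappa>] s by simp
  have rt: "r > 0" "t > 0" "t\<^sup>2 = s\<^sup>2 - 1" using G q by (auto simp: r_def t_def)
  have r3: "r ^ 3 = St_G \<kappa> (arcosh s)" unfolding r_def by (rule real_root_pow_pos2) (use G in auto)
  have "r ^ 3 < \<kappa> * (t ^ 3 * s)"
    using St_G_less[OF \<kappa>, of "arcosh s"] s by (simp add: r3 sinh_arcosh_real t_def)
  moreover have "du_St \<kappa> s + s * ddu_St \<kappa> s = (\<kappa> * (t ^ 3 * s) - r ^ 3) / (r\<^sup>2 * t ^ 3)"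
  proof -
    have "du_St \<kappa> s + s * ddu_St \<kappa> s = r / t + s * (\<kappa> / r\<^sup>2 - r * s / t ^ 3)"
      using False by (simp add: du_St_def ddu_St_def r_def t_def)
    also have "\<dots> = (r ^ 3 * t\<^sup>2 + \<kappa> * (t ^ 3 * s) - r ^ 3 * s\<^sup>2) / (r\<^sup>2 * t ^ 3)"
      using rt(1,2) by (simp add: field_simps power2_eq_square power3_eq_cube)
    also have "\<dots> = (\<kappa> * (t ^ 3 * s) - r ^ 3) / (r\<^sup>2 * t ^ 3)"
      unfolding rt(3) by (simp add: algebra_simps)
    finally show ?thesis .
  qed
  ultimately show ?thesis using rt by simp
qed (use \<kappa> in \<open>simp add: du_St_def ddu_St_def\<close>)

lemma filterlim_du_St_mult:
  assumes "\<kappa> > 0"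
  shows "filterlim (\<lambda>s. sqrt (s\<^sup>2 - 1) * du_St \<kappa> s) at_top at_top"
proof -
  have "filterlim (\<lambda>\<sigma>::real. \<kappa> * (3 / 2 * (sinh (2 * \<sigma>) / 2 - \<sigma>))) at_top at_top"
    by (rule filterlim_tendsto_pos_mult_at_top[OF tendsto_const assms]) real_asymp
  then have "filterlim (St_G \<kappa>) at_top at_top"
    by (simp add: St_G_def[abs_def] algebra_simps)
  moreover have "filterlim (root 3) at_top at_top"
    by real_asymp
  ultimately have "filterlim (\<lambda>s. root 3 (St_G \<kappa> (arcosh s))) at_top at_top"
    using filterlim_compose[OF _ filterlim_compose[OF _ arcosh_real_at_top]] by blast
  moreover have "eventually (\<lambda>s. root 3 (St_G \<kappa> (arcosh s)) = sqrt (s\<^sup>2 - 1) * du_St \<kappa> s) at_top"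
    using eventually_gt_at_top[of 1]
  proof eventually_elim
    case (elim s)
    then have "s\<^sup>2 - 1 > 0" by (simp add: one_less_power)
    then show ?case using elim by (auto simp: du_St_def power2_eq_1_iff)
  qed
  ultimately show ?thesis
    using filterlim_cong by fast
qed


section \<open>Tangent vectors of the level sets\<close>

definition rot_field1 :: "complex ^ 4 \<Rightarrow> complex ^ 4" where
  "rot_field1 z = vec4 (- z $ 1) (z $ 0) 0 0"

definition rot_field2 :: "complex ^ 4 \<Rightarrow> complex ^ 4" where
  "rot_field2 z = vec4 0 0 (- z $ 3) (z $ 2)"

text \<open>The derivative of \<open>u'(|z|\<^sup>2) Im (z\<^sub>j cnj z\<^sub>k)\<close> in terms of the values \<open>a\<close>, \<open>b\<close> of \<open>u'\<close>, \<open>u''\<close>.\<close>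

definition dmoment :: "real \<Rightarrow> real \<Rightarrow> 4 \<Rightarrow> 4 \<Rightarrow> complex ^ 4 \<Rightarrow> complex ^ 4 \<Rightarrow> real" where
  "dmoment a b j k z v =
     a * Im (v $ j * cnj (z $ k) + z $ j * cnj (v $ k)) + b * (2 * (z \<bullet> v)) * Im (z $ j * cnj (z $ k))"

definition L_tangent :: "real \<Rightarrow> real \<Rightarrow> complex ^ 4 \<Rightarrow> (complex ^ 4) set" where
  "L_tangent a b z = {v. (\<Sum>j\<in>UNIV. z $ j * v $ j) = 0 \<and> Im (z $ 0 * v $ 0 + z $ 1 * v $ 1) = 0 \<and>
     dmoment a b 0 1 z v = 0 \<and> dmoment a b 2 3 z v = 0}"

lemma cmod_sq_sum_squares:
  fixes x y :: complex
  shows "((cmod x)\<^sup>2 + (cmod y)\<^sup>2)\<^sup>2 = (cmod (x\<^sup>2 + y\<^sup>2))\<^sup>2 + 4 * (Im (x * cnj y))\<^sup>2"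
  unfolding cmod_power2 by (simp add: power2_eq_square algebra_simps)

lemma Im_mult_cnj_le: "4 * (Im (x * cnj y))\<^sup>2 \<le> ((cmod x)\<^sup>2 + (cmod y)\<^sup>2)\<^sup>2"
  unfolding cmod_sq_sum_squares by simp

lemma moment_matrix_det_pos:
  fixes a b A B m n :: real
  assumes "a > 0" "a + (A + B) * b > 0" "A > 0" "B > 0" "4 * m\<^sup>2 \<le> A\<^sup>2" "4 * n\<^sup>2 \<le> B\<^sup>2"
  shows "(a * A + 4 * b * m\<^sup>2) * (a * B + 4 * b * n\<^sup>2) - (4 * b * m * n)\<^sup>2 > 0"
proof -
  let ?s = "4 * (A * n\<^sup>2 + B * m\<^sup>2)"
  have "B * (4 * m\<^sup>2) \<le> B * A\<^sup>2" "A * (4 * n\<^sup>2) \<le> A * B\<^sup>2"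
    using assms by (auto intro: mult_left_mono simp del: mult_le_cancel_left_pos)
  then have s: "?s \<le> A * B * (A + B)"
    by (simp add: power2_eq_square algebra_simps)
  have "a * A * B + b * ?s > 0"
  proof (cases "b \<ge> 0")
    case True
    then have "b * ?s \<ge> 0" using assms by auto
    then show ?thesis using assms by (simp add: add_pos_nonneg)
  next
    case False
    then have "b * ?s \<ge> b * (A * B * (A + B))"
      using s by (intro mult_left_mono_neg) auto
    moreover have "a * A * B + b * (A * B * (A + B)) = A * B * (a + (A + B) * b)"
      by (simp add: algebra_simps)
    moreover have "A * B * (a + (A + B) * b) > 0" using assms by simp
    ultimately show ?thesis by linarith
  qed
  moreover have "(a * A + 4 * b * m\<^sup>2) * (a * B + 4 * b * n\<^sup>2) - (4 * b * m * n)\<^sup>2 = a * (a * A * B + b * ?s)"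
    by (simp add: power2_eq_square algebra_simps)
  ultimately show ?thesis using assms(1) by simp
qed

lemma symmetric_system_solvable:
  fixes p q r :: real
  assumes "p * r - q\<^sup>2 \<noteq> 0"
  shows "\<exists>x y. p * x + q * y = s \<and> q * x + r * y = t"
proof (intro exI conjI)
  let ?d = "p * r - q\<^sup>2"
  have "p * ((r * s - q * t) / ?d) + q * ((p * t - q * s) / ?d) = (p * (r * s - q * t) + q * (p * t - q * s)) / ?d"
    by (simp add: add_divide_distrib)
  also have "p * (r * s - q * t) + q * (p * t - q * s) = s * ?d"
    by (simp add: power2_eq_square algebra_simps)
  finally show "p * ((r * s - q * t) / ?d) + q * ((p * t - q * s) / ?d) = s"
    using assms by simp
  have "q * ((r * s - q * t) / ?d) + r * ((p * t - q * s) / ?d) = (q * (r * s - q * t) + r * (p * t - q * s)) / ?d"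
    by (simp add: add_divide_distrib)
  also have "q * (r * s - q * t) + r * (p * t - q * s) = t * ?d"
    by (simp add: power2_eq_square algebra_simps)
  finally show "q * ((r * s - q * t) / ?d) + r * ((p * t - q * s) / ?d) = t"
    using assms by simp
qed

lemma symmetric_system_unique:
  fixes p q r :: real
  assumes "p * r - q\<^sup>2 \<noteq> 0" "p * x + q * y = 0" "q * x + r * y = 0"
  shows "x = 0" "y = 0"
proof -
  have "(p * r - q\<^sup>2) * x = r * (p * x + q * y) - q * (q * x + r * y)"
    by (simp add: power2_eq_square algebra_simps)
  then show "x = 0" using assms by simp
  have "(p * r - q\<^sup>2) * y = p * (q * x + r * y) - q * (p * x + q * y)"
    by (simp add: power2_eq_square algebra_simps)
  then show "y = 0" using assms by simp
qed

text \<open>The Gram matrix of the two rotation fields in the Kaehler metric.\<close>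

definition gram_diag :: "real \<Rightarrow> real \<Rightarrow> 4 \<Rightarrow> 4 \<Rightarrow> complex ^ 4 \<Rightarrow> real" where
  "gram_diag a b j k z = a * ((cmod (z $ j))\<^sup>2 + (cmod (z $ k))\<^sup>2) + 4 * b * (Im (z $ j * cnj (z $ k)))\<^sup>2"

definition gram_off :: "real \<Rightarrow> complex ^ 4 \<Rightarrow> real" where
  "gram_off b z = 4 * b * Im (z $ 0 * cnj (z $ 1)) * Im (z $ 2 * cnj (z $ 3))"

lemma dmoment_rot:
  fixes \<alpha> \<beta> :: complex
  defines "v \<equiv> \<lambda>z. \<alpha> *s rot_field1 z + \<beta> *s rot_field2 z"
  shows "dmoment a b 0 1 z (v z) =
      - (gram_diag a b 0 1 z * Im \<alpha>
        + gram_off b z * Im \<beta>)"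
    "dmoment a b 2 3 z (v z) =
      - (gram_off b z * Im \<alpha>
        + gram_diag a b 2 3 z * Im \<beta>)"
  unfolding dmoment_def v_def rot_field1_def rot_field2_def inner_4 gram_diag_def gram_off_def cmod_power2
  by (simp_all add: power2_eq_square algebra_simps)

lemma dmoment_add: "dmoment a b j k z (v + w) = dmoment a b j k z v + dmoment a b j k z w"
  by (simp add: dmoment_def inner_add_right algebra_simps)

lemma dmoment_scaleR: "dmoment a b j k z (c *\<^sub>R v) = c * dmoment a b j k z v"
  by (simp add: dmoment_def algebra_simps)

lemma dmoment_minus: "dmoment a b j k z (v - w) = dmoment a b j k z v - dmoment a b j k z w"
  by (simp add: dmoment_def inner_diff_right algebra_simps)

lemma L_tangent_diff:
  assumes "v \<in> L_tangent a b z" "w \<in> L_tangent a b z"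
  shows "v - w \<in> L_tangent a b z"
proof -
  have "(\<Sum>j\<in>UNIV. z $ j * (v - w) $ j) = (\<Sum>j\<in>UNIV. z $ j * v $ j) - (\<Sum>j\<in>UNIV. z $ j * w $ j)"
    by (simp add: right_diff_distrib sum_subtractf)
  moreover have "Im (z $ 0 * (v - w) $ 0 + z $ 1 * (v - w) $ 1)
      = Im (z $ 0 * v $ 0 + z $ 1 * v $ 1) - Im (z $ 0 * w $ 0 + z $ 1 * w $ 1)"
    by (simp add: algebra_simps)
  ultimately show ?thesis using assms unfolding L_tangent_def by (simp only: mem_Collect_eq dmoment_minus) simp
qed

lemma L_tangent_scaleR:
  assumes "v \<in> L_tangent a b z"
  shows "c *\<^sub>R v \<in> L_tangent a b z"
proof -
  have "(\<Sum>j\<in>UNIV. z $ j * (c *\<^sub>R v) $ j) = c *\<^sub>R (\<Sum>j\<in>UNIV. z $ j * v $ j)"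
    by (simp add: scaleR_sum_right)
  moreover have "Im (z $ 0 * (c *\<^sub>R v) $ 0 + z $ 1 * (c *\<^sub>R v) $ 1) = c * Im (z $ 0 * v $ 0 + z $ 1 * v $ 1)"
    by (simp add: algebra_simps)
  ultimately show ?thesis using assms unfolding L_tangent_def by (simp only: mem_Collect_eq dmoment_scaleR) simp
qed

locale free_point =
  fixes z :: "complex ^ 4" and a b :: real
  assumes free: "z \<notin> non_free_locus" and a: "a > 0" and ab: "a + (norm z)\<^sup>2 * b > 0"
begin

lemma moduli_pos: "(cmod (z $ 0))\<^sup>2 + (cmod (z $ 1))\<^sup>2 > 0" "(cmod (z $ 2))\<^sup>2 + (cmod (z $ 3))\<^sup>2 > 0"
  using free unfolding non_free_locus_def by (auto simp: sum_power2_gt_zero_iff)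

lemma moment_matrix_det_nonzero:
  "gram_diag a b 0 1 z
   * gram_diag a b 2 3 z
   - (gram_off b z)\<^sup>2 \<noteq> 0"
  using moment_matrix_det_pos[OF a _ moduli_pos Im_mult_cnj_le Im_mult_cnj_le, of b] ab
  unfolding gram_diag_def gram_off_def by (simp add: norm_sq_4 algebra_simps)

lemma rot_field_coeffs:
  assumes "z $ 0 * v $ 0 + z $ 1 * v $ 1 = 0" "z $ 2 * v $ 2 + z $ 3 * v $ 3 = 0"
  shows "\<exists>\<alpha> \<beta>. v = \<alpha> *s rot_field1 z + \<beta> *s rot_field2 z"
proof -
  have pair: "\<exists>\<alpha>. p = - \<alpha> * y \<and> q = \<alpha> * x" if "x * p + y * q = 0" "(cmod x)\<^sup>2 + (cmod y)\<^sup>2 > 0" for x y p q :: complex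
  proof (cases "x = 0")
    case True
    then show ?thesis using that by (intro exI[of _ "- p / y"]) auto
  next
    case False
    have "x * p = - q * y" using that(1) by (simp add: eq_neg_iff_add_eq_0 mult.commute)
    then show ?thesis using False by (intro exI[of _ "q / x"]) (simp add: field_simps)
  qed
  from pair[OF assms(1) moduli_pos(1)] pair[OF assms(2) moduli_pos(2)]
  obtain \<alpha> \<beta> where "v $ 0 = - \<alpha> * z $ 1" "v $ 1 = \<alpha> * z $ 0" "v $ 2 = - \<beta> * z $ 3" "v $ 3 = \<beta> * z $ 2"
    by blast
  then have "v = \<alpha> *s rot_field1 z + \<beta> *s rot_field2 z"
    by (intro vec4_eqI) (simp_all add: rot_field1_def rot_field2_def)
  then show ?thesis by blast
qed

lemma L_tangent_rot_fields:
  assumes "v \<in> L_tangent a b z" "z $ 0 * v $ 0 + z $ 1 * v $ 1 = 0"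
  shows "\<exists>x y. v = x *\<^sub>R rot_field1 z + y *\<^sub>R rot_field2 z"
proof -
  have "z $ 2 * v $ 2 + z $ 3 * v $ 3 = 0"
    using assms by (simp add: L_tangent_def sum_UNIV_4)
  from rot_field_coeffs[OF assms(2) this] obtain \<alpha> \<beta> where v: "v = \<alpha> *s rot_field1 z + \<beta> *s rot_field2 z"
    by blast
  have d: "dmoment a b 0 1 z v = 0" "dmoment a b 2 3 z v = 0"
    using assms by (simp_all add: L_tangent_def)
  note im = symmetric_system_unique[OF moment_matrix_det_nonzero d[unfolded v dmoment_rot neg_equal_0_iff_equal]]
  from im have re: "\<alpha> = of_real (Re \<alpha>)" "\<beta> = of_real (Re \<beta>)"
    by (simp_all add: complex_eq_iff)
  have sm: "complex_of_real r *s p = r *\<^sub>R p" for r and p :: "complex ^ 4"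
    by (simp add: vec_eq_iff scaleR_conv_of_real[where 'a = complex])
  have "v = Re \<alpha> *\<^sub>R rot_field1 z + Re \<beta> *\<^sub>R rot_field2 z"
    unfolding v sm[symmetric] re[symmetric] ..
  then show ?thesis by blast
qed

lemma L_tangent_basis:
  "\<exists>e \<in> L_tangent a b z. \<forall>v \<in> L_tangent a b z. \<exists>x y c. v = x *\<^sub>R rot_field1 z + y *\<^sub>R rot_field2 z + c *\<^sub>R e"
proof (cases "\<forall>v \<in> L_tangent a b z. z $ 0 * v $ 0 + z $ 1 * v $ 1 = 0")
  case True
  have "0 \<in> L_tangent a b z" by (simp add: L_tangent_def dmoment_def)
  moreover have "\<exists>x y c. v = x *\<^sub>R rot_field1 z + y *\<^sub>R rot_field2 z + c *\<^sub>R 0" if "v \<in> L_tangent a b z" for v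
    using L_tangent_rot_fields[OF that] True that by simp
  ultimately show ?thesis by blast
next
  case False
  then obtain e where e: "e \<in> L_tangent a b z" "z $ 0 * e $ 0 + z $ 1 * e $ 1 \<noteq> 0" by blast
  define l where "l = (\<lambda>v :: complex ^ 4. Re (z $ 0 * v $ 0 + z $ 1 * v $ 1))"
  have l: "z $ 0 * v $ 0 + z $ 1 * v $ 1 = of_real (l v)" if "v \<in> L_tangent a b z" for v
    using that by (simp add: L_tangent_def l_def complex_eq_iff)
  have le: "l e \<noteq> 0" using e l by auto
  have "\<exists>x y c. v = x *\<^sub>R rot_field1 z + y *\<^sub>R rot_field2 z + c *\<^sub>R e" if v: "v \<in> L_tangent a b z" for v
  proof -
    let ?w = "v - (l v / l e) *\<^sub>R e"
    have "?w \<in> L_tangent a b z"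
      using v e(1) by (intro L_tangent_diff L_tangent_scaleR)
    moreover have "z $ 0 * ?w $ 0 + z $ 1 * ?w $ 1 = 0"
    proof -
      have "z $ 0 * ?w $ 0 + z $ 1 * ?w $ 1
          = (z $ 0 * v $ 0 + z $ 1 * v $ 1) - of_real (l v / l e) * (z $ 0 * e $ 0 + z $ 1 * e $ 1)"
        by (simp add: scaleR_conv_of_real[where 'a = complex] algebra_simps)
      also have "\<dots> = 0" unfolding l[OF v] l[OF e(1)] using le by simp
      finally show ?thesis .
    qed
    ultimately obtain x y where "?w = x *\<^sub>R rot_field1 z + y *\<^sub>R rot_field2 z"
      using L_tangent_rot_fields by blast
    then have "v = x *\<^sub>R rot_field1 z + y *\<^sub>R rot_field2 z + (l v / l e) *\<^sub>R e"
      by (simp add: diff_eq_eq)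
    then show ?thesis by blast
  qed
  then show ?thesis using e(1) by blast
qed

lemma defining_forms_surj:
  "\<exists>v. 2 * (\<Sum>j\<in>UNIV. z $ j * v $ j) = c \<and> 2 * Im (z $ 0 * v $ 0 + z $ 1 * v $ 1) = y \<and>
     dmoment a b 0 1 z v = s \<and> dmoment a b 2 3 z v = t"
proof -
  define A B where AB: "A = (cmod (z $ 0))\<^sup>2 + (cmod (z $ 1))\<^sup>2" "B = (cmod (z $ 2))\<^sup>2 + (cmod (z $ 3))\<^sup>2"
  have "A \<noteq> 0" "B \<noteq> 0" using moduli_pos unfolding AB by linarith+
  then have AB0: "complex_of_real A \<noteq> 0" "complex_of_real B \<noteq> 0" by simp_all
  define l1 l2 where l: "l1 = \<i> * of_real (y / 2) / of_real A" "l2 = (c / 2 - \<i> * of_real (y / 2)) / of_real B"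
  define w where "w = vec4 (l1 * cnj (z $ 0)) (l1 * cnj (z $ 1)) (l2 * cnj (z $ 2)) (l2 * cnj (z $ 3))"
  have A: "z $ 0 * cnj (z $ 0) + z $ 1 * cnj (z $ 1) = of_real A"
    and B: "z $ 2 * cnj (z $ 2) + z $ 3 * cnj (z $ 3) = of_real B"
    unfolding AB by (simp_all only: of_real_add complex_norm_square)
  have "z $ 0 * w $ 0 + z $ 1 * w $ 1 = l1 * (z $ 0 * cnj (z $ 0) + z $ 1 * cnj (z $ 1))"
    unfolding w_def by (simp add: algebra_simps)
  then have w1: "z $ 0 * w $ 0 + z $ 1 * w $ 1 = \<i> * of_real (y / 2)"
    unfolding A l using AB0 by simp
  have "z $ 2 * w $ 2 + z $ 3 * w $ 3 = l2 * (z $ 2 * cnj (z $ 2) + z $ 3 * cnj (z $ 3))"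
    unfolding w_def by (simp add: algebra_simps)
  then have w2: "z $ 2 * w $ 2 + z $ 3 * w $ 3 = c / 2 - \<i> * of_real (y / 2)"
    unfolding B l using AB0 by simp
  obtain p q where pq:
    "gram_diag a b 0 1 z * p
       + gram_off b z * q = dmoment a b 0 1 z w - s"
    "gram_off b z * p
       + gram_diag a b 2 3 z * q = dmoment a b 2 3 z w - t"
    using symmetric_system_solvable[OF moment_matrix_det_nonzero] by blast
  let ?r = "Complex 0 p *s rot_field1 z + Complex 0 q *s rot_field2 z"
  have "dmoment a b 0 1 z (w + ?r) = s" "dmoment a b 2 3 z (w + ?r) = t"
    by (simp_all only: dmoment_add[where v = w] dmoment_rot complex.sel pq)
  moreover have "z $ 0 * (w + ?r) $ 0 + z $ 1 * (w + ?r) $ 1 = \<i> * of_real (y / 2)"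
    using w1 by (simp add: rot_field1_def rot_field2_def algebra_simps)
  moreover have "z $ 2 * (w + ?r) $ 2 + z $ 3 * (w + ?r) $ 3 = c / 2 - \<i> * of_real (y / 2)"
    using w2 by (simp add: rot_field1_def rot_field2_def algebra_simps)
  ultimately show ?thesis
    by (intro exI[of _ "w + ?r"]) (simp only: sum_UNIV_4, simp add: add.assoc)
qed

end

lemma radial_form_add_left: "radial_form a b z (v + v') w = radial_form a b z v w + radial_form a b z v' w"
  unfolding radial_form_def
  by (simp only: vector_add_component distrib_left distrib_right sum.distrib plus_complex.sel add_ac)

lemma radial_form_scaleR_left: "radial_form a b z (c *\<^sub>R v) w = c * radial_form a b z v w"
proof -
  have "(\<Sum>j\<in>UNIV. (c *\<^sub>R v) $ j * cnj (w $ j)) = c *\<^sub>R (\<Sum>j\<in>UNIV. v $ j * cnj (w $ j))"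
    "(\<Sum>j\<in>UNIV. cnj (z $ j) * (c *\<^sub>R v) $ j) = c *\<^sub>R (\<Sum>j\<in>UNIV. cnj (z $ j) * v $ j)"
    by (simp_all add: scaleR_sum_right)
  then show ?thesis
    unfolding radial_form_def mult_scaleR_left by (simp only: mult_scaleR_left scaleR_complex.sel) argo
qed

lemma radial_form_swap: "radial_form a b z v w = - radial_form a b z w v"
proof -
  let ?h = "\<lambda>v. \<Sum>j\<in>UNIV. cnj (z $ j) * v $ j"
  have "(\<Sum>j\<in>UNIV. v $ j * cnj (w $ j)) = cnj (\<Sum>j\<in>UNIV. w $ j * cnj (v $ j))"
    "?h v * cnj (?h w) = cnj (?h w * cnj (?h v))"
    by (simp_all add: mult.commute)
  then show ?thesis
    unfolding radial_form_def by (simp only: cnj.simps(2)) argo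
qed

lemma radial_form_add_right: "radial_form a b z v (w + w') = radial_form a b z v w + radial_form a b z v w'"
  using radial_form_add_left radial_form_swap by (metis add.inverse_distrib_swap add.commute)

lemma radial_form_scaleR_right: "radial_form a b z v (c *\<^sub>R w) = c * radial_form a b z v w"
  using radial_form_scaleR_left radial_form_swap by (metis mult_minus_right)

lemma radial_form_self: "radial_form a b z v v = 0"
  using radial_form_swap[of a b z v v] by simp

lemma radial_form_rot_field:
  "radial_form a b z (rot_field1 z) v = - 2 * dmoment a b 0 1 z v"
  "radial_form a b z (rot_field2 z) v = - 2 * dmoment a b 2 3 z v"
  unfolding radial_form_def dmoment_def rot_field1_def rot_field2_def inner_4
  by (simp_all add: sum_UNIV_4 algebra_simps)

lemma dmoment_rot_field2: "dmoment a b 0 1 z (rot_field2 z) = 0"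
  unfolding dmoment_def rot_field2_def inner_4 
  by (simp add: algebra_simps)

lemma (in free_point) radial_form_L_tangent:
  assumes "v \<in> L_tangent a b z" "w \<in> L_tangent a b z"
  shows "radial_form a b z v w = 0"
proof -
  obtain e where e: "e \<in> L_tangent a b z"
    and "\<And>v. v \<in> L_tangent a b z \<Longrightarrow> \<exists>x y c. v = x *\<^sub>R rot_field1 z + y *\<^sub>R rot_field2 z + c *\<^sub>R e"
    using L_tangent_basis by blast
  then obtain x y c x' y' c' where v: "v = x *\<^sub>R rot_field1 z + y *\<^sub>R rot_field2 z + c *\<^sub>R e"
    and w: "w = x' *\<^sub>R rot_field1 z + y' *\<^sub>R rot_field2 z + c' *\<^sub>R e"
    using assms by metis
  have e0: "dmoment a b 0 1 z e = 0" "dmoment a b 2 3 z e = 0"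
    using e by (simp_all add: L_tangent_def)
  have 0: "radial_form a b z (rot_field1 z) (rot_field2 z) = 0" "radial_form a b z (rot_field1 z) e = 0"
    "radial_form a b z (rot_field2 z) e = 0"
    by (simp_all add: radial_form_rot_field e0) (metis dmoment_rot_field2)
  then have "radial_form a b z (rot_field2 z) (rot_field1 z) = 0" "radial_form a b z e (rot_field1 z) = 0"
    "radial_form a b z e (rot_field2 z) = 0"
    by (metis radial_form_swap neg_equal_0_iff_equal)+
  with 0 show ?thesis unfolding v w
    by (simp add: radial_form_add_left radial_form_add_right radial_form_scaleR_left radial_form_scaleR_right radial_form_self)
qed

lemma vol4_rot_fields:
  "vol4 z (rot_field1 z) (rot_field2 z) e =
     (z $ 2 ^ 2 + z $ 3 ^ 2) * (z $ 0 * e $ 0 + z $ 1 * e $ 1)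
     - (z $ 0 ^ 2 + z $ 1 ^ 2) * (z $ 2 * e $ 2 + z $ 3 * e $ 3)"
  unfolding vol4_def det_4 vec4_nth rot_field1_def rot_field2_def
  by (simp add: power2_eq_square algebra_simps)

lemma vol4_combination:
  "vol4 z (x1 *\<^sub>R p + y1 *\<^sub>R q + c1 *\<^sub>R e) (x2 *\<^sub>R p + y2 *\<^sub>R q + c2 *\<^sub>R e) (x3 *\<^sub>R p + y3 *\<^sub>R q + c3 *\<^sub>R e)
   = of_real (x1 * (y2 * c3 - c2 * y3) - y1 * (x2 * c3 - c2 * x3) + c1 * (x2 * y3 - y2 * x3)) * vol4 z p q e"
proof -
  define M :: "complex^4^4" where
    "M = vec4 (vec4 1 0 0 0) (vec4 0 (of_real x1) (of_real y1) (of_real c1))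
      (vec4 0 (of_real x2) (of_real y2) (of_real c2)) (vec4 0 (of_real x3) (of_real y3) (of_real c3))"
  have "vec4 z (x1 *\<^sub>R p + y1 *\<^sub>R q + c1 *\<^sub>R e) (x2 *\<^sub>R p + y2 *\<^sub>R q + c2 *\<^sub>R e) (x3 *\<^sub>R p + y3 *\<^sub>R q + c3 *\<^sub>R e)
      = M ** vec4 z p q e"
    by (simp add: vec_eq_iff all_4 matrix_matrix_mult_def M_def sum_UNIV_4 scaleR_conv_of_real[where 'a = complex])
  moreover have "det M = of_real (x1 * (y2 * c3 - c2 * y3) - y1 * (x2 * c3 - c2 * x3) + c1 * (x2 * y3 - y2 * x3))"
    unfolding M_def det_4 vec4_nth by (simp add: algebra_simps)
  ultimately show ?thesis unfolding vol4_def by (simp add: det_mul)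
qed

lemma (in free_point) Im_vol4_L_tangent:
  assumes "quad z = 1"
    and "v1 \<in> L_tangent a b z" "v2 \<in> L_tangent a b z" "v3 \<in> L_tangent a b z"
  shows "Im (vol4 z v1 v2 v3) = 0"
proof -
  obtain e where e: "e \<in> L_tangent a b z"
    and *: "\<And>v. v \<in> L_tangent a b z \<Longrightarrow> \<exists>x y c. v = x *\<^sub>R rot_field1 z + y *\<^sub>R rot_field2 z + c *\<^sub>R e"
    using L_tangent_basis by blast
  obtain r :: real where r: "vol4 z v1 v2 v3 = of_real r * vol4 z (rot_field1 z) (rot_field2 z) e"
    using *[OF assms(2)] *[OF assms(3)] *[OF assms(4)] vol4_combination by metis
  have sw: "z $ 2 * e $ 2 + z $ 3 * e $ 3 = - (z $ 0 * e $ 0 + z $ 1 * e $ 1)"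
    using e by (simp add: L_tangent_def sum_UNIV_4 eq_neg_iff_add_eq_0 algebra_simps)
  have "vol4 z (rot_field1 z) (rot_field2 z) e = quad z * (z $ 0 * e $ 0 + z $ 1 * e $ 1)"
    unfolding vol4_rot_fields quad_def sw by (simp add: algebra_simps)
  then show ?thesis using e assms(1) unfolding r by (simp add: L_tangent_def)
qed


section \<open>The family is special Lagrangian\<close>

lemma all_5: "(\<forall>i::5. P i) \<longleftrightarrow> P 0 \<and> P 1 \<and> P 2 \<and> P 3 \<and> P 4"
proof -
  have "i = 0 \<or> i = 1 \<or> i = 2 \<or> i = 3 \<or> i = 4" for i :: 5
  proof (induct i)
    case (of_int z)
    then have "0 \<le> z" "z < 5" by simp_all
    then have "z = 0 \<or> z = 1 \<or> z = 2 \<or> z = 3 \<or> z = 4" by arith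
    then show ?case by auto
  qed
  then show ?thesis by metis
qed

definition sel5 :: "'a \<Rightarrow> 'a \<Rightarrow> 'a \<Rightarrow> 'a \<Rightarrow> 'a \<Rightarrow> 5 \<Rightarrow> 'a" where
  "sel5 a b c d e i = (if i = 0 then a else if i = 1 then b else if i = 2 then c else if i = 3 then d else e)"

lemma sel5_simps [simp]:
  "sel5 a b c d e 0 = a" "sel5 a b c d e 1 = b" "sel5 a b c d e 2 = c" "sel5 a b c d e 3 = d" "sel5 a b c d e 4 = e"
  by (simp_all add: sel5_def)

lemma smooth_on_subset:
  assumes "smooth_on W f" "U \<subseteq> W"
  shows "smooth_on U f"
proof -
  have "Ck_on k U f" if "Ck_on k W f" for k and f :: "'a \<Rightarrow> 'b"
    using that assms(2) by (induction k arbitrary: f) (auto intro: continuous_on_subset)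
  then show ?thesis using assms(1) by (simp add: smooth_on_def)
qed

lemma smooth_on_Re_nth: "smooth_on U (\<lambda>z :: complex ^ 4. Re (z $ i))"
  by (rule smooth_on_bounded_linear)
    (auto intro: bounded_linear_compose[OF bounded_linear_Re bounded_linear_vec_nth, unfolded o_def])

lemma smooth_on_Im_nth: "smooth_on U (\<lambda>z :: complex ^ 4. Im (z $ i))"
  by (rule smooth_on_bounded_linear)
    (auto intro: bounded_linear_compose[OF bounded_linear_Im bounded_linear_vec_nth, unfolded o_def])

lemmas smooth_on_poly_intros =
  smooth_on_Re_nth smooth_on_Im_nth smooth_on_add smooth_on_diff smooth_on_mult smooth_on_minus smooth_on_power
  smooth_on_const

lemma smooth_on_Re_quad: "open U \<Longrightarrow> smooth_on U (\<lambda>z. Re (quad z))"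
  unfolding quad_def by (simp add: smooth_on_poly_intros Re_power2)

lemma smooth_on_Im_quad: "open U \<Longrightarrow> smooth_on U (\<lambda>z. Im (quad z))"
  unfolding quad_def by (simp add: smooth_on_poly_intros Im_power2)

lemma smooth_on_norm_sq: "open U \<Longrightarrow> smooth_on U (\<lambda>z :: complex ^ 4. (norm z)\<^sup>2)"
  unfolding norm_sq_4 cmod_power2 by (simp add: smooth_on_poly_intros)

lemma has_derivative_nth: "((\<lambda>z. z $ i) has_derivative (\<lambda>v. v $ i)) (at z within S)"
  by (rule bounded_linear_imp_has_derivative) (rule bounded_linear_vec_nth)

lemma has_derivative_norm_sq: "((\<lambda>z. (norm z)\<^sup>2) has_derivative (\<lambda>v. 2 * (z \<bullet> v))) (at (z :: 'a::real_inner))"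
  unfolding power2_norm_eq_inner by (auto intro!: derivative_eq_intros simp: inner_commute)

lemma has_derivative_quad: "(quad has_derivative (\<lambda>v. 2 * (\<Sum>j\<in>UNIV. z $ j * v $ j))) (at z)"
  unfolding quad_def[abs_def]
  by (auto intro!: derivative_eq_intros has_derivative_nth simp: sum_UNIV_4 algebra_simps)

lemma has_derivative_Im_quad01:
  "((\<lambda>z :: complex ^ 4. Im ((z $ 0)\<^sup>2 + (z $ 1)\<^sup>2)) has_derivative (\<lambda>v. 2 * Im (z $ 0 * v $ 0 + z $ 1 * v $ 1))) (at z)"
proof -
  have "((\<lambda>z :: complex ^ 4. (z $ 0)\<^sup>2 + (z $ 1)\<^sup>2) has_derivative (\<lambda>v. 2 * (z $ 0 * v $ 0 + z $ 1 * v $ 1))) (at z)"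
    by (auto intro!: derivative_eq_intros has_derivative_nth simp: algebra_simps)
  from has_derivative_Im[OF this] show ?thesis by simp
qed

lemma has_derivative_moment:
  assumes "(V has_real_derivative V') (at ((norm z)\<^sup>2))"
  shows "((\<lambda>z. V ((norm z)\<^sup>2) * Im (z $ j * cnj (z $ k))) has_derivative dmoment (V ((norm z)\<^sup>2)) V' j k z) (at z)"
proof -
  have 1: "((\<lambda>z. V ((norm z)\<^sup>2)) has_derivative (\<lambda>v. V' * (2 * (z \<bullet> v)))) (at z)"
    using has_derivative_compose[OF has_derivative_norm_sq assms[unfolded has_field_derivative_def]] .
  have "((\<lambda>z :: complex ^ 4. z $ j * cnj (z $ k)) has_derivative (\<lambda>v. z $ j * cnj (v $ k) + v $ j * cnj (z $ k))) (at z)"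
    by (intro has_derivative_mult has_derivative_cnj has_derivative_nth)
  from has_derivative_mult[OF 1 has_derivative_Im[OF this]] show ?thesis
    unfolding dmoment_def[abs_def] by (simp add: add.commute mult.commute)
qed

lemma level_set_chart:
  assumes U: "open U" "p \<in> U" "U \<inter> non_free_locus = {}"
    and V: "smooth_on U (\<lambda>z. V ((norm z)\<^sup>2))"
    and V': "\<And>z. z \<in> U \<Longrightarrow> (V has_real_derivative V' ((norm z)\<^sup>2)) (at ((norm z)\<^sup>2))"
    and pos: "\<And>z. z \<in> U \<Longrightarrow> V ((norm z)\<^sup>2) > 0" "\<And>z. z \<in> U \<Longrightarrow> V ((norm z)\<^sup>2) + (norm z)\<^sup>2 * V' ((norm z)\<^sup>2) > 0"
    and L: "L \<inter> U = {z \<in> U. quad z = 1 \<and> V ((norm z)\<^sup>2) * Im (z $ 0 * cnj (z $ 1)) = c1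
      \<and> V ((norm z)\<^sup>2) * Im (z $ 2 * cnj (z $ 3)) = c2 \<and> Im ((z $ 0)\<^sup>2 + (z $ 1)\<^sup>2) = c3}"
  shows "regular_equations L p"
proof -
  define f :: "5 \<Rightarrow> complex ^ 4 \<Rightarrow> real" where
    "f = sel5 (\<lambda>z. Re (quad z) - 1) (\<lambda>z. Im (quad z)) (\<lambda>z. V ((norm z)\<^sup>2) * Im (z $ 0 * cnj (z $ 1)) - c1)
       (\<lambda>z. V ((norm z)\<^sup>2) * Im (z $ 2 * cnj (z $ 3)) - c2) (\<lambda>z. Im ((z $ 0)\<^sup>2 + (z $ 1)\<^sup>2) - c3)"
  define D :: "5 \<Rightarrow> complex ^ 4 \<Rightarrow> complex ^ 4 \<Rightarrow> real" where
    "D = sel5 (\<lambda>z v. Re (2 * (\<Sum>j\<in>UNIV. z $ j * v $ j))) (\<lambda>z v. Im (2 * (\<Sum>j\<in>UNIV. z $ j * v $ j)))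
      (\<lambda>z. dmoment (V ((norm z)\<^sup>2)) (V' ((norm z)\<^sup>2)) 0 1 z) (\<lambda>z. dmoment (V ((norm z)\<^sup>2)) (V' ((norm z)\<^sup>2)) 2 3 z)
      (\<lambda>z v. 2 * Im (z $ 0 * v $ 0 + z $ 1 * v $ 1))"
  have "\<forall>i. smooth_on U (f i)"
    unfolding all_5 f_def sel5_simps
    by (intro conjI smooth_on_diff smooth_on_Re_quad smooth_on_Im_quad U smooth_on_const smooth_on_mult V)
      (simp_all add: U(1) smooth_on_poly_intros Im_power2)
  moreover have "\<forall>i. (f i has_derivative D i z) (at z)" if "z \<in> U" for z
    unfolding all_5 f_def D_def sel5_simps
    using has_derivative_diff[OF has_derivative_Re[OF has_derivative_quad] has_derivative_const]
      has_derivative_Im[OF has_derivative_quad]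
      has_derivative_diff[OF has_derivative_moment[OF V'[OF that]] has_derivative_const]
      has_derivative_diff[OF has_derivative_Im_quad01 has_derivative_const]
    by (simp only: diff_zero)
  moreover have "L \<inter> U = {z \<in> U. \<forall>i. f i z = 0}"
    unfolding L all_5 f_def sel5_simps by (auto simp: complex_eq_iff)
  moreover have "\<exists>v. \<forall>i. D i z v = y i" if z: "z \<in> L \<inter> U" for z y
  proof -
    interpret free_point z "V ((norm z)\<^sup>2)" "V' ((norm z)\<^sup>2)"
      using z U(3) pos by unfold_locales auto
    obtain v where "2 * (\<Sum>j\<in>UNIV. z $ j * v $ j) = Complex (y 0) (y 1)"
      "2 * Im (z $ 0 * v $ 0 + z $ 1 * v $ 1) = y 4"
      "dmoment (V ((norm z)\<^sup>2)) (V' ((norm z)\<^sup>2)) 0 1 z v = y 2"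
      "dmoment (V ((norm z)\<^sup>2)) (V' ((norm z)\<^sup>2)) 2 3 z v = y 3"
      using defining_forms_surj[of "Complex (y 0) (y 1)" "y 4" "y 2" "y 3"] by (elim exE conjE) (rule that)
    then show ?thesis
      by (intro exI[of _ v]) (simp only: all_5 D_def sel5_simps complex.sel simp_thms)
  qed
  ultimately show ?thesis using U(1,2)
    unfolding regular_equations_def by (intro exI[of _ U] exI[of _ f] exI[of _ D] conjI ballI allI) simp_all
qed

lemma quadric_norm_ge_1: "quad z = 1 \<Longrightarrow> 1 \<le> norm z"
proof -
  assume "quad z = 1"
  then have "1 = Re (quad z)" by simp
  also have "\<dots> \<le> (norm z)\<^sup>2"
    unfolding quad_def norm_sq_4 cmod_power2 by (simp add: Re_power2)
  finally show "1 \<le> norm z" by (simp add: one_le_power power2_nonneg_ge_1_iff)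
qed

lemma quadric_norm_eq_1:
  assumes "quad z = 1" "norm z = 1"
  shows "Im (z $ j) = 0"
proof -
  have "Re (quad z) = (norm z)\<^sup>2" using assms by simp
  then have *: "(Im (z $ 0))\<^sup>2 + (Im (z $ 1))\<^sup>2 + (Im (z $ 2))\<^sup>2 + (Im (z $ 3))\<^sup>2 = 0"
    unfolding quad_def norm_sq_4 cmod_power2 by (simp add: Re_power2)
  have "(Im (z $ 0))\<^sup>2 = 0" "(Im (z $ 1))\<^sup>2 = 0" "(Im (z $ 2))\<^sup>2 = 0" "(Im (z $ 3))\<^sup>2 = 0"
    using * zero_le_power2[of "Im (z $ 0)"] zero_le_power2[of "Im (z $ 1)"]
      zero_le_power2[of "Im (z $ 2)"] zero_le_power2[of "Im (z $ 3)"] by linarith+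
  then have "\<forall>j. Im (z $ j) = 0" unfolding all_4 by simp
  then show ?thesis ..
qed

lemma L_fam_iff:
  assumes "\<kappa> > 0"
  shows "z \<in> L_fam \<kappa> c1 c2 c3 \<longleftrightarrow> quad z = 1 \<and> du_St \<kappa> ((norm z)\<^sup>2) * Im (z $ 0 * cnj (z $ 1)) = c1
     \<and> du_St \<kappa> ((norm z)\<^sup>2) * Im (z $ 2 * cnj (z $ 3)) = c2 \<and> Im ((z $ 0)\<^sup>2 + (z $ 1)\<^sup>2) = c3"
  using u_St'_eq[OF assms] quadric_norm_ge_1[of z]
  unfolding L_fam_def quadric_def by (auto simp: one_le_power)

lemma smooth_on_du_St:
  assumes "\<kappa> > 0"
  shows "smooth_on {z :: complex ^ 4. 1 < norm z} (\<lambda>z. du_St \<kappa> ((norm z)\<^sup>2))"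
proof -
  let ?U = "{z :: complex ^ 4. 1 < norm z}"
  have U: "open ?U" by (intro open_Collect_less continuous_intros)
  define q :: "complex ^ 4 \<Rightarrow> real" where "q = (\<lambda>z. (((norm z)\<^sup>2)\<^sup>2 - 1) powr (1 / 2))"
  have s: "(norm z)\<^sup>2 > 1" "((norm z)\<^sup>2)\<^sup>2 - 1 > 0" if "z \<in> ?U" for z
    using that by (simp_all add: one_less_power)
  have n: "smooth_on ?U (\<lambda>z. (norm z)\<^sup>2)" by (rule smooth_on_norm_sq[OF U])
  have q: "smooth_on ?U q"
    unfolding q_def using s
    by (intro smooth_on_powr smooth_on_diff smooth_on_power[OF U n] smooth_on_const U) auto
  have q': "q z = sqrt (((norm z)\<^sup>2)\<^sup>2 - 1)" "q z > 0" if "z \<in> ?U" for z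
    unfolding q_def using s[OF that] by (simp_all add: powr_half_sqrt less_imp_le)
  define G where "G = (\<lambda>z. 3 * \<kappa> / 2 * ((norm z)\<^sup>2 * q z - ln ((norm z)\<^sup>2 + q z)))"
  have G: "G z = St_G \<kappa> (arcosh ((norm z)\<^sup>2))" if "z \<in> ?U" for z
  proof -
    have "arcosh ((norm z)\<^sup>2) = ln ((norm z)\<^sup>2 + q z)"
      unfolding q'(1)[OF that] using s[OF that] by (intro arcosh_real_def less_imp_le)
    moreover have "sinh (arcosh ((norm z)\<^sup>2)) = q z"
      unfolding q'(1)[OF that] using s[OF that] by (intro sinh_arcosh_real less_imp_le)
    moreover have "cosh (arcosh ((norm z)\<^sup>2)) = (norm z)\<^sup>2" using s[OF that] by simp
    ultimately show ?thesis unfolding G_def St_G_def sinh_double by simp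
  qed
  have Gpos: "G z > 0" if "z \<in> ?U" for z
    using G[OF that] St_G_pos[OF assms] s[OF that] by simp
  have "smooth_on ?U G"
    unfolding G_def using q'(2)
    by (intro smooth_on_mult smooth_on_diff smooth_on_add smooth_on_ln n q U smooth_on_const add_nonneg_pos) auto
  then have "smooth_on ?U (\<lambda>z. G z powr (1 / 3) * q z powr - 1)"
    by (intro smooth_on_mult smooth_on_powr U q) (use q'(2) Gpos in auto)
  moreover have "G z powr (1 / 3) * q z powr - 1 = du_St \<kappa> ((norm z)\<^sup>2)" if "z \<in> ?U" for z
  proof -
    have "G z powr (1 / 3) = root 3 (G z)"
      using root_powr_inverse[of 3 "G z"] Gpos[OF that] by simp
    moreover have "q z powr - 1 = 1 / q z"
      using q'(2)[OF that] by (simp add: powr_minus_divide)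
    ultimately show ?thesis
      using s[OF that] q'(1)[OF that] G[OF that] by (simp add: du_St_def)
  qed
  ultimately show ?thesis by (rule smooth_on_cong[OF U, rotated])
qed

lemma du_St_deriv_at:
  assumes "\<kappa> > 0" "s > 1"
  shows "(du_St \<kappa> has_real_derivative ddu_St \<kappa> s) (at s)"
proof -
  have "at s within {1..} = at s"
    by (rule at_within_interior) (use assms(2) in simp)
  then show ?thesis using du_St_deriv[of \<kappa> s] assms by simp
qed

lemma closed_non_free_locus: "closed non_free_locus"
  unfolding non_free_locus_def
  by (intro closed_Collect_disj closed_Collect_conj closed_Collect_eq continuous_intros)

lemma submanifold3_L_fam:
  assumes \<kappa>: "\<kappa> > 0"
  shows "submanifold3 (L_fam \<kappa> c1 c2 c3 - non_free_locus)"
proof (rule submanifold3I)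
  fix p assume p: "p \<in> L_fam \<kappa> c1 c2 c3 - non_free_locus"
  let ?L = "L_fam \<kappa> c1 c2 c3 - non_free_locus"
  show "regular_equations ?L p"
  proof (cases "norm p = 1")
    case False
    let ?U = "{z :: complex ^ 4. 1 < norm z} - non_free_locus"
    have s: "(norm z)\<^sup>2 > 1" if "z \<in> ?U" for z using that by (simp add: one_less_power)
    have oU: "open {z :: complex ^ 4. 1 < norm z}" by (intro open_Collect_less continuous_intros)
    show ?thesis
    proof (rule level_set_chart[where V = "du_St \<kappa>" and V' = "ddu_St \<kappa>" and U = ?U])
      show "open ?U" by (intro open_Diff oU closed_non_free_locus)
      show "p \<in> ?U" using p False quadric_norm_ge_1[of p] by (auto simp: L_fam_def quadric_def)
      show "smooth_on ?U (\<lambda>z. du_St \<kappa> ((norm z)\<^sup>2))"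
        by (rule smooth_on_subset[OF smooth_on_du_St[OF \<kappa>]]) auto
      show "?L \<inter> ?U = {z \<in> ?U. quad z = 1 \<and> du_St \<kappa> ((norm z)\<^sup>2) * Im (z $ 0 * cnj (z $ 1)) = c1
        \<and> du_St \<kappa> ((norm z)\<^sup>2) * Im (z $ 2 * cnj (z $ 3)) = c2 \<and> Im ((z $ 0)\<^sup>2 + (z $ 1)\<^sup>2) = c3}"
        using L_fam_iff[OF \<kappa>] by blast
    qed (use s du_St_pos[OF \<kappa>] du_St_ddu_St_pos[OF \<kappa>] du_St_deriv_at[OF \<kappa>] in \<open>auto simp: less_imp_le\<close>)
  next
    case True
    \<comment> \<open>At points of the zero section \<open>u'\<close> has no smooth extension at hand, but both moments vanish,
      so the factor \<open>u'\<close> can be dropped from the equations.\<close>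
    have q: "quad p = 1" using p by (simp add: L_fam_iff[OF \<kappa>])
    have c: "c1 = 0" "c2 = 0"
      using p quadric_norm_eq_1[OF q True] by (auto simp: L_fam_iff[OF \<kappa>])
    show ?thesis
    proof (rule level_set_chart[where V = "\<lambda>_. 1" and V' = "\<lambda>_. 0" and U = "- non_free_locus"])
      show "?L \<inter> - non_free_locus = {z \<in> - non_free_locus. quad z = 1 \<and> 1 * Im (z $ 0 * cnj (z $ 1)) = 0
        \<and> 1 * Im (z $ 2 * cnj (z $ 3)) = 0 \<and> Im ((z $ 0)\<^sup>2 + (z $ 1)\<^sup>2) = c3}"
      proof -
        have "du_St \<kappa> ((norm z)\<^sup>2) \<noteq> 0" if "quad z = 1" for z
          using du_St_pos[OF \<kappa>, of "(norm z)\<^sup>2"] quadric_norm_ge_1[OF that] by (simp add: one_le_power)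
        then show ?thesis unfolding set_eq_iff by (auto simp only: L_fam_iff[OF \<kappa>] c) auto
      qed
    qed (use p closed_non_free_locus in \<open>auto simp: open_Compl\<close>)
  qed
qed

lemma tangent_space_L_fam:
  assumes \<kappa>: "\<kappa> > 0" and L: "L \<subseteq> L_fam \<kappa> c1 c2 c3" and p: "p \<in> L" and v: "v \<in> tangent_space L p"
  shows "v \<in> L_tangent (du_St \<kappa> ((norm p)\<^sup>2)) (ddu_St \<kappa> ((norm p)\<^sup>2)) p"
proof -
  note tan = tangent_space_derivative_eq_0[OF v]
  note Lz = subsetD[OF L, unfolded L_fam_iff[OF \<kappa>]]
  have "Re (2 * (\<Sum>j\<in>UNIV. p $ j * v $ j)) - 0 = 0"
    by (rule tan[OF has_derivative_diff[OF has_derivative_Re[OF has_derivative_quad] has_derivative_const[of 1]]])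
      (use Lz in auto)
  moreover have "Im (2 * (\<Sum>j\<in>UNIV. p $ j * v $ j)) = 0"
    by (rule tan[OF has_derivative_Im[OF has_derivative_quad]]) (use Lz in auto)
  ultimately have 1: "(\<Sum>j\<in>UNIV. p $ j * v $ j) = 0"
    by (simp add: complex_eq_iff)
  have "2 * Im (p $ 0 * v $ 0 + p $ 1 * v $ 1) - 0 = 0"
    by (rule tan[OF has_derivative_diff[OF has_derivative_Im_quad01 has_derivative_const[of c3]]]) (use Lz in auto)
  then have 2: "Im (p $ 0 * v $ 0 + p $ 1 * v $ 1) = 0" by simp
  have 3: "dmoment (du_St \<kappa> ((norm p)\<^sup>2)) (ddu_St \<kappa> ((norm p)\<^sup>2)) j k p v = 0"
    if c: "\<And>z. z \<in> L \<Longrightarrow> du_St \<kappa> ((norm z)\<^sup>2) * Im (z $ j * cnj (z $ k)) = c" for j k c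
  proof (cases "norm p = 1")
    case False
    then have "(norm p)\<^sup>2 > 1"
      using quadric_norm_ge_1[of p] Lz[OF p] by (simp add: one_less_power)
    then have "dmoment (du_St \<kappa> ((norm p)\<^sup>2)) (ddu_St \<kappa> ((norm p)\<^sup>2)) j k p v - 0 = 0"
      by (intro tan[OF has_derivative_diff[OF has_derivative_moment[OF du_St_deriv_at[OF \<kappa>]] has_derivative_const[of c]]])
        (use c in auto)
    then show ?thesis by simp
  next
    case True
    have q: "quad p = 1" using Lz[OF p] by simp
    have im: "Im (p $ j * cnj (p $ k)) = 0"
      using quadric_norm_eq_1[OF q True] by simp
    have "c = 0" using c[OF p] im by simp
    have 0: "Im (z $ j * cnj (z $ k)) = 0" if "z \<in> L" for z
      using c[OF that] \<open>c = 0\<close> du_St_pos[OF \<kappa>, of "(norm z)\<^sup>2"] quadric_norm_ge_1[of z] Lz[OF that]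
      by (simp add: one_le_power)
    have "((\<lambda>z. 1 * Im (z $ j * cnj (z $ k))) has_derivative dmoment 1 0 j k p) (at p)"
      using has_derivative_moment[of "\<lambda>_. 1" 0 p j k] by simp
    from tan[OF this] have "dmoment 1 0 j k p v = 0" using 0 by simp
    then show ?thesis using im unfolding dmoment_def by (simp only: mult_1 mult_zero_left mult_zero_right add_0_right)
  qed
  show ?thesis
    unfolding L_tangent_def using 1 2 3[of 0 1 c1] 3[of 2 3 c2] Lz by blast
qed

lemma omega_St_eq:
  assumes \<kappa>: "\<kappa> > 0" and z: "1 \<le> norm z"
  shows "omega_St \<kappa> z v w = of_real (radial_form (du_St \<kappa> ((norm z)\<^sup>2)) (ddu_St \<kappa> ((norm z)\<^sup>2)) z v w)"
  unfolding omega_St_def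
proof (rule i_ddbar_radial[where T = "{1..}"])
  fix p i :: "complex ^ 4" and e :: real
  assume p: "p \<in> {z. 1 \<le> norm z}" and i: "i \<in> Basis" and e: "0 < e"
  define d where "d = (if p \<bullet> i \<ge> 0 then e / 2 else - (e / 2))"
  have "d * (p \<bullet> i) \<ge> 0"
    using e by (cases "p \<bullet> i \<ge> 0") (auto simp: d_def mult_nonneg_nonpos)
  then have "(norm p)\<^sup>2 \<le> (norm (p + d *\<^sub>R i))\<^sup>2"
    unfolding power2_norm_eq_inner
    by (simp add: inner_add_left inner_add_right inner_commute[of i p] distrib_left)
      (simp add: mult.assoc[symmetric] add_nonneg_nonneg)
  then have "norm p \<le> norm (p + d *\<^sub>R i)"
    by (rule power2_le_imp_le) simp
  then show "\<exists>d. 0 < \<bar>d\<bar> \<and> \<bar>d\<bar> < e \<and> p + d *\<^sub>R i \<in> {z. 1 \<le> norm z}"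
    using p e by (intro exI[of _ d]) (auto simp: d_def)
qed (use z u_St_deriv[OF \<kappa>] du_St_deriv[OF \<kappa>] in \<open>auto simp: one_le_power\<close>)

lemma special_lagrangian_L_fam:
  assumes \<kappa>: "\<kappa> > 0"
  shows "special_lagrangian quadric (omega_St \<kappa>) Omega_St (L_fam \<kappa> c1 c2 c3 - non_free_locus)"
proof -
  let ?L = "L_fam \<kappa> c1 c2 c3 - non_free_locus"
  have fp: "free_point z (du_St \<kappa> ((norm z)\<^sup>2)) (ddu_St \<kappa> ((norm z)\<^sup>2))" "1 \<le> norm z" "quad z = 1"
    if "z \<in> ?L" for z
  proof -
    show q: "quad z = 1" using that by (simp add: L_fam_iff[OF \<kappa>])
    then show n: "1 \<le> norm z" by (rule quadric_norm_ge_1)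
    then have "1 \<le> (norm z)\<^sup>2" by (simp add: one_le_power)
    then show "free_point z (du_St \<kappa> ((norm z)\<^sup>2)) (ddu_St \<kappa> ((norm z)\<^sup>2))"
      using that du_St_pos[OF \<kappa>] du_St_ddu_St_pos[OF \<kappa>] by unfold_locales auto
  qed
  note tan = tangent_space_L_fam[OF \<kappa> Diff_subset]
  show ?thesis
    unfolding special_lagrangian_def
  proof (intro conjI ballI)
    show "?L \<subseteq> quadric" by (auto simp: L_fam_def)
    show "submanifold3 ?L" by (rule submanifold3_L_fam[OF \<kappa>])
    fix z assume z: "z \<in> ?L"
    { fix v w assume "v \<in> tangent_space ?L z" "w \<in> tangent_space ?L z"
      then show "omega_St \<kappa> z v w = 0"
        using omega_St_eq[OF \<kappa> fp(2)[OF z]] free_point.radial_form_L_tangent[OF fp(1)[OF z] tan[OF z] tan[OF z]]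
        by simp }
    { fix v1 v2 v3 assume "v1 \<in> tangent_space ?L z" "v2 \<in> tangent_space ?L z" "v3 \<in> tangent_space ?L z"
      then show "Im (Omega_St z v1 v2 v3) = 0"
        unfolding Omega_St_def
        using free_point.Im_vol4_L_tangent[OF fp(1)[OF z] fp(3)[OF z] tan[OF z] tan[OF z] tan[OF z]] by simp }
  qed
qed

lemma L_fam_free:
  assumes "c3 \<noteq> 0 \<or> (c1 \<noteq> 0 \<and> c2 \<noteq> 0)"
  shows "L_fam \<kappa> c1 c2 c3 - non_free_locus = L_fam \<kappa> c1 c2 c3"
proof -
  have "z \<notin> non_free_locus" if z: "z \<in> L_fam \<kappa> c1 c2 c3" for z
  proof
    assume nf: "z \<in> non_free_locus"
    have "Im (quad z) = 0" using z by (simp add: L_fam_def quadric_def)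
    then show False using nf z assms by (auto simp: L_fam_def non_free_locus_def quad_def)
  qed
  then show ?thesis by blast
qed


section \<open>The limit cones\<close>

definition twisted_vec :: "complex \<Rightarrow> complex \<Rightarrow> real \<Rightarrow> real \<Rightarrow> real \<Rightarrow> real \<Rightarrow> complex ^ 4" where
  "twisted_vec u w a b c d = vec4 (u * of_real a) (u * of_real b) (w * of_real c) (w * of_real d)"

definition torus_pt :: "complex \<Rightarrow> complex \<Rightarrow> real \<times> real \<Rightarrow> complex ^ 4" where
  "torus_pt u w x = (1 / sqrt 2) *\<^sub>R twisted_vec u w (cos (fst x)) (sin (fst x)) (cos (snd x)) (sin (snd x))"

definition twisted_torus :: "complex \<Rightarrow> complex \<Rightarrow> (complex ^ 4) set" where
  "twisted_torus u w = range (torus_pt u w)"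

lemma twisted_vec_nth [simp]:
  "twisted_vec u w a b c d $ 0 = u * of_real a" "twisted_vec u w a b c d $ 1 = u * of_real b"
  "twisted_vec u w a b c d $ 2 = w * of_real c" "twisted_vec u w a b c d $ 3 = w * of_real d"
  by (simp_all add: twisted_vec_def)

lemma twisted_vec_scaleR: "r *\<^sub>R twisted_vec u w a b c d = twisted_vec u w (r * a) (r * b) (r * c) (r * d)"
  by (rule vec4_eqI) (simp_all add: scaleR_conv_of_real[where 'a = complex])

lemma torus_pt_eq: "torus_pt u w x = twisted_vec u w (cos (fst x) / sqrt 2) (sin (fst x) / sqrt 2) (cos (snd x) / sqrt 2) (sin (snd x) / sqrt 2)"
  by (simp add: torus_pt_def twisted_vec_scaleR)

lemma ex_angle_2pi: "\<exists>t\<in>{0..<2 * pi}. cos t = cos x \<and> sin t = sin x"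
  using sincos_total_2pi[of "cos x" "sin x"] by (metis atLeastLessThan_iff sin_cos_squared_add3 power2_eq_square)

lemma twisted_torus_eq:
  "twisted_torus u w = {(1 / sqrt 2) *\<^sub>R twisted_vec u w (cos \<theta>1) (sin \<theta>1) (cos \<theta>2) (sin \<theta>2)
     | \<theta>1 \<theta>2. \<theta>1 \<in> {0..<2 * pi} \<and> \<theta>2 \<in> {0..<2 * pi}}" (is "_ = ?R")
proof (intro equalityI subsetI)
  fix z assume "z \<in> twisted_torus u w"
  then obtain a b where z: "z = torus_pt u w (a, b)" by (auto simp: twisted_torus_def)
  obtain s t where "s \<in> {0..<2 * pi}" "t \<in> {0..<2 * pi}" "cos s = cos a" "sin s = sin a" "cos t = cos b" "sin t = sin b"
    using ex_angle_2pi[of a] ex_angle_2pi[of b] by blast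
  then show "z \<in> ?R" unfolding z torus_pt_def by (intro CollectI exI[of _ s] exI[of _ t]) simp
next
  fix z assume "z \<in> ?R"
  then obtain s t where "z = torus_pt u w (s, t)" by (auto simp: torus_pt_def)
  then show "z \<in> twisted_torus u w" by (auto simp: twisted_torus_def)
qed

lemma Sigma_a_eq: "Sigma_a = twisted_torus 1 \<i>"
  unfolding twisted_torus_eq Sigma_a_def twisted_vec_def by simp

lemma Sigma_c_eq: "Sigma_c = twisted_torus \<i> 1"
  unfolding twisted_torus_eq Sigma_c_def twisted_vec_def by simp

lemma cone_over_twisted_torus:
  "z \<in> cone_over (twisted_torus u w) \<longleftrightarrow>
     (\<exists>a b c d. z = twisted_vec u w a b c d \<and> a\<^sup>2 + b\<^sup>2 = c\<^sup>2 + d\<^sup>2)" (is "_ \<longleftrightarrow> ?R")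
proof
  assume "z \<in> cone_over (twisted_torus u w)"
  then obtain s x where z: "z = s *\<^sub>R torus_pt u w x"
    by (auto simp: cone_over_def twisted_torus_def)
  have sq: "(s * (cos t / sqrt 2))\<^sup>2 + (s * (sin t / sqrt 2))\<^sup>2 = s\<^sup>2 / 2" for t
    by (simp add: power_mult_distrib power_divide flip: distrib_left add_divide_distrib)
  show ?R unfolding z torus_pt_eq twisted_vec_scaleR
    by (intro exI conjI, rule refl) (simp only: sq)
next
  assume ?R
  then obtain a b c d where z: "z = twisted_vec u w a b c d" and e: "a\<^sup>2 + b\<^sup>2 = c\<^sup>2 + d\<^sup>2" by blast
  define r where "r = sqrt (a\<^sup>2 + b\<^sup>2)"
  have polar: "\<exists>t. x = r * cos t \<and> y = r * sin t" if "x\<^sup>2 + y\<^sup>2 = a\<^sup>2 + b\<^sup>2" for x y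
  proof (cases "r = 0")
    case True
    then show ?thesis using that by (auto simp: r_def sum_power2_eq_zero_iff)
  next
    case False
    have "r\<^sup>2 = x\<^sup>2 + y\<^sup>2" using that by (simp add: r_def)
    moreover have "(x / r)\<^sup>2 + (y / r)\<^sup>2 = (x\<^sup>2 + y\<^sup>2) / r\<^sup>2"
      by (simp add: power_divide add_divide_distrib)
    ultimately have "(x / r)\<^sup>2 + (y / r)\<^sup>2 = 1"
      using False by (metis divide_self power_not_zero)
    then obtain t where "x / r = cos t" "y / r = sin t"
      using sincos_total_2pi by metis
    then show ?thesis using False by (intro exI[of _ t]) (simp add: field_simps)
  qed
  obtain s where s: "a = r * cos s" "b = r * sin s" using polar[OF refl] by blast
  obtain t where t: "c = r * cos t" "d = r * sin t" using polar[OF e[symmetric]] by blast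
  from s t have "z = (r * sqrt 2) *\<^sub>R torus_pt u w (s, t)"
    unfolding z torus_pt_eq twisted_vec_scaleR by simp
  then show "z \<in> cone_over (twisted_torus u w)"
    by (auto simp: cone_over_def twisted_torus_def)
qed

lemma u_cone_deriv: "s > 0 \<Longrightarrow> (u_cone has_real_derivative s powr (- 1 / 3)) (at s within S)"
  unfolding u_cone_def[abs_def] by (auto intro!: derivative_eq_intros)

lemma omega_cone_eq:
  assumes "z \<noteq> 0"
  shows "omega_cone z v w = of_real (radial_form (((norm z)\<^sup>2) powr (- 1 / 3)) (- 1 / 3 * ((norm z)\<^sup>2) powr (- 4 / 3)) z v w)"
  unfolding omega_cone_def
proof (rule i_ddbar_radial[where T = "{0<..}" and U' = "\<lambda>s. s powr (- 1 / 3)" and U'' = "\<lambda>s. - 1 / 3 * s powr (- 4 / 3)"])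
  fix p i :: "complex ^ 4" and e :: real
  assume p: "p \<in> - {0}" and i: "i \<in> Basis" and e: "0 < e"
  define d where "d = min e (norm p) / 2"
  have d: "0 < d" "d < e" "d < norm p" 
  proof -
    have "norm p > 0" using p by simp
    then show "0 < d" "d < e" "d < norm p" using e by (auto simp: d_def min_def)
  qed
  have "p + d *\<^sub>R i \<noteq> 0"
  proof
    assume "p + d *\<^sub>R i = 0"
    then have "norm p = norm (d *\<^sub>R i)" by (metis add_eq_0_iff norm_minus_cancel)
    then show False using d i by simp
  qed
  then show "\<exists>d. 0 < \<bar>d\<bar> \<and> \<bar>d\<bar> < e \<and> p + d *\<^sub>R i \<in> - {0}"
    using d by (intro exI[of _ d]) auto
next
  show "((\<lambda>s. s powr (- 1 / 3)) has_real_derivative - 1 / 3 * s powr (- 4 / 3)) (at s within {0<..})" if "s \<in> {0<..}" for s :: real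
    using that by (auto intro!: derivative_eq_intros)
qed (use assms u_cone_deriv in auto)

lemma Omega_cone_eq:
  assumes z: "z \<noteq> 0"
    and v: "(\<Sum>j\<in>UNIV. z $ j * v1 $ j) = 0" "(\<Sum>j\<in>UNIV. z $ j * v2 $ j) = 0" "(\<Sum>j\<in>UNIV. z $ j * v3 $ j) = 0"
  shows "Omega_cone z v1 v2 v3 = vol4 (\<chi> j. cnj (z $ j)) v1 v2 v3 / of_real ((norm z)\<^sup>2)"
  unfolding Omega_cone_def
proof (rule the_equality)
  let ?c = "(\<chi> j. cnj (z $ j)) :: complex ^ 4"
  have n: "(\<Sum>j\<in>UNIV. z $ j * ?c $ j) = of_real ((norm z)\<^sup>2)"
    unfolding norm_sq_4 of_real_add complex_norm_square by (simp add: sum_UNIV_4)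
  have nz: "complex_of_real ((norm z)\<^sup>2) \<noteq> 0" using z by simp
  have vol0: "vol4 v v1 v2 v3 = 0" if "(\<Sum>j\<in>UNIV. z $ j * v $ j) = 0" for v
  proof -
    have "vec4 v v1 v2 v3 *v z = 0"
      using v that by (simp add: vec_eq_iff all_4 matrix_vector_mult_def mult.commute)
    then show ?thesis
      unfolding vol4_def using z by (metis invertible_det_nz matrix_left_invertible_ker invertible_def)
  qed
  have lin: "vol4 (v + c *s v') v1 v2 v3 = vol4 v v1 v2 v3 + c * vol4 v' v1 v2 v3" for v v' c
    unfolding vol4_def det_4 vec4_nth by (simp add: algebra_simps)
  show "\<forall>v0. (\<Sum>j\<in>UNIV. z $ j * v0 $ j) * (vol4 ?c v1 v2 v3 / of_real ((norm z)\<^sup>2)) = vol4 v0 v1 v2 v3"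
  proof
    fix v0 :: "complex ^ 4"
    define c where "c = (\<Sum>j\<in>UNIV. z $ j * v0 $ j) / of_real ((norm z)\<^sup>2)"
    have "(\<Sum>j\<in>UNIV. z $ j * (v0 + (- c) *s ?c) $ j) = (\<Sum>j\<in>UNIV. z $ j * v0 $ j) - c * (\<Sum>j\<in>UNIV. z $ j * ?c $ j)"
      by (simp add: sum_UNIV_4 algebra_simps)
    also have "\<dots> = 0" unfolding n c_def using nz by simp
    finally have "vol4 v0 v1 v2 v3 + (- c) * vol4 ?c v1 v2 v3 = 0"
      using vol0 lin by metis
    then show "(\<Sum>j\<in>UNIV. z $ j * v0 $ j) * (vol4 ?c v1 v2 v3 / of_real ((norm z)\<^sup>2)) = vol4 v0 v1 v2 v3"
      by (simp add: c_def)
  qed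
  fix a assume "\<forall>v0. (\<Sum>j\<in>UNIV. z $ j * v0 $ j) * a = vol4 v0 v1 v2 v3"
  then have "of_real ((norm z)\<^sup>2) * a = vol4 ?c v1 v2 v3" using n by metis
  then show "a = vol4 ?c v1 v2 v3 / of_real ((norm z)\<^sup>2)" using nz by (simp add: field_simps)
qed

lemma has_derivative_twisted:
  "((\<lambda>z :: complex ^ 4. Im (cnj u * z $ i)) has_derivative (\<lambda>v. Im (cnj u * v $ i))) (at z)"
  "((\<lambda>z :: complex ^ 4. (Re (cnj u * z $ i))\<^sup>2) has_derivative (\<lambda>v. 2 * Re (cnj u * z $ i) * Re (cnj u * v $ i))) (at z)"
proof -
  have *: "((\<lambda>z :: complex ^ 4. cnj u * z $ i) has_derivative (\<lambda>v. cnj u * v $ i)) (at z)"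
    by (intro has_derivative_mult_right has_derivative_nth)
  show "((\<lambda>z :: complex ^ 4. Im (cnj u * z $ i)) has_derivative (\<lambda>v. Im (cnj u * v $ i))) (at z)"
    by (rule has_derivative_Im[OF *])
  show "((\<lambda>z :: complex ^ 4. (Re (cnj u * z $ i))\<^sup>2) has_derivative (\<lambda>v. 2 * Re (cnj u * z $ i) * Re (cnj u * v $ i))) (at z)"
    by (rule has_derivative_eq_rhs[OF has_derivative_power[OF has_derivative_Re[OF *], of 2]]) (simp add: fun_eq_iff algebra_simps)
qed

context
  fixes u w :: complex
  assumes uw: "u = 1 \<and> w = \<i> \<or> u = \<i> \<and> w = 1"
begin

lemma cnj_mult_self_1: "cnj u * u = 1" "cnj w * w = 1" "u * cnj u = 1" "w * cnj w = 1"
  using uw by auto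

definition cone_forms :: "5 \<Rightarrow> complex ^ 4 \<Rightarrow> real" where
  "cone_forms = sel5 (\<lambda>z. Im (cnj u * z $ 0)) (\<lambda>z. Im (cnj u * z $ 1)) (\<lambda>z. Im (cnj w * z $ 2)) (\<lambda>z. Im (cnj w * z $ 3))
     (\<lambda>z. (Re (cnj u * z $ 0))\<^sup>2 + (Re (cnj u * z $ 1))\<^sup>2 - ((Re (cnj w * z $ 2))\<^sup>2 + (Re (cnj w * z $ 3))\<^sup>2))"

definition cone_forms_deriv :: "5 \<Rightarrow> complex ^ 4 \<Rightarrow> complex ^ 4 \<Rightarrow> real" where
  "cone_forms_deriv = sel5 (\<lambda>z v. Im (cnj u * v $ 0)) (\<lambda>z v. Im (cnj u * v $ 1)) (\<lambda>z v. Im (cnj w * v $ 2)) (\<lambda>z v. Im (cnj w * v $ 3))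
     (\<lambda>z v. (2 * Re (cnj u * z $ 0) * Re (cnj u * v $ 0) + 2 * Re (cnj u * z $ 1) * Re (cnj u * v $ 1))
        - (2 * Re (cnj w * z $ 2) * Re (cnj w * v $ 2) + 2 * Re (cnj w * z $ 3) * Re (cnj w * v $ 3)))"

lemma cone_forms_has_derivative: "(cone_forms i has_derivative cone_forms_deriv i z) (at z)"
proof -
  have "\<forall>i. (cone_forms i has_derivative cone_forms_deriv i z) (at z)"
    unfolding all_5 cone_forms_def cone_forms_deriv_def sel5_simps
    by (intro conjI has_derivative_twisted has_derivative_add has_derivative_diff)
  then show ?thesis ..
qed

lemma twisted_real: "Im (cnj x * y) = 0 \<Longrightarrow> cnj x * x = 1 \<Longrightarrow> y = x * of_real (Re (cnj x * y))"
proof -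
  assume "Im (cnj x * y) = 0" and x: "cnj x * x = 1"
  then have "of_real (Re (cnj x * y)) = cnj x * y" by (simp add: complex_eq_iff)
  then have "x * of_real (Re (cnj x * y)) = (cnj x * x) * y" by simp
  then show ?thesis using x by simp
qed

lemma twisted_vecI:
  assumes "Im (cnj u * v $ 0) = 0" "Im (cnj u * v $ 1) = 0" "Im (cnj w * v $ 2) = 0" "Im (cnj w * v $ 3) = 0"
  shows "v = twisted_vec u w (Re (cnj u * v $ 0)) (Re (cnj u * v $ 1)) (Re (cnj w * v $ 2)) (Re (cnj w * v $ 3))"
  using twisted_real[OF assms(1) cnj_mult_self_1(1)] twisted_real[OF assms(2) cnj_mult_self_1(1)]
    twisted_real[OF assms(3) cnj_mult_self_1(2)] twisted_real[OF assms(4) cnj_mult_self_1(2)]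
  by (intro vec4_eqI) (simp_all only: twisted_vec_nth)

lemma cnj_mult_twisted: "cnj u * (u * of_real r) = of_real r" "cnj w * (w * of_real r) = of_real r"
  using cnj_mult_self_1 by (simp_all flip: mult.assoc)

lemma cone_over_twisted_torus_forms:
  "z \<in> cone_over (twisted_torus u w) \<longleftrightarrow> (\<forall>i. cone_forms i z = 0)"
proof
  assume "z \<in> cone_over (twisted_torus u w)"
  then show "\<forall>i. cone_forms i z = 0"
    unfolding cone_over_twisted_torus all_5 cone_forms_def sel5_simps
    by (elim exE conjE) (simp only: twisted_vec_nth cnj_mult_twisted Im_complex_of_real Re_complex_of_real, simp)
next
  assume "\<forall>i. cone_forms i z = 0"
  then show "z \<in> cone_over (twisted_torus u w)"
    unfolding cone_over_twisted_torus all_5 cone_forms_def sel5_simps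
    by - (elim conjE, intro exI conjI, erule (3) twisted_vecI, simp)
qed

lemma cone_forms_smooth: "open U \<Longrightarrow> smooth_on U (cone_forms i)"
proof -
  assume U: "open U"
  have bl: "bounded_linear (\<lambda>z :: complex ^ 4. c * z $ j)" for c j
    by (intro bounded_linear_const_mult bounded_linear_vec_nth)
  have "smooth_on U (\<lambda>z :: complex ^ 4. Im (c * z $ j))" "smooth_on U (\<lambda>z :: complex ^ 4. Re (c * z $ j))" for c j
    using bounded_linear_compose[OF bounded_linear_Im bl] bounded_linear_compose[OF bounded_linear_Re bl]
    by (auto intro!: smooth_on_bounded_linear simp only: o_def)
  then have "\<forall>i. smooth_on U (cone_forms i)"
    unfolding all_5 cone_forms_def sel5_simps
    by (intro conjI smooth_on_add smooth_on_diff smooth_on_power U)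
  then show ?thesis ..
qed

lemma submanifold3_cone: "submanifold3 (cone_over (twisted_torus u w) - {0})"
proof (rule submanifold3I)
  let ?L = "cone_over (twisted_torus u w) - {0}"
  fix p assume p: "p \<in> ?L"
  have surj: "\<exists>v. \<forall>i. cone_forms_deriv i z v = y i" if z: "z \<in> ?L" for z y
  proof -
    obtain a b c d where ze: "z = twisted_vec u w a b c d" and e: "a\<^sup>2 + b\<^sup>2 = c\<^sup>2 + d\<^sup>2"
      using z cone_over_twisted_torus by blast
    have "a\<^sup>2 + b\<^sup>2 \<noteq> 0"
    proof
      assume 0: "a\<^sup>2 + b\<^sup>2 = 0"
      then have "a = 0" "b = 0" "c = 0" "d = 0" using e by (simp_all add: sum_power2_eq_zero_iff)
      then have "z = 0" unfolding ze by (intro vec4_eqI) simp_all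
      then show False using z by simp
    qed
    define k where "k = y 4 / (2 * (a\<^sup>2 + b\<^sup>2))"
    have k: "2 * a * (k * a) + 2 * b * (k * b) = y 4"
    proof -
      have "2 * a * (k * a) + 2 * b * (k * b) = k * (2 * (a\<^sup>2 + b\<^sup>2))"
        by (simp add: power2_eq_square algebra_simps)
      then show ?thesis using \<open>a\<^sup>2 + b\<^sup>2 \<noteq> 0\<close> by (simp add: k_def)
    qed
    let ?v = "vec4 (u * Complex (k * a) (y 0)) (u * Complex (k * b) (y 1)) (w * Complex 0 (y 2)) (w * Complex 0 (y 3))"
    have "cnj u * (u * x) = x" "cnj w * (w * x) = x" for x
      using cnj_mult_self_1 by (simp_all flip: mult.assoc)
    then show ?thesis
      unfolding ze by (intro exI[of _ ?v])
        (simp only: all_5 cone_forms_deriv_def sel5_simps vec4_nth twisted_vec_nth complex.sel Re_complex_of_real k, simp)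
  qed
  have "?L \<inter> - {0} = {z \<in> - {0}. \<forall>i. cone_forms i z = 0}"
    using cone_over_twisted_torus_forms by auto
  moreover have "open (- {0 :: complex ^ 4})" "p \<in> - {0}" using p by (auto simp: open_Compl)
  moreover have "\<forall>i. smooth_on (- {0}) (cone_forms i)"
    "\<forall>z\<in>- {0}. \<forall>i. (cone_forms i has_derivative cone_forms_deriv i z) (at z)"
    using cone_forms_smooth cone_forms_has_derivative by (auto simp: open_Compl)
  moreover have "\<forall>z\<in>?L \<inter> - {0}. \<forall>y. \<exists>v. \<forall>i. cone_forms_deriv i z v = y i"
    using surj by blast
  ultimately show "regular_equations ?L p"
    unfolding regular_equations_def by (intro exI[of _ "- {0}"] exI[of _ cone_forms] exI[of _ cone_forms_deriv] conjI)
qed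

lemma tangent_space_cone:
  assumes "p \<in> cone_over (twisted_torus u w) - {0}" and v: "v \<in> tangent_space (cone_over (twisted_torus u w) - {0}) p"
  shows "(\<exists>a b c d. v = twisted_vec u w a b c d) \<and> (\<Sum>j\<in>UNIV. p $ j * v $ j) = 0"
proof -
  have "\<forall>i. cone_forms_deriv i p v = 0"
    using tangent_space_derivative_eq_0[OF v cone_forms_has_derivative] cone_over_twisted_torus_forms by blast
  then have t: "Im (cnj u * v $ 0) = 0" "Im (cnj u * v $ 1) = 0" "Im (cnj w * v $ 2) = 0" "Im (cnj w * v $ 3) = 0"
    and s: "2 * Re (cnj u * p $ 0) * Re (cnj u * v $ 0) + 2 * Re (cnj u * p $ 1) * Re (cnj u * v $ 1)
        - (2 * Re (cnj w * p $ 2) * Re (cnj w * v $ 2) + 2 * Re (cnj w * p $ 3) * Re (cnj w * v $ 3)) = 0"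
    unfolding all_5 cone_forms_deriv_def sel5_simps by blast+
  obtain a b c d where p: "p = twisted_vec u w a b c d"
    using assms(1) cone_over_twisted_torus by blast
  obtain a' b' c' d' where v': "v = twisted_vec u w a' b' c' d'"
    using twisted_vecI[OF t] by blast
  have "2 * a * a' + 2 * b * b' - (2 * c * c' + 2 * d * d') = 0"
    using s unfolding p v' by (simp only: twisted_vec_nth cnj_mult_twisted Re_complex_of_real)
  then have "a * a' + b * b' - c * c' - d * d' = 0" by simp
  moreover have "(\<Sum>j\<in>UNIV. p $ j * v $ j) = u\<^sup>2 * of_real (a * a' + b * b' - c * c' - d * d')"
  proof -
    have "w\<^sup>2 = - (u\<^sup>2)" using uw by auto
    then have "w * w = - (u * u)" by (simp add: power2_eq_square)
    moreover have "(\<Sum>j\<in>UNIV. p $ j * v $ j) = (u * u) * of_real (a * a' + b * b') + (w * w) * of_real (c * c' + d * d')"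
      unfolding p v' sum_UNIV_4 twisted_vec_nth by (simp add: algebra_simps)
    ultimately show ?thesis
      by (simp add: power2_eq_square algebra_simps)
  qed
  ultimately show ?thesis using v' by auto
qed

lemma vol4_twisted_real:
  "vol4 (twisted_vec u w a0 a1 a2 a3) (twisted_vec u w b0 b1 b2 b3) (twisted_vec u w c0 c1 c2 c3) (twisted_vec u w d0 d1 d2 d3) \<in> \<real>"
proof -
  have "vol4 (twisted_vec u w a0 a1 a2 a3) (twisted_vec u w b0 b1 b2 b3) (twisted_vec u w c0 c1 c2 c3) (twisted_vec u w d0 d1 d2 d3)
    = u\<^sup>2 * w\<^sup>2 * vol4 (twisted_vec 1 1 a0 a1 a2 a3) (twisted_vec 1 1 b0 b1 b2 b3) (twisted_vec 1 1 c0 c1 c2 c3) (twisted_vec 1 1 d0 d1 d2 d3)"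
    unfolding vol4_def det_4 vec4_nth twisted_vec_nth by (simp add: power2_eq_square algebra_simps)
  moreover have "vol4 (twisted_vec 1 1 a0 a1 a2 a3) (twisted_vec 1 1 b0 b1 b2 b3) (twisted_vec 1 1 c0 c1 c2 c3) (twisted_vec 1 1 d0 d1 d2 d3) \<in> \<real>"
    unfolding vol4_def det_4 vec4_nth twisted_vec_nth by (intro Reals_add Reals_diff Reals_mult) auto
  moreover have "u\<^sup>2 * w\<^sup>2 \<in> \<real>" using uw by auto
  ultimately show ?thesis by simp
qed

lemma radial_form_twisted:
  "radial_form a b (twisted_vec u w z0 z1 z2 z3) (twisted_vec u w v0 v1 v2 v3) (twisted_vec u w w0 w1 w2 w3) = 0"
proof -
  have "u * x * cnj (u * y) = x * cnj y" "w * x * cnj (w * y) = x * cnj y"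
    "cnj (u * x) * (u * y) = cnj x * y" "cnj (w * x) * (w * y) = cnj x * y" for x y
    using cnj_mult_self_1 by (simp_all add: mult_ac)
  then show ?thesis
    unfolding radial_form_def sum_UNIV_4 twisted_vec_nth by simp
qed

lemma twisted_torus_subset_conifold: "cone_over (twisted_torus u w) \<subseteq> conifold"
proof
  fix z assume "z \<in> cone_over (twisted_torus u w)"
  then obtain a b c d where z: "z = twisted_vec u w a b c d" and e: "a\<^sup>2 + b\<^sup>2 = c\<^sup>2 + d\<^sup>2"
    using cone_over_twisted_torus by blast
  have "quad z = u\<^sup>2 * of_real (a\<^sup>2 + b\<^sup>2) + w\<^sup>2 * of_real (c\<^sup>2 + d\<^sup>2)"
    unfolding z quad_def twisted_vec_nth by (simp add: power_mult_distrib algebra_simps)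
  also have "\<dots> = 0" unfolding e using uw by auto
  finally show "z \<in> conifold" by (simp add: conifold_def)
qed

lemma special_lagrangian_cone:
  "special_lagrangian conifold omega_cone Omega_cone (cone_over (twisted_torus u w) - {0})"
proof -
  let ?L = "cone_over (twisted_torus u w) - {0}"
  show ?thesis
    unfolding special_lagrangian_def
  proof (intro conjI ballI)
    show "?L \<subseteq> conifold" using twisted_torus_subset_conifold by blast
    show "submanifold3 ?L" by (rule submanifold3_cone)
    fix z assume z: "z \<in> ?L"
    then obtain a b c d where ze: "z = twisted_vec u w a b c d" using cone_over_twisted_torus by blast
    { fix v x assume "v \<in> tangent_space ?L z" "x \<in> tangent_space ?L z"
      then obtain a1 b1 c1 d1 a2 b2 c2 d2 where "v = twisted_vec u w a1 b1 c1 d1" "x = twisted_vec u w a2 b2 c2 d2"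
        using tangent_space_cone[OF z] by metis
      then show "omega_cone z v x = 0"
        using z by (simp add: omega_cone_eq ze radial_form_twisted) }
    { fix v1 v2 v3 assume v: "v1 \<in> tangent_space ?L z" "v2 \<in> tangent_space ?L z" "v3 \<in> tangent_space ?L z"
      then obtain a1 b1 c1 d1 a2 b2 c2 d2 a3 b3 c3 d3 where ve: "v1 = twisted_vec u w a1 b1 c1 d1"
        "v2 = twisted_vec u w a2 b2 c2 d2" "v3 = twisted_vec u w a3 b3 c3 d3"
        using tangent_space_cone[OF z] by metis
      obtain r s :: real where rs: "cnj u = u * of_real r" "cnj w = w * of_real s"
      proof (rule that)
        show "cnj u = u * of_real (if u = 1 then 1 else - 1)" "cnj w = w * of_real (if w = 1 then 1 else - 1)"
          using uw by auto
      qed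
      have "(\<chi> j. cnj (z $ j)) = twisted_vec u w (r * a) (r * b) (s * c) (s * d)"
        unfolding ze by (rule vec4_eqI) (simp_all add: rs)
      then have "vol4 (\<chi> j. cnj (z $ j)) v1 v2 v3 \<in> \<real>"
        unfolding ve using vol4_twisted_real by simp
      then have "vol4 (\<chi> j. cnj (z $ j)) v1 v2 v3 / of_real ((norm z)\<^sup>2) \<in> \<real>"
        by (intro Reals_divide) auto
      moreover have "Omega_cone z v1 v2 v3 = vol4 (\<chi> j. cnj (z $ j)) v1 v2 v3 / of_real ((norm z)\<^sup>2)"
        by (rule Omega_cone_eq) (use z v tangent_space_cone[OF z] in auto)
      ultimately show "Im (Omega_cone z v1 v2 v3) = 0" by (simp add: complex_is_Real_iff) }
  qed
qed

lemma torus_pt_has_derivative: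
  "(torus_pt u w has_derivative (\<lambda>h. twisted_vec u w (- sin (fst x) * fst h / sqrt 2) (cos (fst x) * fst h / sqrt 2)
      (- sin (snd x) * snd h / sqrt 2) (cos (snd x) * snd h / sqrt 2))) (at x)"
    and smooth_on_torus_pt: "smooth_on UNIV (torus_pt u w)"
proof -
  define e where "e = (\<lambda>i. axis i (if i = 0 \<or> i = 1 then u / of_real (sqrt 2) else w / of_real (sqrt 2)) :: complex ^ 4)"
  have tw: "twisted_vec u w (a / sqrt 2) (b / sqrt 2) (c / sqrt 2) (d / sqrt 2) = a *\<^sub>R e 0 + b *\<^sub>R e 1 + c *\<^sub>R e 2 + d *\<^sub>R e 3" for a b c d
    by (rule vec4_eqI) (simp_all add: e_def axis_def scaleR_conv_of_real[where 'a = complex])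
  have F: "torus_pt u w = (\<lambda>x. cos (fst x) *\<^sub>R e 0 + sin (fst x) *\<^sub>R e 1 + cos (snd x) *\<^sub>R e 2 + sin (snd x) *\<^sub>R e 3)"
    unfolding torus_pt_eq tw ..
  show "(torus_pt u w has_derivative (\<lambda>h. twisted_vec u w (- sin (fst x) * fst h / sqrt 2) (cos (fst x) * fst h / sqrt 2)
      (- sin (snd x) * snd h / sqrt 2) (cos (snd x) * snd h / sqrt 2))) (at x)"
    unfolding F tw by (auto intro!: derivative_eq_intros simp: mult.commute)
  show "smooth_on UNIV (torus_pt u w)"
    unfolding F
    by (intro smooth_on_add smooth_on_bounded_linear_compose[OF open_UNIV bounded_linear_scaleR_left]
        smooth_on_cos smooth_on_sin smooth_on_bounded_linear open_UNIV bounded_linear_fst bounded_linear_snd)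
qed

lemma torus_pt_eq_iff:
  "torus_pt u w (a, b) = torus_pt u w (a', b') \<longleftrightarrow>
     (\<exists>k l :: int. a' = a + 2 * pi * of_int k \<and> b' = b + 2 * pi * of_int l)"
proof -
  have nz: "u \<noteq> 0" "w \<noteq> 0" using uw by auto
  have "torus_pt u w (a, b) = torus_pt u w (a', b') \<longleftrightarrow> (sin a' = sin a \<and> cos a' = cos a) \<and> (sin b' = sin b \<and> cos b' = cos b)"
    using nz by (auto simp: torus_pt_eq vec_eq_iff all_4)
  also have "\<dots> \<longleftrightarrow> (\<exists>k :: int. a' = a + 2 * pi * of_int k) \<and> (\<exists>l :: int. b' = b + 2 * pi * of_int l)"
    unfolding sin_cos_eq_iff ..
  finally show ?thesis by blast
qed

lemma norm_sq_twisted_vec: "(norm (twisted_vec u w a b c d))\<^sup>2 = a\<^sup>2 + b\<^sup>2 + c\<^sup>2 + d\<^sup>2"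
proof -
  have "cmod u = 1" "cmod w = 1" using uw by auto
  then show ?thesis by (simp add: norm_sq_4 norm_mult)
qed

lemma norm_torus_pt: "norm (torus_pt u w x) = 1"
proof -
  have "(cos t / sqrt 2)\<^sup>2 + (sin t / sqrt 2)\<^sup>2 = 1 / 2" for t :: real
    by (simp add: power_divide flip: add_divide_distrib)
  from this[of "fst x"] this[of "snd x"] have "(norm (torus_pt u w x))\<^sup>2 = 1\<^sup>2"
    unfolding torus_pt_eq norm_sq_twisted_vec by simp
  then show ?thesis by (simp only: power2_eq_iff_nonneg norm_ge_zero zero_le_one)
qed

lemma flat_torus_twisted: "flat_torus (kaehler_metric omega_cone) (twisted_torus u w)"
  unfolding flat_torus_def
proof (intro exI[of _ "torus_pt u w"] exI[of _ inner] conjI allI impI)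
  show "smooth_on UNIV (torus_pt u w)" by (rule smooth_on_torus_pt)
  show "range (torus_pt u w) = twisted_torus u w" by (simp add: twisted_torus_def)
  show "torus_pt u w (a, b) = torus_pt u w (a', b') \<longleftrightarrow>
     (\<exists>k l :: int. a' = a + 2 * pi * of_int k \<and> b' = b + 2 * pi * of_int l)" for a b a' b'
    by (rule torus_pt_eq_iff)
  show "v \<bullet> v > 0" if "v \<noteq> 0" for v :: "real \<times> real" using that by simp
  show "kaehler_metric omega_cone (torus_pt u w x) (frechet_derivative (torus_pt u w) (at x) v)
      (frechet_derivative (torus_pt u w) (at x) v') = v \<bullet> v'" for x v v'
  proof -
    define D where "D = (\<lambda>h. twisted_vec u w (- sin (fst x) * fst h / sqrt 2) (cos (fst x) * fst h / sqrt 2)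
      (- sin (snd x) * snd h / sqrt 2) (cos (snd x) * snd h / sqrt 2))"
    have fd: "frechet_derivative (torus_pt u w) (at x) = D"
      unfolding D_def using frechet_derivative_at[OF torus_pt_has_derivative] by simp
    have nz: "torus_pt u w x \<noteq> 0" using norm_torus_pt[of x] by auto
    have red: "u * p * cnj (\<i> * (u * q)) = - \<i> * (p * cnj q)" "w * p * cnj (\<i> * (w * q)) = - \<i> * (p * cnj q)"
      "cnj (u * p) * (u * q) = cnj p * q" "cnj (w * p) * (w * q) = cnj p * q" for p q
      using uw by auto
    have h: "(\<Sum>j\<in>UNIV. cnj (torus_pt u w x $ j) * D v $ j) = 0"
      unfolding sum_UNIV_4 torus_pt_eq D_def twisted_vec_nth red by simp
    have "(\<Sum>j\<in>UNIV. D v $ j * cnj ((\<i> *s D v') $ j)) = - \<i> * of_real (v \<bullet> v' / 2)"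
    proof -
      have "(\<Sum>j\<in>UNIV. D v $ j * cnj ((\<i> *s D v') $ j)) = - \<i> * of_real
         ((cos (fst x) * cos (fst x) + sin (fst x) * sin (fst x)) * (fst v * fst v') / 2
         + (cos (snd x) * cos (snd x) + sin (snd x) * sin (snd x)) * (snd v * snd v') / 2)"
        unfolding sum_UNIV_4 D_def vector_smult_component twisted_vec_nth red
        by (simp add: complex_eq_iff algebra_simps add_divide_distrib diff_divide_distrib del: sin_cos_squared_add3)
      also have "\<dots> = - \<i> * of_real (v \<bullet> v' / 2)"
        unfolding sin_cos_squared_add3 by (simp add: inner_prod_def add_divide_distrib)
      finally show ?thesis .
    qed
    then show ?thesis
      unfolding fd kaehler_metric_def omega_cone_eq[OF nz] radial_form_def norm_torus_pt h by simp
  qed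
qed

lemma torus_act_twisted:
  "torus_act a b (twisted_vec u w (r * cos s) (r * sin s) (r' * cos t) (r' * sin t))
    = twisted_vec u w (r * cos (a + s)) (r * sin (a + s)) (r' * cos (b + t)) (r' * sin (b + t))"
  unfolding torus_act_def by (rule vec4_eqI) (simp_all add: cos_add sin_add algebra_simps)

lemma torus_orbit_torus_pt: "torus_orbit (torus_pt u w x) = twisted_torus u w"
proof -
  have *: "torus_act a b (torus_pt u w x) = torus_pt u w (a + fst x, b + snd x)" for a b x
    using torus_act_twisted[of a b "1 / sqrt 2" "fst x" "1 / sqrt 2" "snd x"] by (simp add: torus_pt_eq)
  have "torus_pt u w y \<in> torus_orbit (torus_pt u w x)" for y
    unfolding torus_orbit_def * by (intro CollectI exI[of _ "fst y - fst x"] exI[of _ "snd y - snd x"]) simp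
  then show ?thesis
    unfolding twisted_torus_def torus_orbit_def * by auto
qed

end

definition swap_pairs :: "complex ^ 4 \<Rightarrow> complex ^ 4" where
  "swap_pairs z = vec4 (z $ 2) (z $ 3) (z $ 0) (z $ 1)"

lemma swap_pairs_swap_pairs [simp]: "swap_pairs (swap_pairs z) = z"
  by (rule vec4_eqI) (simp_all add: swap_pairs_def)

lemma swap_pairs_twisted_vec: "swap_pairs (twisted_vec u w a b c d) = twisted_vec w u c d a b"
  by (rule vec4_eqI) (simp_all add: swap_pairs_def)

lemma swap_pairs_cone: "swap_pairs ` cone_over (twisted_torus u w) = cone_over (twisted_torus w u)"
proof -
  have sub: "swap_pairs ` cone_over (twisted_torus u w) \<subseteq> cone_over (twisted_torus w u)" for u w
    by (auto simp: cone_over_twisted_torus swap_pairs_twisted_vec) metis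
  show ?thesis
  proof
    show "cone_over (twisted_torus w u) \<subseteq> swap_pairs ` cone_over (twisted_torus u w)"
    proof
      fix z assume "z \<in> cone_over (twisted_torus w u)"
      then have "swap_pairs z \<in> cone_over (twisted_torus u w)" using sub by blast
      then show "z \<in> swap_pairs ` cone_over (twisted_torus u w)" by (metis imageI swap_pairs_swap_pairs)
    qed
  qed (rule sub)
qed

lemma SO4_congruent_swap: "SO4_congruent (cone_over (twisted_torus u w)) (cone_over (twisted_torus w u))"
proof -
  define g :: "real ^ 4 ^ 4" where "g = vec4 (vec4 0 0 1 0) (vec4 0 0 0 1) (vec4 1 0 0 0) (vec4 0 1 0 0)"
  have "orthogonal_matrix g"
    unfolding orthogonal_matrix_def
    by (simp add: g_def matrix_matrix_mult_def transpose_def mat_def vec_eq_iff all_4 sum_UNIV_4)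
  moreover have "det g = 1"
    by (simp add: g_def det_4)
  moreover have "SO4_act g = swap_pairs"
    by (intro ext vec4_eqI) (simp_all add: SO4_act_def g_def swap_pairs_def sum_UNIV_4)
  ultimately show ?thesis
    unfolding SO4_congruent_def using swap_pairs_cone by metis
qed


section \<open>Normal form of the torus orbits far out\<close>

text \<open>
  The pair \<open>(x, y)\<close> with \<open>x\<^sup>2 + y\<^sup>2 = p\<close>, \<open>|x|\<^sup>2 + |y|\<^sup>2 = a\<close>, \<open>Im (x cnj y) = m\<close>, normalized by making
  \<open>x + i y\<close> a positive real; a rotation multiplies \<open>x + i y\<close> by a phase and \<open>x - i y\<close> by its inverse.
\<close>

definition orbit_fst :: "complex \<Rightarrow> real \<Rightarrow> real \<Rightarrow> complex" where
  "orbit_fst p a m = (of_real (sqrt (a + 2 * m)) + p / of_real (sqrt (a + 2 * m))) / 2"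

definition orbit_snd :: "complex \<Rightarrow> real \<Rightarrow> real \<Rightarrow> complex" where
  "orbit_snd p a m = (of_real (sqrt (a + 2 * m)) - p / of_real (sqrt (a + 2 * m))) / (2 * \<i>)"

lemma cmod_sq_circular:
  fixes x y :: complex
  shows "(cmod (x + \<i> * y))\<^sup>2 = (cmod x)\<^sup>2 + (cmod y)\<^sup>2 + 2 * Im (x * cnj y)"
    "(cmod (x - \<i> * y))\<^sup>2 = (cmod x)\<^sup>2 + (cmod y)\<^sup>2 - 2 * Im (x * cnj y)"
    "(x + \<i> * y) * (x - \<i> * y) = x\<^sup>2 + y\<^sup>2"
  unfolding cmod_power2 by (simp_all add: power2_eq_square algebra_simps)

lemma orbit_invariants:
  assumes "a + 2 * m > 0" "a\<^sup>2 = (cmod p)\<^sup>2 + 4 * m\<^sup>2"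
  shows "(orbit_fst p a m)\<^sup>2 + (orbit_snd p a m)\<^sup>2 = p"
    "(cmod (orbit_fst p a m))\<^sup>2 + (cmod (orbit_snd p a m))\<^sup>2 = a"
    "Im (orbit_fst p a m * cnj (orbit_snd p a m)) = m"
proof -
  define \<zeta> where "\<zeta> = complex_of_real (sqrt (a + 2 * m))"
  have \<zeta>: "\<zeta> \<noteq> 0" "(cmod \<zeta>)\<^sup>2 = a + 2 * m" using assms(1) by (simp_all add: \<zeta>_def)
  let ?x = "orbit_fst p a m" and ?y = "orbit_snd p a m"
  have x: "?x = (\<zeta> + p / \<zeta>) / 2" and y: "?y = (\<zeta> - p / \<zeta>) / (2 * \<i>)"
    by (simp_all add: orbit_fst_def orbit_snd_def \<zeta>_def)
  have 1: "?x + \<i> * ?y = \<zeta>" "?x - \<i> * ?y = p / \<zeta>"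
    unfolding x y by (simp_all add: field_simps)
  show "?x\<^sup>2 + ?y\<^sup>2 = p"
    using cmod_sq_circular(3)[of ?x ?y] \<zeta>(1) unfolding 1 by simp
  have "(cmod p)\<^sup>2 = (a + 2 * m) * (a - 2 * m)"
    using assms(2) by (simp add: power2_eq_square algebra_simps)
  then have "(cmod (p / \<zeta>))\<^sup>2 = a - 2 * m"
    using assms(1) by (simp add: norm_divide power_divide \<zeta>(2))
  then show "(cmod ?x)\<^sup>2 + (cmod ?y)\<^sup>2 = a" "Im (?x * cnj ?y) = m"
    using cmod_sq_circular(1,2)[of ?x ?y] unfolding 1 \<zeta>(2) by linarith+
qed

lemma rotation_of_equal_invariants:
  fixes x y x' y' :: complex
  assumes "x\<^sup>2 + y\<^sup>2 = x'\<^sup>2 + y'\<^sup>2" "x\<^sup>2 + y\<^sup>2 \<noteq> 0"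
    and "(cmod x)\<^sup>2 + (cmod y)\<^sup>2 = (cmod x')\<^sup>2 + (cmod y')\<^sup>2" "Im (x * cnj y) = Im (x' * cnj y')"
  shows "\<exists>\<theta>. x' = of_real (cos \<theta>) * x - of_real (sin \<theta>) * y \<and> y' = of_real (sin \<theta>) * x + of_real (cos \<theta>) * y"
proof -
  define \<zeta> \<eta> \<zeta>' \<eta>' where "\<zeta> = x + \<i> * y" "\<eta> = x - \<i> * y" "\<zeta>' = x' + \<i> * y'" "\<eta>' = x' - \<i> * y'"
  note d = this
  have p: "\<zeta> * \<eta> = \<zeta>' * \<eta>'" "\<zeta> * \<eta> \<noteq> 0"
    unfolding d cmod_sq_circular(3) using assms(1,2) by auto
  then have nz: "\<zeta> \<noteq> 0" "\<zeta>' \<noteq> 0" by auto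
  have "(cmod \<zeta>')\<^sup>2 = (cmod \<zeta>)\<^sup>2"
    unfolding d cmod_sq_circular(1) using assms(3,4) by simp
  then have "cmod \<zeta>' = cmod \<zeta>"
    by (simp only: power2_eq_iff_nonneg norm_ge_zero)
  then have "cmod (\<zeta>' / \<zeta>) = 1" using nz by (simp add: norm_divide)
  then obtain \<theta> where "\<zeta>' / \<zeta> = cis \<theta>"
    by (metis complex_norm_eq_1_exp cis_conv_exp)
  then have 1: "\<zeta>' = cis \<theta> * \<zeta>" using nz by (simp add: field_simps)
  then have "\<zeta> * \<eta> = \<zeta> * (cis \<theta> * \<eta>')" using p(1) by (simp add: mult_ac)
  then have "\<eta> = cis \<theta> * \<eta>'" using nz by simp
  moreover have "cnj (cis \<theta>) * cis \<theta> = 1"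
    unfolding cis_cnj cis_mult by simp
  ultimately have 2: "\<eta>' = cnj (cis \<theta>) * \<eta>"
    by (simp flip: mult.assoc)
  have "x' = (\<zeta>' + \<eta>') / 2" "y' = - \<i> * (\<zeta>' - \<eta>') / 2"
    unfolding d by (simp_all add: algebra_simps)
  then show ?thesis
    unfolding 1 2 d by (intro exI[of _ \<theta>]) (simp add: complex_eq_iff algebra_simps add_divide_distrib diff_divide_distrib)
qed

text \<open>
  For unit vectors \<open>z\<close> with \<open>z\<^sub>0\<^sup>2 + z\<^sub>1\<^sup>2 + z\<^sub>2\<^sup>2 + z\<^sub>3\<^sup>2 = e\<close>, \<open>Im (z\<^sub>0\<^sup>2 + z\<^sub>1\<^sup>2) = g\<close> and moments \<open>m\<close>, \<open>n\<close>, write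
  \<open>P\<close>, \<open>Q\<close> for the sums of squares and \<open>A\<close>, \<open>B\<close> for the squared lengths of the two pairs.  The relations
  \<open>A\<^sup>2 = |P|\<^sup>2 + 4 m\<^sup>2\<close>, \<open>B\<^sup>2 = |Q|\<^sup>2 + 4 n\<^sup>2\<close>, \<open>A + B = 1\<close>, \<open>P + Q = e\<close> reduce to a quadratic equation for
  \<open>Y = Re P - Re Q\<close>, whose positive root is \<open>asym_root\<close>.
\<close>

definition asym_gap :: "real \<Rightarrow> real \<Rightarrow> real" where
  "asym_gap m n = 4 * m\<^sup>2 - 4 * n\<^sup>2"

definition asym_const :: "real \<Rightarrow> real \<Rightarrow> real \<Rightarrow> real \<Rightarrow> real" where
  "asym_const e g m n = 1 - e\<^sup>2 - 2 * (2 * g\<^sup>2 + 4 * m\<^sup>2 + 4 * n\<^sup>2) + (asym_gap m n)\<^sup>2"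

definition asym_root :: "real \<Rightarrow> real \<Rightarrow> real \<Rightarrow> real \<Rightarrow> real" where
  "asym_root e g m n = (e * asym_gap m n + sqrt ((e * asym_gap m n)\<^sup>2 + (1 - e\<^sup>2) * asym_const e g m n)) / (1 - e\<^sup>2)"

definition asym_mod1 :: "real \<Rightarrow> real \<Rightarrow> real \<Rightarrow> real \<Rightarrow> real" where
  "asym_mod1 e g m n = (1 + e * asym_root e g m n + asym_gap m n) / 2"

definition asym_mod2 :: "real \<Rightarrow> real \<Rightarrow> real \<Rightarrow> real \<Rightarrow> real" where
  "asym_mod2 e g m n = (1 - e * asym_root e g m n - asym_gap m n) / 2"

definition asym_sq1 :: "real \<Rightarrow> real \<Rightarrow> real \<Rightarrow> real \<Rightarrow> complex" where
  "asym_sq1 e g m n = Complex ((asym_root e g m n + e) / 2) g"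

definition asym_sq2 :: "real \<Rightarrow> real \<Rightarrow> real \<Rightarrow> real \<Rightarrow> complex" where
  "asym_sq2 e g m n = Complex ((e - asym_root e g m n) / 2) (- g)"

definition asym_pt :: "real \<Rightarrow> real \<Rightarrow> real \<Rightarrow> real \<Rightarrow> complex ^ 4" where
  "asym_pt e g m n =
     vec4 (orbit_fst (asym_sq1 e g m n) (asym_mod1 e g m n) m) (orbit_snd (asym_sq1 e g m n) (asym_mod1 e g m n) m)
          (orbit_fst (asym_sq2 e g m n) (asym_mod2 e g m n) n) (orbit_snd (asym_sq2 e g m n) (asym_mod2 e g m n) n)"

definition asym_admissible :: "real \<Rightarrow> real \<Rightarrow> real \<Rightarrow> real \<Rightarrow> bool" where
  "asym_admissible e g m n \<longleftrightarrow> 0 < e \<and> e < 1 \<and> 0 < asym_const e g m n \<and> e < asym_root e g m n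
     \<and> 0 < asym_mod1 e g m n \<and> 0 < asym_mod2 e g m n"

definition unit_level_set :: "real \<Rightarrow> real \<Rightarrow> real \<Rightarrow> real \<Rightarrow> (complex ^ 4) set" where
  "unit_level_set e g m n = {z. norm z = 1 \<and> quad z = of_real e \<and> Im ((z $ 0)\<^sup>2 + (z $ 1)\<^sup>2) = g
     \<and> Im (z $ 0 * cnj (z $ 1)) = m \<and> Im (z $ 2 * cnj (z $ 3)) = n}"

lemma asym_root_eq:
  assumes "asym_admissible e g m n"
  shows "(1 - e\<^sup>2) * (asym_root e g m n)\<^sup>2 - 2 * e * asym_gap m n * asym_root e g m n - asym_const e g m n = 0"
proof -
  define c q where "c = 1 - e\<^sup>2" and "q = sqrt ((e * asym_gap m n)\<^sup>2 + c * asym_const e g m n)"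
  have e: "0 < e" "e < 1" "0 < asym_const e g m n" using assms by (simp_all add: asym_admissible_def)
  have c: "c > 0" unfolding c_def using e by (simp add: power_less_one_iff)
  have q2: "q\<^sup>2 = (e * asym_gap m n)\<^sup>2 + c * asym_const e g m n"
    unfolding q_def using c e by simp
  have Y: "asym_root e g m n = (e * asym_gap m n + q) / c"
    by (simp add: asym_root_def c_def q_def)
  have "c * asym_root e g m n = e * asym_gap m n + q" unfolding Y using c by simp
  then have "(c * asym_root e g m n - e * asym_gap m n)\<^sup>2 = q\<^sup>2" by simp
  then have "c * (c * (asym_root e g m n)\<^sup>2 - 2 * e * asym_gap m n * asym_root e g m n - asym_const e g m n) = 0"
    unfolding q2 by (simp add: power2_eq_square algebra_simps)
  then show ?thesis using c unfolding c_def by simp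
qed

lemma asym_mod_sq:
  assumes "asym_admissible e g m n"
  shows "(asym_mod1 e g m n)\<^sup>2 = (cmod (asym_sq1 e g m n))\<^sup>2 + 4 * m\<^sup>2"
    "(asym_mod2 e g m n)\<^sup>2 = (cmod (asym_sq2 e g m n))\<^sup>2 + 4 * n\<^sup>2"
proof -
  define Y where "Y = asym_root e g m n"
  have r: "(1 - e\<^sup>2) * Y\<^sup>2 - 2 * e * asym_gap m n * Y - asym_const e g m n = 0"
    unfolding Y_def by (rule asym_root_eq[OF assms])
  have "4 * ((asym_mod1 e g m n)\<^sup>2 - (cmod (asym_sq1 e g m n))\<^sup>2 - 4 * m\<^sup>2)
      = - ((1 - e\<^sup>2) * Y\<^sup>2 - 2 * e * asym_gap m n * Y - asym_const e g m n)"
    unfolding asym_mod1_def asym_sq1_def Y_def[symmetric] asym_const_def asym_gap_def cmod_power2 complex.sel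
    by (simp add: power2_eq_square field_simps)
  then show "(asym_mod1 e g m n)\<^sup>2 = (cmod (asym_sq1 e g m n))\<^sup>2 + 4 * m\<^sup>2"
    unfolding r by simp
  have "4 * ((asym_mod2 e g m n)\<^sup>2 - (cmod (asym_sq2 e g m n))\<^sup>2 - 4 * n\<^sup>2)
      = - ((1 - e\<^sup>2) * Y\<^sup>2 - 2 * e * asym_gap m n * Y - asym_const e g m n)"
    unfolding asym_mod2_def asym_sq2_def Y_def[symmetric] asym_const_def asym_gap_def cmod_power2 complex.sel
    by (simp add: power2_eq_square field_simps)
  then show "(asym_mod2 e g m n)\<^sup>2 = (cmod (asym_sq2 e g m n))\<^sup>2 + 4 * n\<^sup>2"
    unfolding r by simp
qed

lemma asym_sqrt_arg_pos:
  assumes "asym_admissible e g m n"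
  shows "0 < asym_mod1 e g m n + 2 * m" "0 < asym_mod2 e g m n + 2 * n"
proof -
  have pos: "0 < a + 2 * k" if "0 < a" "a\<^sup>2 = (cmod p)\<^sup>2 + 4 * k\<^sup>2" "p \<noteq> 0" for a k :: real and p
  proof -
    have "(cmod p)\<^sup>2 > 0" using that(3) by simp
    then have "\<bar>2 * k\<bar>\<^sup>2 < a\<^sup>2" using that(2) by (simp add: power_mult_distrib)
    then have "\<bar>2 * k\<bar> < a" by (rule power_less_imp_less_base) (use that(1) in simp)
    then show ?thesis by linarith
  qed
  have "asym_sq1 e g m n \<noteq> 0" "asym_sq2 e g m n \<noteq> 0"
    using assms by (auto simp: asym_admissible_def asym_sq1_def asym_sq2_def complex_eq_iff)
  then show "0 < asym_mod1 e g m n + 2 * m" "0 < asym_mod2 e g m n + 2 * n"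
    using pos asym_mod_sq[OF assms] assms by (auto simp: asym_admissible_def)
qed

lemma asym_pt_invariants:
  assumes "asym_admissible e g m n"
  shows "(asym_pt e g m n $ 0)\<^sup>2 + (asym_pt e g m n $ 1)\<^sup>2 = asym_sq1 e g m n"
    "(asym_pt e g m n $ 2)\<^sup>2 + (asym_pt e g m n $ 3)\<^sup>2 = asym_sq2 e g m n"
    "(cmod (asym_pt e g m n $ 0))\<^sup>2 + (cmod (asym_pt e g m n $ 1))\<^sup>2 = asym_mod1 e g m n"
    "(cmod (asym_pt e g m n $ 2))\<^sup>2 + (cmod (asym_pt e g m n $ 3))\<^sup>2 = asym_mod2 e g m n"
    "Im (asym_pt e g m n $ 0 * cnj (asym_pt e g m n $ 1)) = m"
    "Im (asym_pt e g m n $ 2 * cnj (asym_pt e g m n $ 3)) = n"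
  unfolding asym_pt_def vec4_nth
  using orbit_invariants[OF asym_sqrt_arg_pos(1)[OF assms] asym_mod_sq(1)[OF assms]]
    orbit_invariants[OF asym_sqrt_arg_pos(2)[OF assms] asym_mod_sq(2)[OF assms]] by blast+

lemma asym_pt_in_unit_level_set:
  assumes "asym_admissible e g m n"
  shows "asym_pt e g m n \<in> unit_level_set e g m n" "Re ((asym_pt e g m n $ 0)\<^sup>2 + (asym_pt e g m n $ 1)\<^sup>2) > e / 2"
proof -
  note i = asym_pt_invariants[OF assms]
  have "(norm (asym_pt e g m n))\<^sup>2 = asym_mod1 e g m n + asym_mod2 e g m n"
    unfolding norm_sq_4 i(3,4)[symmetric] by simp
  also have "\<dots> = 1\<^sup>2" by (simp add: asym_mod1_def asym_mod2_def flip: add_divide_distrib)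
  finally have n: "norm (asym_pt e g m n) = 1" by (simp only: power2_eq_iff_nonneg norm_ge_zero zero_le_one)
  have "quad (asym_pt e g m n) = asym_sq1 e g m n + asym_sq2 e g m n"
    unfolding quad_def i(1,2)[symmetric] by simp
  also have "\<dots> = of_real e" by (simp add: asym_sq1_def asym_sq2_def complex_eq_iff field_simps)
  finally have q: "quad (asym_pt e g m n) = of_real e" .
  show "asym_pt e g m n \<in> unit_level_set e g m n"
    unfolding unit_level_set_def mem_Collect_eq i n q by (simp add: asym_sq1_def)
  show "Re ((asym_pt e g m n $ 0)\<^sup>2 + (asym_pt e g m n $ 1)\<^sup>2) > e / 2"
    unfolding i(1) using assms by (simp add: asym_sq1_def asym_admissible_def)
qed

lemma unit_level_set_quadratic:
  assumes z: "z \<in> unit_level_set e g m n"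
  defines "Y \<equiv> 2 * Re ((z $ 0)\<^sup>2 + (z $ 1)\<^sup>2) - e"
  shows "(1 - e\<^sup>2) * Y\<^sup>2 - 2 * e * asym_gap m n * Y - asym_const e g m n = 0"
    and "(cmod (z $ 0))\<^sup>2 + (cmod (z $ 1))\<^sup>2 = (1 + e * Y + asym_gap m n) / 2"
    and "(cmod (z $ 2))\<^sup>2 + (cmod (z $ 3))\<^sup>2 = (1 - e * Y - asym_gap m n) / 2"
    and "(z $ 0)\<^sup>2 + (z $ 1)\<^sup>2 = Complex ((Y + e) / 2) g"
    and "(z $ 2)\<^sup>2 + (z $ 3)\<^sup>2 = Complex ((e - Y) / 2) (- g)"
proof -
  define A B where "A = (cmod (z $ 0))\<^sup>2 + (cmod (z $ 1))\<^sup>2" "B = (cmod (z $ 2))\<^sup>2 + (cmod (z $ 3))\<^sup>2"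
  note AB = this
  show P: "(z $ 0)\<^sup>2 + (z $ 1)\<^sup>2 = Complex ((Y + e) / 2) g"
    using z by (simp add: unit_level_set_def Y_def complex_eq_iff)
  have "(z $ 2)\<^sup>2 + (z $ 3)\<^sup>2 = of_real e - ((z $ 0)\<^sup>2 + (z $ 1)\<^sup>2)"
    using z by (simp add: unit_level_set_def quad_def algebra_simps)
  also have "\<dots> = Complex ((e - Y) / 2) (- g)"
    unfolding P by (simp add: complex_eq_iff field_simps)
  finally show Q: "(z $ 2)\<^sup>2 + (z $ 3)\<^sup>2 = Complex ((e - Y) / 2) (- g)" .
  have A2: "A\<^sup>2 = ((Y + e) / 2)\<^sup>2 + g\<^sup>2 + 4 * m\<^sup>2"
    using cmod_sq_sum_squares[of "z $ 0" "z $ 1"] z unfolding AB P cmod_power2 by (simp add: unit_level_set_def)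
  have B2: "B\<^sup>2 = ((e - Y) / 2)\<^sup>2 + g\<^sup>2 + 4 * n\<^sup>2"
    using cmod_sq_sum_squares[of "z $ 2" "z $ 3"] z unfolding AB Q cmod_power2 by (simp add: unit_level_set_def)
  have s: "A + B = 1"
    using norm_sq_4[of z] z by (simp add: AB unit_level_set_def)
  have "A - B = (A - B) * (A + B)" using s by simp
  also have "\<dots> = A\<^sup>2 - B\<^sup>2" by (simp add: power2_eq_square algebra_simps)
  also have "\<dots> = e * Y + asym_gap m n" unfolding A2 B2 asym_gap_def by (simp add: power2_eq_square field_simps)
  finally have d: "A - B = e * Y + asym_gap m n" .
  show A: "(cmod (z $ 0))\<^sup>2 + (cmod (z $ 1))\<^sup>2 = (1 + e * Y + asym_gap m n) / 2"
    and "(cmod (z $ 2))\<^sup>2 + (cmod (z $ 3))\<^sup>2 = (1 - e * Y - asym_gap m n) / 2"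
    using s d unfolding AB[symmetric] by simp_all
  have "((1 + e * Y + asym_gap m n) / 2)\<^sup>2 = ((Y + e) / 2)\<^sup>2 + g\<^sup>2 + 4 * m\<^sup>2"
    using A2 A unfolding AB by simp
  moreover have "4 * (((1 + e * Y + asym_gap m n) / 2)\<^sup>2 - ((Y + e) / 2)\<^sup>2 - g\<^sup>2 - 4 * m\<^sup>2)
      = - ((1 - e\<^sup>2) * Y\<^sup>2 - 2 * e * asym_gap m n * Y - asym_const e g m n)"
    unfolding asym_const_def asym_gap_def by (simp add: power2_eq_square field_simps)
  ultimately show "(1 - e\<^sup>2) * Y\<^sup>2 - 2 * e * asym_gap m n * Y - asym_const e g m n = 0"
    by simp
qed

lemma unit_level_set_orbit:
  assumes adm: "asym_admissible e g m n" and z: "z \<in> unit_level_set e g m n"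
    and pos: "Re ((z $ 0)\<^sup>2 + (z $ 1)\<^sup>2) > e / 2"
  shows "\<exists>\<theta>1 \<theta>2. z = torus_act \<theta>1 \<theta>2 (asym_pt e g m n)"
proof -
  define Y' Y where "Y' = 2 * Re ((z $ 0)\<^sup>2 + (z $ 1)\<^sup>2) - e" and "Y = asym_root e g m n"
  note u = unit_level_set_quadratic[OF z, folded Y'_def]
  have Y: "Y > 0" "Y' > 0" using adm pos by (simp_all add: asym_admissible_def Y_def Y'_def)
  have q: "(1 - e\<^sup>2) * Y\<^sup>2 - 2 * e * asym_gap m n * Y - asym_const e g m n = 0"
    unfolding Y_def by (rule asym_root_eq[OF adm])
  have c: "asym_const e g m n > 0" "1 - e\<^sup>2 > 0"
    using adm by (simp_all add: asym_admissible_def power_less_one_iff)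
  have "Y' = Y"
  proof (rule ccontr)
    assume "Y' \<noteq> Y"
    have "(Y' - Y) * ((1 - e\<^sup>2) * (Y' + Y) - 2 * e * asym_gap m n) = 0"
      using u(1) q by (simp add: power2_eq_square algebra_simps)
    then have "(1 - e\<^sup>2) * (Y' + Y) = 2 * e * asym_gap m n" using \<open>Y' \<noteq> Y\<close> by simp
    then have "asym_const e g m n = (1 - e\<^sup>2) * Y\<^sup>2 - (1 - e\<^sup>2) * (Y' + Y) * Y" using q by simp
    also have "\<dots> = - ((1 - e\<^sup>2) * (Y' * Y))" by (simp add: power2_eq_square algebra_simps)
    also have "\<dots> < 0" using c Y by simp
    finally show False using c by simp
  qed
  note u = u[unfolded this Y_def]
  note i = asym_pt_invariants[OF adm, unfolded asym_sq1_def asym_sq2_def asym_mod1_def asym_mod2_def]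
  let ?p = "asym_pt e g m n"
  have "(?p $ 0)\<^sup>2 + (?p $ 1)\<^sup>2 \<noteq> 0" "(?p $ 2)\<^sup>2 + (?p $ 3)\<^sup>2 \<noteq> 0"
    unfolding i using adm by (simp_all add: complex_eq_iff asym_admissible_def)
  then obtain \<theta>1 \<theta>2 where
    "z $ 0 = of_real (cos \<theta>1) * ?p $ 0 - of_real (sin \<theta>1) * ?p $ 1"
    "z $ 1 = of_real (sin \<theta>1) * ?p $ 0 + of_real (cos \<theta>1) * ?p $ 1"
    "z $ 2 = of_real (cos \<theta>2) * ?p $ 2 - of_real (sin \<theta>2) * ?p $ 3"
    "z $ 3 = of_real (sin \<theta>2) * ?p $ 2 + of_real (cos \<theta>2) * ?p $ 3"
    using rotation_of_equal_invariants[of "?p $ 0" "?p $ 1" "z $ 0" "z $ 1"]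
      rotation_of_equal_invariants[of "?p $ 2" "?p $ 3" "z $ 2" "z $ 3"] i u z
    unfolding unit_level_set_def by auto
  then have "z = torus_act \<theta>1 \<theta>2 ?p"
    unfolding torus_act_def by (intro vec4_eqI) simp_all
  then show ?thesis by blast
qed

lemma tendsto_vec4:
  fixes f :: "'b \<Rightarrow> 'a::topological_space"
  assumes "(f \<longlongrightarrow> a) F" "(g \<longlongrightarrow> b) F" "(h \<longlongrightarrow> c) F" "(k \<longlongrightarrow> d) F"
  shows "((\<lambda>x. vec4 (f x) (g x) (h x) (k x)) \<longlongrightarrow> vec4 a b c d) F"
proof (rule vec_tendstoI)
  have "\<forall>i. ((\<lambda>x. vec4 (f x) (g x) (h x) (k x) $ i) \<longlongrightarrow> vec4 a b c d $ i) F"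
    unfolding all_4 using assms by simp
  then show "((\<lambda>x. vec4 (f x) (g x) (h x) (k x) $ i) \<longlongrightarrow> vec4 a b c d $ i) F" for i ..
qed

lemma tendsto_asym:
  assumes e: "(e \<longlongrightarrow> e0) F" and g: "(g \<longlongrightarrow> g0) F" and m: "(m \<longlongrightarrow> m0) F" and n: "(n \<longlongrightarrow> n0) F"
    and e0: "e0\<^sup>2 < 1"
  shows tendsto_asym_const: "((\<lambda>x. asym_const (e x) (g x) (m x) (n x)) \<longlongrightarrow> asym_const e0 g0 m0 n0) F"
    and tendsto_asym_root: "((\<lambda>x. asym_root (e x) (g x) (m x) (n x)) \<longlongrightarrow> asym_root e0 g0 m0 n0) F"
    and tendsto_asym_mod1: "((\<lambda>x. asym_mod1 (e x) (g x) (m x) (n x)) \<longlongrightarrow> asym_mod1 e0 g0 m0 n0) F"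
    and tendsto_asym_mod2: "((\<lambda>x. asym_mod2 (e x) (g x) (m x) (n x)) \<longlongrightarrow> asym_mod2 e0 g0 m0 n0) F"
proof -
  have gap: "((\<lambda>x. asym_gap (m x) (n x)) \<longlongrightarrow> asym_gap m0 n0) F"
    unfolding asym_gap_def by (intro tendsto_intros m n)
  show c: "((\<lambda>x. asym_const (e x) (g x) (m x) (n x)) \<longlongrightarrow> asym_const e0 g0 m0 n0) F"
    unfolding asym_const_def by (intro tendsto_intros e g m n gap)
  show r: "((\<lambda>x. asym_root (e x) (g x) (m x) (n x)) \<longlongrightarrow> asym_root e0 g0 m0 n0) F"
    unfolding asym_root_def by (intro tendsto_intros e gap c) (use e0 in simp)
  show "((\<lambda>x. asym_mod1 (e x) (g x) (m x) (n x)) \<longlongrightarrow> asym_mod1 e0 g0 m0 n0) F"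
    "((\<lambda>x. asym_mod2 (e x) (g x) (m x) (n x)) \<longlongrightarrow> asym_mod2 e0 g0 m0 n0) F"
    unfolding asym_mod1_def asym_mod2_def by (intro tendsto_intros e gap r; simp)+
qed

lemma tendsto_asym_pt:
  assumes e: "(e \<longlongrightarrow> e0) F" and g: "(g \<longlongrightarrow> g0) F" and m: "(m \<longlongrightarrow> m0) F" and n: "(n \<longlongrightarrow> n0) F"
    and e0: "e0\<^sup>2 < 1" and pos: "0 < asym_mod1 e0 g0 m0 n0 + 2 * m0" "0 < asym_mod2 e0 g0 m0 n0 + 2 * n0"
  shows "((\<lambda>x. asym_pt (e x) (g x) (m x) (n x)) \<longlongrightarrow> asym_pt e0 g0 m0 n0) F"
proof -
  note asym = tendsto_asym[OF assms(1-5)]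
  have sq: "((\<lambda>x. asym_sq1 (e x) (g x) (m x) (n x)) \<longlongrightarrow> asym_sq1 e0 g0 m0 n0) F"
    "((\<lambda>x. asym_sq2 (e x) (g x) (m x) (n x)) \<longlongrightarrow> asym_sq2 e0 g0 m0 n0) F"
    unfolding asym_sq1_def asym_sq2_def by (intro tendsto_Complex tendsto_intros e g asym; simp)+
  show ?thesis
    unfolding asym_pt_def orbit_fst_def orbit_snd_def
    by (intro tendsto_vec4 tendsto_intros sq asym m n) (use pos in auto)
qed


section \<open>The two ends\<close>

lemma torus_act_scaleR: "torus_act a b (r *\<^sub>R z) = r *\<^sub>R torus_act a b z"
  unfolding torus_act_def by (rule vec4_eqI) (simp_all add: scaleR_conv_of_real[where 'a = complex] algebra_simps)

lemma torus_act_diff: "torus_act a b (z - w) = torus_act a b z - torus_act a b w"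
  unfolding torus_act_def by (rule vec4_eqI) (simp_all add: algebra_simps)

lemma torus_act_invariants:
  defines "w \<equiv> \<lambda>a b z. torus_act a b z"
  shows "(w a b z $ 0)\<^sup>2 + (w a b z $ 1)\<^sup>2 = (z $ 0)\<^sup>2 + (z $ 1)\<^sup>2"
    "(w a b z $ 2)\<^sup>2 + (w a b z $ 3)\<^sup>2 = (z $ 2)\<^sup>2 + (z $ 3)\<^sup>2"
    "(cmod (w a b z $ 0))\<^sup>2 + (cmod (w a b z $ 1))\<^sup>2 = (cmod (z $ 0))\<^sup>2 + (cmod (z $ 1))\<^sup>2"
    "(cmod (w a b z $ 2))\<^sup>2 + (cmod (w a b z $ 3))\<^sup>2 = (cmod (z $ 2))\<^sup>2 + (cmod (z $ 3))\<^sup>2"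
    "Im (w a b z $ 0 * cnj (w a b z $ 1)) = Im (z $ 0 * cnj (z $ 1))"
    "Im (w a b z $ 2 * cnj (w a b z $ 3)) = Im (z $ 2 * cnj (z $ 3))"
proof -
  have sc: "(sin t)\<^sup>2 + (cos t)\<^sup>2 = 1" for t :: real by simp
  have "(of_real c * x - of_real s * y)\<^sup>2 + (of_real s * x + of_real c * y)\<^sup>2 = of_real (s\<^sup>2 + c\<^sup>2) * (x\<^sup>2 + y\<^sup>2)"
    for c s and x y :: complex
    by (simp add: power2_eq_square algebra_simps)
  note 1 = this[of "cos t" _ "sin t" for t, unfolded sc of_real_1 mult_1]
  have "(cmod (of_real c * x - of_real s * y))\<^sup>2 + (cmod (of_real s * x + of_real c * y))\<^sup>2
      = (s\<^sup>2 + c\<^sup>2) * ((cmod x)\<^sup>2 + (cmod y)\<^sup>2)" for c s x y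
    unfolding cmod_power2 by (simp add: power2_eq_square algebra_simps)
  note 2 = this[of "cos t" _ "sin t" for t, unfolded sc mult_1]
  have "Im ((of_real c * x - of_real s * y) * cnj (of_real s * x + of_real c * y)) = (s\<^sup>2 + c\<^sup>2) * Im (x * cnj y)" for c s x y
    by (simp add: power2_eq_square algebra_simps)
  note 3 = this[of "cos t" _ "sin t" for t, unfolded sc mult_1]
  show "(w a b z $ 0)\<^sup>2 + (w a b z $ 1)\<^sup>2 = (z $ 0)\<^sup>2 + (z $ 1)\<^sup>2"
    "(w a b z $ 2)\<^sup>2 + (w a b z $ 3)\<^sup>2 = (z $ 2)\<^sup>2 + (z $ 3)\<^sup>2"
    "(cmod (w a b z $ 0))\<^sup>2 + (cmod (w a b z $ 1))\<^sup>2 = (cmod (z $ 0))\<^sup>2 + (cmod (z $ 1))\<^sup>2"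
    "(cmod (w a b z $ 2))\<^sup>2 + (cmod (w a b z $ 3))\<^sup>2 = (cmod (z $ 2))\<^sup>2 + (cmod (z $ 3))\<^sup>2"
    "Im (w a b z $ 0 * cnj (w a b z $ 1)) = Im (z $ 0 * cnj (z $ 1))"
    "Im (w a b z $ 2 * cnj (w a b z $ 3)) = Im (z $ 2 * cnj (z $ 3))"
    unfolding w_def torus_act_def vec4_nth 1 2 3 by (rule refl)+
qed

lemma norm_torus_act: "norm (torus_act a b z) = norm z"
proof -
  have "(norm (torus_act a b z))\<^sup>2 = (norm z)\<^sup>2"
    using torus_act_invariants(3,4)[of a b z] unfolding norm_sq_4 by simp
  then show ?thesis by (simp only: power2_eq_iff_nonneg norm_ge_zero)
qed

lemma quad_torus_act: "quad (torus_act a b z) = quad z"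
  using torus_act_invariants(1,2)[of a b z] unfolding quad_def by (simp add: add.assoc)

lemma torus_act_torus_act: "torus_act (- a) (- b) (torus_act a b z) = z"
proof (rule vec4_eqI)
  have sc: "(cos t)\<^sup>2 + (sin t)\<^sup>2 = 1" for t :: real by simp
  have "of_real c * (of_real c * x - of_real s * y) - of_real (- s) * (of_real s * x + of_real c * y) = of_real (c\<^sup>2 + s\<^sup>2) * x"
    "of_real (- s) * (of_real c * x - of_real s * y) + of_real c * (of_real s * x + of_real c * y) = of_real (c\<^sup>2 + s\<^sup>2) * y"
    for c s and x y :: complex
    by (simp_all add: power2_eq_square algebra_simps)
  note * = this[where c = "cos t" and s = "sin t" for t, unfolded sc of_real_1 mult_1]
  show "torus_act (- a) (- b) (torus_act a b z) $ 0 = z $ 0" "torus_act (- a) (- b) (torus_act a b z) $ 1 = z $ 1"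
    "torus_act (- a) (- b) (torus_act a b z) $ 2 = z $ 2" "torus_act (- a) (- b) (torus_act a b z) $ 3 = z $ 3"
    unfolding torus_act_def vec4_nth cos_minus sin_minus * by (rule refl)+
qed

lemma torus_act_L_fam: "z \<in> L_fam \<kappa> c1 c2 c3 \<Longrightarrow> torus_act a b z \<in> L_fam \<kappa> c1 c2 c3"
  unfolding L_fam_def quadric_def mem_Collect_eq quad_torus_act norm_torus_act torus_act_invariants .

lemma torus_act_image_L_fam: "torus_act a b ` L_fam \<kappa> c1 c2 c3 = L_fam \<kappa> c1 c2 c3"
proof
  show "L_fam \<kappa> c1 c2 c3 \<subseteq> torus_act a b ` L_fam \<kappa> c1 c2 c3"
  proof
    fix z assume "z \<in> L_fam \<kappa> c1 c2 c3"
    then have "torus_act (- a) (- b) z \<in> L_fam \<kappa> c1 c2 c3" by (rule torus_act_L_fam)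
    moreover have "z = torus_act a b (torus_act (- a) (- b) z)"
      using torus_act_torus_act[of "- a" "- b" z] by simp
    ultimately show "z \<in> torus_act a b ` L_fam \<kappa> c1 c2 c3" by blast
  qed
qed (auto intro: torus_act_L_fam)

definition L_asym :: "real \<Rightarrow> real \<Rightarrow> real \<Rightarrow> real \<Rightarrow> (real \<Rightarrow> real \<Rightarrow> real \<Rightarrow> real \<Rightarrow> 'a) \<Rightarrow> real \<Rightarrow> 'a" where
  "L_asym \<kappa> c1 c2 c3 F r =
     F (1 / r\<^sup>2) (c3 / r\<^sup>2) (c1 / (r\<^sup>2 * du_St \<kappa> (r\<^sup>2))) (c2 / (r\<^sup>2 * du_St \<kappa> (r\<^sup>2)))"

definition L_upper :: "real \<Rightarrow> real \<Rightarrow> real \<Rightarrow> real \<Rightarrow> (complex ^ 4) set" where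
  "L_upper \<kappa> c1 c2 c3 = {z \<in> L_fam \<kappa> c1 c2 c3. Re ((z $ 0)\<^sup>2 + (z $ 1)\<^sup>2) > 1 / 2}"

lemma scaled_L_fam_iff:
  assumes \<kappa>: "\<kappa> > 0" and r: "r > 1" and z: "norm z = 1"
  shows "r *\<^sub>R z \<in> L_fam \<kappa> c1 c2 c3 \<longleftrightarrow> z \<in> L_asym \<kappa> c1 c2 c3 unit_level_set r"
proof -
  have r2: "r\<^sup>2 > 1" using r by (simp add: one_less_power)
  have d: "du_St \<kappa> (r\<^sup>2) > 0" using du_St_pos[OF \<kappa>, of "r\<^sup>2"] r2 by simp
  have n: "norm (r *\<^sub>R z) = r" using r z by simp
  have s: "(r *\<^sub>R z) $ i = of_real r * z $ i" for i
    by (simp add: scaleR_conv_of_real[where 'a = complex])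
  have q: "quad (r *\<^sub>R z) = of_real (r\<^sup>2) * quad z"
    unfolding quad_def s by (simp add: power_mult_distrib algebra_simps)
  have i: "Im (((r *\<^sub>R z) $ 0)\<^sup>2 + ((r *\<^sub>R z) $ 1)\<^sup>2) = r\<^sup>2 * Im ((z $ 0)\<^sup>2 + (z $ 1)\<^sup>2)"
    unfolding s power_mult_distrib distrib_left[symmetric] of_real_power[symmetric] by simp
  have m: "Im ((r *\<^sub>R z) $ j * cnj ((r *\<^sub>R z) $ k)) = r\<^sup>2 * Im (z $ j * cnj (z $ k))" for j k
    unfolding s by (simp add: power2_eq_square algebra_simps)
  have "quad (r *\<^sub>R z) = 1 \<longleftrightarrow> quad z = of_real (1 / r\<^sup>2)"
    unfolding q using r by (auto simp: field_simps)
  moreover have "r\<^sup>2 * Im ((z $ 0)\<^sup>2 + (z $ 1)\<^sup>2) = c3 \<longleftrightarrow> Im ((z $ 0)\<^sup>2 + (z $ 1)\<^sup>2) = c3 / r\<^sup>2"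
    using r by (simp add: eq_divide_eq mult.commute)
  moreover have "du_St \<kappa> (r\<^sup>2) * (r\<^sup>2 * x) = c \<longleftrightarrow> x = c / (r\<^sup>2 * du_St \<kappa> (r\<^sup>2))" for x c
    using r d by (auto simp: field_simps)
  ultimately show ?thesis
    unfolding L_fam_iff[OF \<kappa>] n m i L_asym_def unit_level_set_def using z by blast
qed

lemma L_asym_tendsto_parameters:
  assumes \<kappa>: "\<kappa> > 0"
  shows "((\<lambda>r. 1 / r\<^sup>2) \<longlongrightarrow> (0::real)) at_top" "((\<lambda>r. c3 / r\<^sup>2) \<longlongrightarrow> (0::real)) at_top"
    "((\<lambda>r. c / (r\<^sup>2 * du_St \<kappa> (r\<^sup>2))) \<longlongrightarrow> 0) at_top"
proof -
  have sq: "filterlim (\<lambda>r::real. r\<^sup>2) at_top at_top"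
    by (rule filterlim_pow_at_top[OF _ filterlim_ident]) simp
  show "((\<lambda>r. 1 / r\<^sup>2) \<longlongrightarrow> (0::real)) at_top" "((\<lambda>r. c3 / r\<^sup>2) \<longlongrightarrow> (0::real)) at_top"
    by (rule real_tendsto_divide_at_top[OF tendsto_const sq])+
  have "filterlim (\<lambda>s. s * du_St \<kappa> s) at_top at_top"
  proof (rule filterlim_at_top_mono[OF filterlim_du_St_mult[OF \<kappa>]])
    show "eventually (\<lambda>s. sqrt (s\<^sup>2 - 1) * du_St \<kappa> s \<le> s * du_St \<kappa> s) at_top"
      using eventually_ge_at_top[of 1]
    proof eventually_elim
      case (elim s)
      have "sqrt (s\<^sup>2 - 1) \<le> s" by (rule real_le_lsqrt) (use elim in auto)
      then show ?case using elim du_St_pos[OF \<kappa> elim] by (intro mult_right_mono) auto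
    qed
  qed
  from filterlim_compose[OF this sq]
  show "((\<lambda>r. c / (r\<^sup>2 * du_St \<kappa> (r\<^sup>2))) \<longlongrightarrow> 0) at_top"
    by (rule real_tendsto_divide_at_top[OF tendsto_const])
qed

lemma asym_values_0:
  "asym_const 0 0 0 0 = 1" "asym_root 0 0 0 0 = 1" "asym_mod1 0 0 0 0 = 1 / 2" "asym_mod2 0 0 0 0 = 1 / 2"
  by (simp_all add: asym_const_def asym_root_def asym_mod1_def asym_mod2_def asym_gap_def)

lemma asym_pt_0: "asym_pt 0 0 0 0 = torus_pt 1 \<i> (0, - pi / 2)"
proof -
  have h: "complex_of_real (sqrt (1 / 2)) = 1 / of_real (sqrt 2)" by (simp add: real_sqrt_divide)
  have d: "(1 / 2) / (1 / complex_of_real (sqrt 2)) = 1 / of_real (sqrt 2)"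
  proof -
    have "complex_of_real (sqrt 2) * of_real (sqrt 2) = 2" by (simp flip: of_real_mult)
    then show ?thesis by (simp add: field_simps)
  qed
  have c: "Complex (1 / 2) 0 = 1 / 2" "Complex (- (1 / 2)) 0 = - (1 / 2)" by (simp_all add: complex_eq_iff)
  have "orbit_fst (Complex (1 / 2) 0) (1 / 2) 0 = 1 / of_real (sqrt 2)" "orbit_snd (Complex (1 / 2) 0) (1 / 2) 0 = 0"
    "orbit_fst (Complex (- 1 / 2) 0) (1 / 2) 0 = 0" "orbit_snd (Complex (- 1 / 2) 0) (1 / 2) 0 = - \<i> / of_real (sqrt 2)"
    unfolding orbit_fst_def orbit_snd_def c mult_zero_right add_0_right h minus_divide_left[symmetric] d
    by (simp_all add: field_simps)
  moreover have "sin (- pi / 2) = - 1" "cos (- pi / 2) = 0"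
    using sin_minus[of "pi / 2"] cos_minus[of "pi / 2"] by simp_all
  ultimately show ?thesis
    unfolding asym_pt_def asym_sq1_def asym_sq2_def asym_values_0 torus_pt_eq twisted_vec_def by simp
qed

lemma eventually_L_asym_admissible:
  assumes \<kappa>: "\<kappa> > 0"
  shows "eventually (L_asym \<kappa> c1 c2 c3 asym_admissible) at_top"
proof -
  note par = L_asym_tendsto_parameters[OF \<kappa>]
  have "(0::real)\<^sup>2 < 1" by simp
  note asym = tendsto_asym[OF par(1) par(2)[of c3] par(3)[of c1] par(3)[of c2] this, unfolded asym_values_0]
  have "eventually (\<lambda>r. 1 / r\<^sup>2 < (1 / 2 :: real)) at_top"
    by (rule order_tendstoD(2)[OF par(1)]) simp
  moreover have "eventually (\<lambda>r::real. r > 1) at_top" by (rule eventually_gt_at_top)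
  moreover note order_tendstoD(1)[OF asym(1) zero_less_one]
  moreover have "eventually (\<lambda>r. 1 / 2 < asym_root (1 / r\<^sup>2) (c3 / r\<^sup>2) (c1 / (r\<^sup>2 * du_St \<kappa> (r\<^sup>2))) (c2 / (r\<^sup>2 * du_St \<kappa> (r\<^sup>2)))) at_top"
    by (rule order_tendstoD(1)[OF asym(2)]) simp
  moreover have "eventually (\<lambda>r. 0 < asym_mod1 (1 / r\<^sup>2) (c3 / r\<^sup>2) (c1 / (r\<^sup>2 * du_St \<kappa> (r\<^sup>2))) (c2 / (r\<^sup>2 * du_St \<kappa> (r\<^sup>2)))) at_top"
    by (rule order_tendstoD(1)[OF asym(3)]) simp
  moreover have "eventually (\<lambda>r. 0 < asym_mod2 (1 / r\<^sup>2) (c3 / r\<^sup>2) (c1 / (r\<^sup>2 * du_St \<kappa> (r\<^sup>2))) (c2 / (r\<^sup>2 * du_St \<kappa> (r\<^sup>2)))) at_top"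
    by (rule order_tendstoD(1)[OF asym(4)]) simp
  ultimately show ?thesis
  proof eventually_elim
    case (elim r)
    then have "0 < 1 / r\<^sup>2" by simp
    then show ?case using elim unfolding L_asym_def asym_admissible_def by linarith
  qed
qed

lemma L_asym_pt_tendsto:
  assumes \<kappa>: "\<kappa> > 0"
  shows "((\<lambda>r. L_asym \<kappa> c1 c2 c3 asym_pt r) \<longlongrightarrow> torus_pt 1 \<i> (0, - pi / 2)) at_top"
  unfolding L_asym_def asym_pt_0[symmetric]
  by (rule tendsto_asym_pt) (use L_asym_tendsto_parameters[OF \<kappa>] in \<open>simp_all add: asym_values_0\<close>)

lemma L_asym_pt_continuous:
  assumes \<kappa>: "\<kappa> > 0" and adm: "\<And>r. r > R \<Longrightarrow> L_asym \<kappa> c1 c2 c3 asym_admissible r" and R: "R \<ge> 1"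
  shows "continuous_on {R<..} (L_asym \<kappa> c1 c2 c3 asym_pt)"
  unfolding continuous_on
proof
  fix r assume r: "r \<in> {R<..}"
  then have r1: "r > 1" "r\<^sup>2 > 1" using R by (auto simp: one_less_power)
  have "isCont (\<lambda>r. du_St \<kappa> (r\<^sup>2)) r"
    by (rule isCont_o2[where g = "du_St \<kappa>"]) (use DERIV_isCont[OF du_St_deriv_at[OF \<kappa> r1(2)]] in auto)
  then have du: "((\<lambda>r. du_St \<kappa> (r\<^sup>2)) \<longlongrightarrow> du_St \<kappa> (r\<^sup>2)) (at r within {R<..})"
    using continuous_at_imp_continuous_at_within continuous_within by blast
  have dp: "du_St \<kappa> (r\<^sup>2) > 0" using du_St_pos[OF \<kappa>] r1(2) by simp
  have a: "asym_admissible (1 / r\<^sup>2) (c3 / r\<^sup>2) (c1 / (r\<^sup>2 * du_St \<kappa> (r\<^sup>2))) (c2 / (r\<^sup>2 * du_St \<kappa> (r\<^sup>2)))"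
    using adm[of r] r by (simp add: L_asym_def)
  then have "(1 / r\<^sup>2)\<^sup>2 < 1" by (simp add: asym_admissible_def power_less_one_iff)
  then show "(L_asym \<kappa> c1 c2 c3 asym_pt \<longlongrightarrow> L_asym \<kappa> c1 c2 c3 asym_pt r) (at r within {R<..})"
    unfolding L_asym_def[abs_def] using asym_sqrt_arg_pos[OF a]
    by (intro tendsto_asym_pt tendsto_intros du) (use r1 dp in auto)
qed

lemma L_upper_iff:
  assumes \<kappa>: "\<kappa> > 0" and r: "r > 1" and adm: "L_asym \<kappa> c1 c2 c3 asym_admissible r"
  shows "z \<in> L_upper \<kappa> c1 c2 c3 \<and> norm z = r \<longleftrightarrow> (\<exists>\<theta>1 \<theta>2. z = torus_act \<theta>1 \<theta>2 (r *\<^sub>R L_asym \<kappa> c1 c2 c3 asym_pt r))"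
proof
  note a = adm[unfolded L_asym_def]
  have re: "Re (((r *\<^sub>R y) $ 0)\<^sup>2 + ((r *\<^sub>R y) $ 1)\<^sup>2) > 1 / 2 \<longleftrightarrow> Re ((y $ 0)\<^sup>2 + (y $ 1)\<^sup>2) > 1 / r\<^sup>2 / 2" for y :: "complex ^ 4"
  proof -
    have "Re (((r *\<^sub>R y) $ 0)\<^sup>2 + ((r *\<^sub>R y) $ 1)\<^sup>2) = r\<^sup>2 * Re ((y $ 0)\<^sup>2 + (y $ 1)\<^sup>2)"
      by (simp add: Re_power2 power_mult_distrib algebra_simps)
    then show ?thesis using r by (simp add: field_simps)
  qed
  { assume z: "z \<in> L_upper \<kappa> c1 c2 c3 \<and> norm z = r"
    define y where "y = (1 / r) *\<^sub>R z"
    have y: "z = r *\<^sub>R y" "norm y = 1" using r z by (simp_all add: y_def)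
    have "y \<in> unit_level_set (1 / r\<^sup>2) (c3 / r\<^sup>2) (c1 / (r\<^sup>2 * du_St \<kappa> (r\<^sup>2))) (c2 / (r\<^sup>2 * du_St \<kappa> (r\<^sup>2)))"
      using z scaled_L_fam_iff[OF \<kappa> r y(2)] unfolding y(1) by (simp add: L_upper_def L_asym_def)
    moreover have "Re ((y $ 0)\<^sup>2 + (y $ 1)\<^sup>2) > 1 / r\<^sup>2 / 2"
      using z unfolding y(1) L_upper_def mem_Collect_eq re by simp
    ultimately obtain s t where "y = torus_act s t (L_asym \<kappa> c1 c2 c3 asym_pt r)"
      using unit_level_set_orbit[OF a] unfolding L_asym_def by blast
    then show "\<exists>\<theta>1 \<theta>2. z = torus_act \<theta>1 \<theta>2 (r *\<^sub>R L_asym \<kappa> c1 c2 c3 asym_pt r)"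
      unfolding y(1) torus_act_scaleR by blast }
  { assume "\<exists>\<theta>1 \<theta>2. z = torus_act \<theta>1 \<theta>2 (r *\<^sub>R L_asym \<kappa> c1 c2 c3 asym_pt r)"
    then obtain s t where z: "z = torus_act s t (r *\<^sub>R L_asym \<kappa> c1 c2 c3 asym_pt r)" by blast
    let ?y = "L_asym \<kappa> c1 c2 c3 asym_pt r"
    note u = asym_pt_in_unit_level_set[OF a]
    have y1: "norm ?y = 1" using u(1) by (simp add: unit_level_set_def L_asym_def)
    have "r *\<^sub>R ?y \<in> L_fam \<kappa> c1 c2 c3"
      using scaled_L_fam_iff[OF \<kappa> r y1] u(1) by (simp add: L_asym_def)
    then have "z \<in> L_fam \<kappa> c1 c2 c3" unfolding z by (rule torus_act_L_fam)
    moreover have "Re ((z $ 0)\<^sup>2 + (z $ 1)\<^sup>2) > 1 / 2"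
      unfolding z torus_act_invariants re using u(2) by (simp add: L_asym_def)
    moreover have "norm z = r" unfolding z norm_torus_act using y1 r by simp
    ultimately show "z \<in> L_upper \<kappa> c1 c2 c3 \<and> norm z = r" by (simp add: L_upper_def) }
qed

lemma Re_half_not_in_L_fam:
  assumes \<kappa>: "\<kappa> > 0" and r: "norm z > 1" and adm: "L_asym \<kappa> c1 c2 c3 asym_admissible (norm z)"
    and z: "z \<in> L_fam \<kappa> c1 c2 c3"
  shows "Re ((z $ 0)\<^sup>2 + (z $ 1)\<^sup>2) \<noteq> 1 / 2"
proof
  assume h: "Re ((z $ 0)\<^sup>2 + (z $ 1)\<^sup>2) = 1 / 2"
  define y where "y = (1 / norm z) *\<^sub>R z"
  have "z \<noteq> 0" using r by (metis norm_zero not_one_less_zero)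
  then have y: "z = norm z *\<^sub>R y" "norm y = 1" by (simp_all add: y_def)
  have "y \<in> L_asym \<kappa> c1 c2 c3 unit_level_set (norm z)"
    using scaled_L_fam_iff[OF \<kappa> r y(2)] z y(1) by simp
  from unit_level_set_quadratic(1)[OF this[unfolded L_asym_def]]
  have q: "2 * Re ((y $ 0)\<^sup>2 + (y $ 1)\<^sup>2) - 1 / (norm z)\<^sup>2 \<noteq> 0"
    using adm by (auto simp: L_asym_def asym_admissible_def)
  have "Re ((y $ 0)\<^sup>2 + (y $ 1)\<^sup>2) = (1 / norm z)\<^sup>2 * Re ((z $ 0)\<^sup>2 + (z $ 1)\<^sup>2)"
    unfolding y_def by (simp add: Re_power2 power_mult_distrib power_divide diff_divide_distrib add_divide_distrib)
  then show False using q h by (simp add: power_divide)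
qed

lemma L_upper_eq_image:
  assumes \<kappa>: "\<kappa> > 0" and adm: "\<And>r. r > R \<Longrightarrow> L_asym \<kappa> c1 c2 c3 asym_admissible r" and R: "R \<ge> 1"
  shows "{z \<in> L_upper \<kappa> c1 c2 c3. R < norm z}
    = (\<lambda>(r, s, t). torus_act s t (r *\<^sub>R L_asym \<kappa> c1 c2 c3 asym_pt r)) ` ({R<..} \<times> UNIV \<times> UNIV)"
    (is "?L = ?f ` _")
proof (intro equalityI subsetI)
  fix z assume z: "z \<in> ?L"
  then obtain s t where "z = torus_act s t (norm z *\<^sub>R L_asym \<kappa> c1 c2 c3 asym_pt (norm z))"
    using L_upper_iff[OF \<kappa> _ adm, of "norm z" z] R by auto
  then have "z = ?f (norm z, s, t)" by simp
  then show "z \<in> ?f ` ({R<..} \<times> UNIV \<times> UNIV)" using z by blast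
next
  fix z assume "z \<in> ?f ` ({R<..} \<times> UNIV \<times> UNIV)"
  then obtain r s t where "r > R" "z = torus_act s t (r *\<^sub>R L_asym \<kappa> c1 c2 c3 asym_pt r)" by auto
  then show "z \<in> ?L" using L_upper_iff[OF \<kappa> _ adm, of r z] R by auto
qed

lemma connected_L_upper:
  assumes \<kappa>: "\<kappa> > 0" and adm: "\<And>r. r > R \<Longrightarrow> L_asym \<kappa> c1 c2 c3 asym_admissible r" and R: "R \<ge> 1"
  shows "connected {z \<in> L_upper \<kappa> c1 c2 c3. R < norm z}" "{z \<in> L_upper \<kappa> c1 c2 c3. R < norm z} \<noteq> {}"
proof -
  let ?D = "{R<..} \<times> (UNIV :: real set) \<times> (UNIV :: real set)"
  have F: "continuous_on ?D (\<lambda>x. fst x *\<^sub>R L_asym \<kappa> c1 c2 c3 asym_pt (fst x))"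
    by (intro continuous_intros continuous_on_compose2[OF L_asym_pt_continuous[OF \<kappa> adm R]]) auto
  have vec4_cont: "continuous_on S (\<lambda>x. vec4 (f x) (g x) (h x) (k x))"
    if "continuous_on S f" "continuous_on S g" "continuous_on S h" "continuous_on S k"
    for S :: "(real \<times> real \<times> real) set" and f g h k :: "_ \<Rightarrow> complex"
    using that unfolding continuous_on by (auto intro: tendsto_vec4)
  have "continuous_on ?D (\<lambda>x. torus_act (fst (snd x)) (snd (snd x)) (fst x *\<^sub>R L_asym \<kappa> c1 c2 c3 asym_pt (fst x)))"
    unfolding torus_act_def 
    by (intro vec4_cont continuous_on_add continuous_on_diff continuous_on_mult continuous_on_of_real
        continuous_on_cos continuous_on_sin continuous_on_fst continuous_on_snd continuous_on_id
        continuous_on_component[OF F])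
  then have "connected ((\<lambda>(r, s, t). torus_act s t (r *\<^sub>R L_asym \<kappa> c1 c2 c3 asym_pt r)) ` ?D)"
    by (intro connected_continuous_image) (auto simp: case_prod_unfold intro!: connected_Times)
  then show "connected {z \<in> L_upper \<kappa> c1 c2 c3. R < norm z}"
    by (subst L_upper_eq_image[OF \<kappa> adm R])
  show "{z \<in> L_upper \<kappa> c1 c2 c3. R < norm z} \<noteq> {}"
    by (subst L_upper_eq_image[OF \<kappa> adm R]) auto
qed

lemma twisted_torus_uminus: "z \<in> twisted_torus u w \<Longrightarrow> - z \<in> twisted_torus u w"
proof -
  assume "z \<in> twisted_torus u w"
  then obtain x where x: "z = torus_pt u w x" by (auto simp: twisted_torus_def)
  have "- z = torus_pt u w (fst x + pi, snd x + pi)"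
    unfolding x torus_pt_eq by (rule vec4_eqI) simp_all
  then show ?thesis by (auto simp: twisted_torus_def)
qed

lemma asymptotic_L_upper:
  assumes \<kappa>: "\<kappa> > 0"
  shows "asymptotic_to_cone {z \<in> L_upper \<kappa> c1 c2 c3. R < norm z} (cone_over (twisted_torus 1 \<i>))"
  unfolding asymptotic_to_cone_def
proof (intro allI impI)
  fix \<epsilon> :: real assume \<epsilon>: "\<epsilon> > 0"
  let ?b = "L_asym \<kappa> c1 c2 c3 asym_pt" and ?w = "torus_pt 1 \<i> (0, - pi / 2)"
  have "eventually (\<lambda>r. dist (?b r) ?w < \<epsilon>) at_top"
    using tendstoD[OF L_asym_pt_tendsto[OF \<kappa>] \<epsilon>] .
  then have "eventually (\<lambda>r. dist (?b r) ?w < \<epsilon> \<and> L_asym \<kappa> c1 c2 c3 asym_admissible r \<and> r > 1 \<and> r > R) at_top"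
    using eventually_L_asym_admissible[OF \<kappa>, of c1 c2 c3]
    by (intro eventually_conj eventually_gt_at_top)
  then obtain R0 where R0: "\<And>r. r \<ge> R0 \<Longrightarrow> dist (?b r) ?w < \<epsilon> \<and> L_asym \<kappa> c1 c2 c3 asym_admissible r \<and> r > 1 \<and> r > R"
    by (auto simp: eventually_at_top_linorder)
  have n1: "norm ?w = 1" by (rule norm_torus_pt) simp
  have orb: "torus_orbit ?w = twisted_torus 1 \<i>" by (rule torus_orbit_torus_pt) simp
  show "\<exists>R0. \<forall>r\<ge>R0.
        (\<forall>z\<in>{z \<in> L_upper \<kappa> c1 c2 c3. R < norm z}. norm z = r \<longrightarrow> (\<exists>w\<in>cone_over (twisted_torus 1 \<i>). norm w = r \<and> dist z w < \<epsilon> * r)) \<and>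
        (\<forall>w\<in>cone_over (twisted_torus 1 \<i>). norm w = r \<longrightarrow> (\<exists>z\<in>{z \<in> L_upper \<kappa> c1 c2 c3. R < norm z}. norm z = r \<and> dist z w < \<epsilon> * r))"
  proof (intro exI[of _ R0] allI impI conjI ballI)
    fix r assume "R0 \<le> r"
    from R0[OF this] have r: "dist (?b r) ?w < \<epsilon>" "L_asym \<kappa> c1 c2 c3 asym_admissible r" "r > 1" "r > R" by auto
    have d: "dist (torus_act s t (r *\<^sub>R ?b r)) (torus_act s t (r *\<^sub>R ?w)) < \<epsilon> * r" for s t
    proof -
      have "dist (torus_act s t (r *\<^sub>R ?b r)) (torus_act s t (r *\<^sub>R ?w)) = r * dist (?b r) ?w"
        using r(3) unfolding dist_norm torus_act_diff[symmetric] norm_torus_act scaleR_diff_right[symmetric] by simp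
      then show ?thesis using r(1,3) by (simp add: mult.commute)
    qed
    have c: "torus_act s t (r *\<^sub>R ?w) \<in> cone_over (twisted_torus 1 \<i>)" "norm (torus_act s t (r *\<^sub>R ?w)) = r" for s t
    proof -
      have "torus_act s t ?w \<in> twisted_torus 1 \<i>" unfolding orb[symmetric] torus_orbit_def by blast
      then show "torus_act s t (r *\<^sub>R ?w) \<in> cone_over (twisted_torus 1 \<i>)"
        unfolding torus_act_scaleR cone_over_def by blast
      show "norm (torus_act s t (r *\<^sub>R ?w)) = r" unfolding norm_torus_act using n1 r(3) by simp
    qed
    note iff = L_upper_iff[OF \<kappa> r(3,2)]
    { fix z assume "z \<in> {z \<in> L_upper \<kappa> c1 c2 c3. R < norm z}" "norm z = r"
      then obtain s t where "z = torus_act s t (r *\<^sub>R ?b r)" using iff by blast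
      then show "\<exists>w\<in>cone_over (twisted_torus 1 \<i>). norm w = r \<and> dist z w < \<epsilon> * r"
        using d c by blast }
    { fix w assume w: "w \<in> cone_over (twisted_torus 1 \<i>)" "norm w = r"
      then obtain k y where wk: "w = k *\<^sub>R y" and y: "y \<in> twisted_torus 1 \<i>" by (auto simp: cone_over_def)
      have "norm y = 1" using y norm_torus_pt[of 1 \<i>] by (auto simp: twisted_torus_def)
      then have "\<bar>k\<bar> = r" using w(2) wk by simp
      then have "w = r *\<^sub>R y \<or> w = r *\<^sub>R (- y)" unfolding wk by (cases "k \<ge> 0") auto
      then obtain y' where wy: "w = r *\<^sub>R y'" and "y' \<in> twisted_torus 1 \<i>"
        using y twisted_torus_uminus by blast
      then obtain s t where "y' = torus_act s t ?w"
        unfolding orb[symmetric] torus_orbit_def by blast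
      then have "w = torus_act s t (r *\<^sub>R ?w)" unfolding wy torus_act_scaleR by simp
      moreover have "torus_act s t (r *\<^sub>R ?b r) \<in> L_upper \<kappa> c1 c2 c3 \<and> norm (torus_act s t (r *\<^sub>R ?b r)) = r"
        using iff by blast
      ultimately show "\<exists>z\<in>{z \<in> L_upper \<kappa> c1 c2 c3. R < norm z}. norm z = r \<and> dist z w < \<epsilon> * r"
        using d r(4) by (intro bexI[of _ "torus_act s t (r *\<^sub>R ?b r)"]) auto }
  qed
qed

lemma norm_swap_pairs: "norm (swap_pairs z) = norm z"
proof -
  have "(norm (swap_pairs z))\<^sup>2 = (norm z)\<^sup>2" by (simp add: norm_sq_4 swap_pairs_def)
  then show ?thesis by (simp only: power2_eq_iff_nonneg norm_ge_zero)
qed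

lemma dist_swap_pairs: "dist (swap_pairs z) (swap_pairs w) = dist z w"
proof -
  have "swap_pairs z - swap_pairs w = swap_pairs (z - w)"
    by (rule vec4_eqI) (simp_all add: swap_pairs_def)
  then show ?thesis by (simp add: dist_norm norm_swap_pairs)
qed

lemma asymptotic_to_cone_swap_pairs:
  assumes "asymptotic_to_cone L C"
  shows "asymptotic_to_cone (swap_pairs ` L) (swap_pairs ` C)"
  using assms unfolding asymptotic_to_cone_def by (simp add: norm_swap_pairs dist_swap_pairs)

lemma swap_pairs_L_fam:
  assumes "z \<in> L_fam \<kappa> c1 c2 c3"
  shows "swap_pairs z \<in> L_fam \<kappa> c2 c1 (- c3)"
    and "Re ((swap_pairs z $ 0)\<^sup>2 + (swap_pairs z $ 1)\<^sup>2) = 1 - Re ((z $ 0)\<^sup>2 + (z $ 1)\<^sup>2)"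
proof -
  have q: "quad z = 1" using assms by (simp add: L_fam_def quadric_def)
  then have "(z $ 2)\<^sup>2 + (z $ 3)\<^sup>2 = 1 - ((z $ 0)\<^sup>2 + (z $ 1)\<^sup>2)"
    by (simp add: quad_def eq_diff_eq add.commute add.left_commute add.assoc)
  then have s: "(swap_pairs z $ 0)\<^sup>2 + (swap_pairs z $ 1)\<^sup>2 = 1 - ((z $ 0)\<^sup>2 + (z $ 1)\<^sup>2)"
    by (simp add: swap_pairs_def)
  then show "Re ((swap_pairs z $ 0)\<^sup>2 + (swap_pairs z $ 1)\<^sup>2) = 1 - Re ((z $ 0)\<^sup>2 + (z $ 1)\<^sup>2)"
    by simp
  have "quad (swap_pairs z) = quad z" by (simp add: quad_def swap_pairs_def)
  moreover have "Im ((swap_pairs z $ 0)\<^sup>2 + (swap_pairs z $ 1)\<^sup>2) = - c3"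
    unfolding s using assms by (simp add: L_fam_def)
  ultimately show "swap_pairs z \<in> L_fam \<kappa> c2 c1 (- c3)"
    using assms q unfolding L_fam_def quadric_def mem_Collect_eq norm_swap_pairs
    by (simp add: swap_pairs_def)
qed

lemma components_two:
  fixes h :: "'a::topological_space \<Rightarrow> real"
  assumes "connected A" "connected B" "A \<noteq> {}" "B \<noteq> {}" and h: "continuous_on UNIV h"
    and A: "\<And>x. x \<in> A \<Longrightarrow> h x > c" and B: "\<And>x. x \<in> B \<Longrightarrow> h x < c"
  shows "components (A \<union> B) = {A, B}"
proof -
  have max: "D \<subseteq> A \<or> D \<subseteq> B" if D: "connected D" "D \<subseteq> A \<union> B" for D
  proof (rule ccontr)
    assume "\<not> ?thesis"
    then have ne: "D \<inter> {x. h x > c} \<noteq> {}" "D \<inter> {x. h x < c} \<noteq> {}" using D(2) A B by blast+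
    have "open {x. h x > c}" "open {x. h x < c}"
      using h by (auto intro!: open_Collect_less continuous_intros)
    moreover have "D \<subseteq> {x. h x > c} \<union> {x. h x < c}" using D(2) A B by blast
    moreover have "{x. h x > c} \<inter> {x. h x < c} \<inter> D = {}" by auto
    ultimately show False
      using connectedD[OF D(1), of "{x. h x > c}" "{x. h x < c}"] ne by auto
  qed
  have disj: "A \<inter> B = {}" using A B by fastforce
  show ?thesis
  proof (intro equalityI subsetI)
    fix C assume C: "C \<in> components (A \<union> B)"
    then have "C \<subseteq> A \<union> B" "connected C" "C \<noteq> {}"
      by (auto simp: in_components_subset in_components_connected in_components_nonempty)
    then have "C \<subseteq> A \<or> C \<subseteq> B" using max by blast
    then show "C \<in> {A, B}"
    proof
      assume "C \<subseteq> A"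
      then have "A \<subseteq> C" using components_maximal[OF C assms(1)] \<open>C \<noteq> {}\<close> by blast
      then show ?thesis using \<open>C \<subseteq> A\<close> by blast
    next
      assume "C \<subseteq> B"
      then have "B \<subseteq> C" using components_maximal[OF C assms(2)] \<open>C \<noteq> {}\<close> by blast
      then show ?thesis using \<open>C \<subseteq> B\<close> by blast
    qed
  next
    have "D = A" if "A \<subseteq> D" "D \<subseteq> A \<union> B" "connected D" for D
      using max[OF that(3,2)] that(1) disj assms(3) by blast
    moreover have "D = B" if "B \<subseteq> D" "D \<subseteq> A \<union> B" "connected D" for D
      using max[OF that(3,2)] that(1) disj assms(4) by blast
    moreover fix C assume "C \<in> {A, B}"
    ultimately show "C \<in> components (A \<union> B)"
      unfolding in_components_maximal using assms(1-4) by auto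
  qed
qed

lemma L_fam_ends:
  assumes \<kappa>: "\<kappa> > 0"
  shows "\<exists>R0. \<forall>R\<ge>R0. \<exists>A B. A \<noteq> B
          \<and> components {z \<in> L_fam \<kappa> c1 c2 c3. R < norm z} = {A, B}
          \<and> asymptotic_to_cone A (cone_over Sigma_a)
          \<and> asymptotic_to_cone B (cone_over Sigma_c)"
proof -
  have "eventually (\<lambda>r. L_asym \<kappa> c1 c2 c3 asym_admissible r \<and> L_asym \<kappa> c2 c1 (- c3) asym_admissible r \<and> r > 1) at_top"
    using eventually_L_asym_admissible[OF \<kappa>] by (intro eventually_conj eventually_gt_at_top)
  then obtain R0 where R0: "\<And>r. r \<ge> R0 \<Longrightarrow>
      L_asym \<kappa> c1 c2 c3 asym_admissible r \<and> L_asym \<kappa> c2 c1 (- c3) asym_admissible r \<and> r > 1"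
    by (auto simp: eventually_at_top_linorder)
  show ?thesis
  proof (intro exI[of _ R0] allI impI)
    fix R assume "R0 \<le> R"
    then have adm: "\<And>r. r > R \<Longrightarrow> L_asym \<kappa> c1 c2 c3 asym_admissible r"
      "\<And>r. r > R \<Longrightarrow> L_asym \<kappa> c2 c1 (- c3) asym_admissible r"
      using R0 by auto
    have R: "R \<ge> 1" using R0[OF \<open>R0 \<le> R\<close>] by simp
    define A where "A = {z \<in> L_upper \<kappa> c1 c2 c3. R < norm z}"
    define B where "B = swap_pairs ` {z \<in> L_upper \<kappa> c2 c1 (- c3). R < norm z}"
    have hA: "Re ((z $ 0)\<^sup>2 + (z $ 1)\<^sup>2) > 1 / 2" if "z \<in> A" for z
      using that by (simp add: A_def L_upper_def)
    have B_iff: "z \<in> B \<longleftrightarrow> z \<in> L_fam \<kappa> c1 c2 c3 \<and> R < norm z \<and> Re ((z $ 0)\<^sup>2 + (z $ 1)\<^sup>2) < 1 / 2" for z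
    proof
      assume "z \<in> B"
      then obtain y where y: "z = swap_pairs y" "y \<in> L_fam \<kappa> c2 c1 (- c3)" "Re ((y $ 0)\<^sup>2 + (y $ 1)\<^sup>2) > 1 / 2" "R < norm y"
        by (auto simp: B_def L_upper_def)
      show "z \<in> L_fam \<kappa> c1 c2 c3 \<and> R < norm z \<and> Re ((z $ 0)\<^sup>2 + (z $ 1)\<^sup>2) < 1 / 2"
        using swap_pairs_L_fam[OF y(2)] y(3,4) unfolding y(1) norm_swap_pairs by simp
    next
      assume z: "z \<in> L_fam \<kappa> c1 c2 c3 \<and> R < norm z \<and> Re ((z $ 0)\<^sup>2 + (z $ 1)\<^sup>2) < 1 / 2"
      then have "swap_pairs z \<in> {z \<in> L_upper \<kappa> c2 c1 (- c3). R < norm z}"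
        using swap_pairs_L_fam[of z \<kappa> c1 c2 c3] by (simp add: L_upper_def norm_swap_pairs)
      then show "z \<in> B" unfolding B_def by (rule image_eqI[rotated]) simp
    qed
    have union: "{z \<in> L_fam \<kappa> c1 c2 c3. R < norm z} = A \<union> B"
    proof -
      have "Re ((z $ 0)\<^sup>2 + (z $ 1)\<^sup>2) \<noteq> 1 / 2" if "z \<in> L_fam \<kappa> c1 c2 c3" "R < norm z" for z
        using Re_half_not_in_L_fam[OF \<kappa> _ adm(1) that(1)] that(2) R by auto
      then show ?thesis unfolding set_eq_iff Un_iff B_iff A_def L_upper_def by fastforce
    qed
    have cont: "continuous_on S swap_pairs" for S
      unfolding continuous_on_iff dist_swap_pairs by blast
    have conn: "connected A" "connected B" "A \<noteq> {}" "B \<noteq> {}"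
      using connected_L_upper[OF \<kappa> adm(1) R] connected_L_upper[OF \<kappa> adm(2) R] connected_continuous_image[OF cont]
      by (auto simp: A_def B_def)
    have comp: "components (A \<union> B) = {A, B}"
      by (rule components_two[OF conn, where h = "\<lambda>z. Re ((z $ 0)\<^sup>2 + (z $ 1)\<^sup>2)" and c = "1 / 2"])
        (use hA B_iff in \<open>auto intro!: continuous_intros\<close>)
    have "A \<noteq> B" using conn(3) hA B_iff by (metis all_not_in_conv less_asym)
    moreover have "asymptotic_to_cone A (cone_over Sigma_a)"
      unfolding A_def Sigma_a_eq by (rule asymptotic_L_upper[OF \<kappa>])
    moreover have "asymptotic_to_cone B (cone_over Sigma_c)"
      unfolding B_def Sigma_c_eq swap_pairs_cone[where u = 1 and w = \<i>, symmetric]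
      by (rule asymptotic_to_cone_swap_pairs[OF asymptotic_L_upper[OF \<kappa>]])
    ultimately show "\<exists>A B. A \<noteq> B
          \<and> components {z \<in> L_fam \<kappa> c1 c2 c3. R < norm z} = {A, B}
          \<and> asymptotic_to_cone A (cone_over Sigma_a)
          \<and> asymptotic_to_cone B (cone_over Sigma_c)"
      unfolding union using comp by blast
  qed
qed


section \<open>The limit equations\<close>

lemma coord_pt_moments:
  "(norm (coord_pt \<rho> t \<phi> \<psi>))\<^sup>2 = cosh (2 * \<rho>)"
  "Im (coord_pt \<rho> t \<phi> \<psi> $ 0 * cnj (coord_pt \<rho> t \<phi> \<psi> $ 1)) = - (sinh (2 * \<rho>) / 2 * (cos t * sin \<phi> * cos \<psi>))"
  "Im (coord_pt \<rho> t \<phi> \<psi> $ 2 * cnj (coord_pt \<rho> t \<phi> \<psi> $ 3)) = - (sinh (2 * \<rho>) / 2 * (sin t * sin \<phi> * sin \<psi>))"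
  "Im ((coord_pt \<rho> t \<phi> \<psi> $ 0)\<^sup>2 + (coord_pt \<rho> t \<phi> \<psi> $ 1)\<^sup>2) = - (sinh (2 * \<rho>) / 2 * (sin (2 * t) * cos \<phi>))"
proof -
  have n: "(c * C)\<^sup>2 + (S * p * s)\<^sup>2 + (S * q * x)\<^sup>2 + ((s * C)\<^sup>2 + (S * p * c)\<^sup>2) + (S * q * y)\<^sup>2 =
      (c\<^sup>2 + s\<^sup>2) * C\<^sup>2 + S\<^sup>2 * (p\<^sup>2 * (c\<^sup>2 + s\<^sup>2) + q\<^sup>2 * (x\<^sup>2 + y\<^sup>2))" for c C S p s q x y :: real
    by (simp add: power2_eq_square algebra_simps)
  have "(norm (coord_pt \<rho> t \<phi> \<psi>))\<^sup>2 = (cos t * cosh \<rho>)\<^sup>2 + (sinh \<rho> * cos \<phi> * sin t)\<^sup>2 + (sinh \<rho> * sin \<phi> * cos \<psi>)\<^sup>2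
      + ((sin t * cosh \<rho>)\<^sup>2 + (sinh \<rho> * cos \<phi> * cos t)\<^sup>2) + (sinh \<rho> * sin \<phi> * sin \<psi>)\<^sup>2"
    unfolding norm_sq_4 cmod_power2 coord_pt_def by simp
  also have "\<dots> = cosh (2 * \<rho>)" unfolding n by (simp add: cosh_double)
  finally show "(norm (coord_pt \<rho> t \<phi> \<psi>))\<^sup>2 = cosh (2 * \<rho>)" .
  show "Im (coord_pt \<rho> t \<phi> \<psi> $ 0 * cnj (coord_pt \<rho> t \<phi> \<psi> $ 1)) = - (sinh (2 * \<rho>) / 2 * (cos t * sin \<phi> * cos \<psi>))"
    "Im (coord_pt \<rho> t \<phi> \<psi> $ 2 * cnj (coord_pt \<rho> t \<phi> \<psi> $ 3)) = - (sinh (2 * \<rho>) / 2 * (sin t * sin \<phi> * sin \<psi>))"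
    "Im ((coord_pt \<rho> t \<phi> \<psi> $ 0)\<^sup>2 + (coord_pt \<rho> t \<phi> \<psi> $ 1)\<^sup>2) = - (sinh (2 * \<rho>) / 2 * (sin (2 * t) * cos \<phi>))"
    unfolding coord_pt_def vec4_nth sinh_double sin_double by (simp_all add: Im_power2)
qed

lemma tendsto_0_of_bounded_product:
  fixes f g :: "nat \<Rightarrow> real"
  assumes "filterlim f at_top sequentially" "\<And>n. f n * g n = c"
  shows "g \<longlonglongrightarrow> 0"
proof -
  have "(\<lambda>n. c / f n) \<longlonglongrightarrow> 0"
    by (rule real_tendsto_divide_at_top[OF tendsto_const assms(1)])
  moreover have "eventually (\<lambda>n. c / f n = g n) sequentially"
    using filterlim_at_top_dense[THEN iffD1, OF assms(1), rule_format, of 0]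
  proof eventually_elim
    case (elim n)
    then show ?case using assms(2)[of n] by (simp add: field_simps)
  qed
  ultimately show ?thesis using Lim_transform_eventually by blast
qed

lemma limit_eqs_of_L_fam:
  fixes \<rho> t \<phi> \<psi> :: "nat \<Rightarrow> real"
  assumes \<kappa>: "\<kappa> > 0" and \<rho>: "filterlim \<rho> at_top sequentially"
    and lim: "t \<longlonglongrightarrow> t0" "\<phi> \<longlonglongrightarrow> \<phi>0" "\<psi> \<longlonglongrightarrow> \<psi>0"
    and L: "\<And>n. coord_pt (\<rho> n) (t n) (\<phi> n) (\<psi> n) \<in> L_fam \<kappa> c1 c2 c3"
  shows "limit_eqs t0 \<phi>0 \<psi>0"
proof -
  have c2: "filterlim (\<lambda>n. cosh (2 * \<rho> n)) at_top sequentially"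
  proof (rule filterlim_compose[OF _ \<rho>])
    show "filterlim (\<lambda>x::real. cosh (2 * x)) at_top at_top" by real_asymp
  qed
  have s2: "filterlim (\<lambda>n. sinh (2 * \<rho> n)) at_top sequentially"
  proof (rule filterlim_compose[OF _ \<rho>])
    show "filterlim (\<lambda>x::real. sinh (2 * x)) at_top at_top" by real_asymp
  qed
  have "filterlim (\<lambda>n. sqrt ((cosh (2 * \<rho> n))\<^sup>2 - 1) * du_St \<kappa> (cosh (2 * \<rho> n))) at_top sequentially"
    by (rule filterlim_compose[OF filterlim_du_St_mult[OF \<kappa>] c2])
  moreover have "eventually (\<lambda>n. sqrt ((cosh (2 * \<rho> n))\<^sup>2 - 1) * du_St \<kappa> (cosh (2 * \<rho> n))
      = du_St \<kappa> (cosh (2 * \<rho> n)) * sinh (2 * \<rho> n)) sequentially"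
    using filterlim_at_top_dense[THEN iffD1, OF \<rho>, rule_format, of 0]
    by eventually_elim (simp add: cosh_square_eq)
  ultimately have us: "filterlim (\<lambda>n. du_St \<kappa> (cosh (2 * \<rho> n)) * sinh (2 * \<rho> n)) at_top sequentially"
    using filterlim_cong by fast
  note eqs = L[unfolded L_fam_iff[OF \<kappa>] coord_pt_moments]
  have "(\<lambda>n. cos (t n) * sin (\<phi> n) * cos (\<psi> n)) \<longlonglongrightarrow> 0"
  proof (rule tendsto_0_of_bounded_product[OF us])
    show "du_St \<kappa> (cosh (2 * \<rho> n)) * sinh (2 * \<rho> n) * (cos (t n) * sin (\<phi> n) * cos (\<psi> n)) = - 2 * c1" for n
      using eqs[of n] by (auto simp: algebra_simps)
  qed
  moreover have "(\<lambda>n. sin (t n) * sin (\<phi> n) * sin (\<psi> n)) \<longlonglongrightarrow> 0"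
  proof (rule tendsto_0_of_bounded_product[OF us])
    show "du_St \<kappa> (cosh (2 * \<rho> n)) * sinh (2 * \<rho> n) * (sin (t n) * sin (\<phi> n) * sin (\<psi> n)) = - 2 * c2" for n
      using eqs[of n] by (auto simp: algebra_simps)
  qed
  moreover have "(\<lambda>n. sin (2 * t n) * cos (\<phi> n)) \<longlonglongrightarrow> 0"
  proof (rule tendsto_0_of_bounded_product[OF s2])
    show "sinh (2 * \<rho> n) * (sin (2 * t n) * cos (\<phi> n)) = - 2 * c3" for n
      using eqs[of n] by (auto simp: algebra_simps)
  qed
  moreover have "(\<lambda>n. cos (t n) * sin (\<phi> n) * cos (\<psi> n)) \<longlonglongrightarrow> cos t0 * sin \<phi>0 * cos \<psi>0"
    "(\<lambda>n. sin (t n) * sin (\<phi> n) * sin (\<psi> n)) \<longlonglongrightarrow> sin t0 * sin \<phi>0 * sin \<psi>0"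
    "(\<lambda>n. sin (2 * t n) * cos (\<phi> n)) \<longlonglongrightarrow> sin (2 * t0) * cos \<phi>0"
    by (intro tendsto_intros lim)+
  ultimately show ?thesis
    unfolding limit_eqs_def using LIMSEQ_unique by blast
qed

lemma cos_sin_not_both_0: "cos (x::real) \<noteq> 0 \<or> sin x \<noteq> 0"
  by (metis cos_zero sin_cos_squared_add add_0 power_zero_numeral zero_neq_one)

lemma limit_eqs_iff_cases:
  "limit_eqs t \<phi> \<psi> \<longleftrightarrow> case_a t \<phi> \<psi> \<or> case_b t \<phi> \<psi> \<or> case_c t \<phi> \<psi> \<or> case_d t \<phi> \<psi>"
  using cos_sin_not_both_0[of t] cos_sin_not_both_0[of \<phi>] cos_sin_not_both_0[of \<psi>]
  unfolding limit_eqs_def case_a_def case_b_def case_c_def case_d_def sin_double by auto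

definition coord_limit :: "real \<Rightarrow> real \<Rightarrow> real \<Rightarrow> complex ^ 4" where
  "coord_limit t \<phi> \<psi> =
     vec4 (Complex (cos t / sqrt 2) (- (cos \<phi> * sin t / sqrt 2))) (\<i> * of_real (sin \<phi> * cos \<psi> / sqrt 2))
          (Complex (sin t / sqrt 2) (cos \<phi> * cos t / sqrt 2)) (\<i> * of_real (sin \<phi> * sin \<psi> / sqrt 2))"

lemma sgn_coord_pt_tendsto:
  fixes \<rho> t \<phi> \<psi> :: "nat \<Rightarrow> real"
  assumes \<rho>: "filterlim \<rho> at_top sequentially" and lim: "t \<longlonglongrightarrow> t0" "\<phi> \<longlonglongrightarrow> \<phi>0" "\<psi> \<longlonglongrightarrow> \<psi>0"
  shows "(\<lambda>n. sgn (coord_pt (\<rho> n) (t n) (\<phi> n) (\<psi> n))) \<longlonglongrightarrow> coord_limit t0 \<phi>0 \<psi>0"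
proof -
  define C S where "C = (\<lambda>x::real. cosh x / sqrt (cosh (2 * x)))" and "S = (\<lambda>x::real. sinh x / sqrt (cosh (2 * x)))"
  have h: "inverse ((1 / 2) powr (1 / 2)) / 2 = 1 / sqrt (2::real)"
    by (simp add: powr_half_sqrt real_sqrt_divide real_div_sqrt divide_eq_eq)
  have "(C \<longlongrightarrow> 1 / sqrt 2) at_top" unfolding C_def h[symmetric] by real_asymp
  from filterlim_compose[OF this \<rho>] have C: "(\<lambda>n. C (\<rho> n)) \<longlonglongrightarrow> 1 / sqrt 2" .
  have "(S \<longlongrightarrow> 1 / sqrt 2) at_top" unfolding S_def h[symmetric] by real_asymp
  from filterlim_compose[OF this \<rho>] have S: "(\<lambda>n. S (\<rho> n)) \<longlonglongrightarrow> 1 / sqrt 2" .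
  have e: "sgn (coord_pt r a b c) =
     vec4 (Complex (cos a * C r) (- (S r * cos b * sin a))) (\<i> * of_real (S r * sin b * cos c))
          (Complex (sin a * C r) (S r * cos b * cos a)) (\<i> * of_real (S r * sin b * sin c))" for r a b c
  proof -
    define k where "k = inverse (sqrt (cosh (2 * r)))"
    have "norm (coord_pt r a b c) = sqrt (cosh (2 * r))"
      using coord_pt_moments(1)[of r a b c] by (metis norm_ge_zero real_sqrt_unique)
    then have "sgn (coord_pt r a b c) = k *\<^sub>R coord_pt r a b c" by (simp add: sgn_div_norm k_def)
    moreover have "C r = k * cosh r" "S r = k * sinh r" by (simp_all add: C_def S_def k_def divide_inverse)
    ultimately show ?thesis
      by (intro vec4_eqI) (simp_all add: coord_pt_def complex_eq_iff)
  qed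
  have "(\<lambda>n. sgn (coord_pt (\<rho> n) (t n) (\<phi> n) (\<psi> n))) \<longlonglongrightarrow>
     vec4 (Complex (cos t0 * (1 / sqrt 2)) (- (1 / sqrt 2 * cos \<phi>0 * sin t0))) (\<i> * of_real (1 / sqrt 2 * sin \<phi>0 * cos \<psi>0))
          (Complex (sin t0 * (1 / sqrt 2)) (1 / sqrt 2 * cos \<phi>0 * cos t0)) (\<i> * of_real (1 / sqrt 2 * sin \<phi>0 * sin \<psi>0))"
    unfolding e by (intro tendsto_vec4 tendsto_Complex tendsto_intros C S lim)
  then show ?thesis by (simp add: coord_limit_def mult_ac)
qed

lemma limit_torusI:
  assumes "\<And>t \<phi> \<psi>. P t \<phi> \<psi> \<Longrightarrow> \<exists>x. coord_limit t \<phi> \<psi> = torus_pt u w x" and uw: "u = 1 \<and> w = \<i> \<or> u = \<i> \<and> w = 1"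
  shows "limit_torus P (twisted_torus u w)"
  unfolding limit_torus_def
proof (intro allI impI, elim conjE)
  fix \<rho> t \<phi> \<psi> :: "nat \<Rightarrow> real" and t0 \<phi>0 \<psi>0
  assume l: "filterlim \<rho> at_top sequentially" "t \<longlonglongrightarrow> t0" "\<phi> \<longlonglongrightarrow> \<phi>0" "\<psi> \<longlonglongrightarrow> \<psi>0" and "P t0 \<phi>0 \<psi>0"
  then obtain x where "coord_limit t0 \<phi>0 \<psi>0 = torus_pt u w x" using assms(1) by blast
  then show "\<exists>p. (\<lambda>n. sgn (coord_pt (\<rho> n) (t n) (\<phi> n) (\<psi> n))) \<longlonglongrightarrow> p \<and> torus_orbit p = twisted_torus u w"
    using sgn_coord_pt_tendsto[OF l] torus_orbit_torus_pt[OF uw] by (intro exI[of _ "torus_pt u w x"]) simp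
qed

lemma coord_limit_eq_torus_pt:
  assumes "u = 1 \<and> w = \<i> \<or> u = \<i> \<and> w = 1" "coord_limit t \<phi> \<psi> = twisted_vec u w (a / sqrt 2) (b / sqrt 2) (c / sqrt 2) (d / sqrt 2)"
    and "a\<^sup>2 + b\<^sup>2 = 1" "c\<^sup>2 + d\<^sup>2 = 1"
  shows "\<exists>x. coord_limit t \<phi> \<psi> = torus_pt u w x"
proof -
  obtain s r where "a = cos s" "b = sin s" "c = cos r" "d = sin r"
    using sincos_total_2pi[OF assms(3)] sincos_total_2pi[OF assms(4)] by metis
  then have "coord_limit t \<phi> \<psi> = torus_pt u w (s, r)" using assms(2) by (simp add: torus_pt_eq)
  then show ?thesis by blast
qed

lemma sin_eq_0_cos_sq: "sin (x::real) = 0 \<Longrightarrow> (cos x)\<^sup>2 = 1"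
  using sin_cos_squared_add[of x] by simp

lemma cos_eq_0_sin_sq: "cos (x::real) = 0 \<Longrightarrow> (sin x)\<^sup>2 = 1"
  using sin_cos_squared_add[of x] by simp

lemma limit_torus_cases:
  "limit_torus case_a (twisted_torus 1 \<i>)" "limit_torus case_b (twisted_torus \<i> 1)"
  "limit_torus case_c (twisted_torus \<i> 1)" "limit_torus case_d (twisted_torus 1 \<i>)"
proof -
  show "limit_torus case_a (twisted_torus 1 \<i>)"
  proof (rule limit_torusI)
    fix t \<phi> \<psi> assume "case_a t \<phi> \<psi>"
    then have "sin \<phi> = 0" "sin t = 0" by (simp_all add: case_a_def)
    then show "\<exists>x. coord_limit t \<phi> \<psi> = torus_pt 1 \<i> x"
      by (intro coord_limit_eq_torus_pt[where a = "cos t" and b = 0 and c = "cos \<phi> * cos t" and d = 0] vec4_eqI)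
        (simp_all add: coord_limit_def complex_eq_iff power_mult_distrib sin_eq_0_cos_sq)
  qed simp
  show "limit_torus case_b (twisted_torus \<i> 1)"
  proof (rule limit_torusI)
    fix t \<phi> \<psi> assume "case_b t \<phi> \<psi>"
    then have "sin \<phi> = 0" "cos t = 0" by (simp_all add: case_b_def)
    then show "\<exists>x. coord_limit t \<phi> \<psi> = torus_pt \<i> 1 x"
      by (intro coord_limit_eq_torus_pt[where a = "- (cos \<phi> * sin t)" and b = 0 and c = "sin t" and d = 0] vec4_eqI)
        (simp_all add: coord_limit_def complex_eq_iff power_mult_distrib sin_eq_0_cos_sq cos_eq_0_sin_sq)
  qed simp
  show "limit_torus case_c (twisted_torus \<i> 1)"
  proof (rule limit_torusI)
    fix t \<phi> \<psi> assume "case_c t \<phi> \<psi>"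
    then have "cos t = 0" "sin \<psi> = 0" by (simp_all add: case_c_def)
    then show "\<exists>x. coord_limit t \<phi> \<psi> = torus_pt \<i> 1 x"
      by (intro coord_limit_eq_torus_pt[where a = "- (cos \<phi> * sin t)" and b = "sin \<phi> * cos \<psi>" and c = "sin t" and d = 0] vec4_eqI)
        (simp_all add: coord_limit_def complex_eq_iff power_mult_distrib sin_eq_0_cos_sq cos_eq_0_sin_sq)
  qed simp
  show "limit_torus case_d (twisted_torus 1 \<i>)"
  proof (rule limit_torusI)
    fix t \<phi> \<psi> assume "case_d t \<phi> \<psi>"
    then have "cos \<psi> = 0" "sin t = 0" by (simp_all add: case_d_def)
    then show "\<exists>x. coord_limit t \<phi> \<psi> = torus_pt 1 \<i> x"
      by (intro coord_limit_eq_torus_pt[where a = "cos t" and b = 0 and c = "cos \<phi> * cos t" and d = "sin \<phi> * sin \<psi>"] vec4_eqI)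
        (simp_all add: coord_limit_def complex_eq_iff power_mult_distrib sin_eq_0_cos_sq cos_eq_0_sin_sq)
  qed simp
qed

lemma twisted_torus_subset_cone: "twisted_torus u w \<subseteq> cone_over (twisted_torus u w)"
proof
  fix z assume "z \<in> twisted_torus u w"
  then have "1 *\<^sub>R z \<in> cone_over (twisted_torus u w)" unfolding cone_over_def by blast
  then show "z \<in> cone_over (twisted_torus u w)" by simp
qed

theorem mainTheorem3:
  fixes \<kappa> c1 c2 c3 :: real
  assumes "\<kappa> > 0"
  shows
    "(\<forall>\<theta>1 \<theta>2. torus_act \<theta>1 \<theta>2 ` L_fam \<kappa> c1 c2 c3 = L_fam \<kappa> c1 c2 c3)
     \<and> special_lagrangian quadric (omega_St \<kappa>) Omega_St (L_fam \<kappa> c1 c2 c3 - non_free_locus)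
     \<and> (c3 \<noteq> 0 \<or> (c1 \<noteq> 0 \<and> c2 \<noteq> 0) \<longrightarrow>
          special_lagrangian quadric (omega_St \<kappa>) Omega_St (L_fam \<kappa> c1 c2 c3))

     \<and> (\<exists>R0. \<forall>R\<ge>R0. \<exists>A B. A \<noteq> B
          \<and> components {z \<in> L_fam \<kappa> c1 c2 c3. R < norm z} = {A, B}
          \<and> asymptotic_to_cone A (cone_over Sigma_a)
          \<and> asymptotic_to_cone B (cone_over Sigma_c))

     \<and> (\<forall>(\<rho> :: nat \<Rightarrow> real) (t :: nat \<Rightarrow> real) (\<phi> :: nat \<Rightarrow> real) (\<psi> :: nat \<Rightarrow> real) t0 \<phi>0 \<psi>0.
          filterlim \<rho> at_top sequentially \<and> t \<longlonglongrightarrow> t0 \<and> \<phi> \<longlonglongrightarrow> \<phi>0 \<and> \<psi> \<longlonglongrightarrow> \<psi>0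
          \<and> (\<forall>n. coord_pt (\<rho> n) (t n) (\<phi> n) (\<psi> n) \<in> L_fam \<kappa> c1 c2 c3)
          \<longrightarrow> limit_eqs t0 \<phi>0 \<psi>0)
     \<and> (\<forall>t \<phi> \<psi>. limit_eqs t \<phi> \<psi> \<longleftrightarrow>
          case_a t \<phi> \<psi> \<or> case_b t \<phi> \<psi> \<or> case_c t \<phi> \<psi> \<or> case_d t \<phi> \<psi>)

     \<and> Sigma_a \<subseteq> conifold \<and> Sigma_c \<subseteq> conifold
     \<and> flat_torus (kaehler_metric omega_cone) Sigma_a
     \<and> flat_torus (kaehler_metric omega_cone) Sigma_c

     \<and> limit_torus case_a Sigma_a
     \<and> (limit_torus case_b Sigma_c \<and> SO4_congruent (cone_over Sigma_c) (cone_over Sigma_a))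
     \<and> limit_torus case_c Sigma_c
     \<and> (limit_torus case_d Sigma_a \<and> SO4_congruent (cone_over Sigma_a) (cone_over Sigma_c))

     \<and> special_lagrangian conifold omega_cone Omega_cone (cone_over Sigma_a - {0})
     \<and> special_lagrangian conifold omega_cone Omega_cone (cone_over Sigma_c - {0})"
  unfolding Sigma_a_eq Sigma_c_eq
proof (intro conjI L_fam_ends[OF assms, unfolded Sigma_a_eq Sigma_c_eq] special_lagrangian_L_fam[OF assms]
    limit_torus_cases SO4_congruent_swap)
  show "\<forall>\<theta>1 \<theta>2. torus_act \<theta>1 \<theta>2 ` L_fam \<kappa> c1 c2 c3 = L_fam \<kappa> c1 c2 c3"
    by (simp add: torus_act_image_L_fam)
  show "c3 \<noteq> 0 \<or> (c1 \<noteq> 0 \<and> c2 \<noteq> 0) \<longrightarrow>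
      special_lagrangian quadric (omega_St \<kappa>) Omega_St (L_fam \<kappa> c1 c2 c3)"
    using special_lagrangian_L_fam[OF assms] L_fam_free by metis
  show "twisted_torus 1 \<i> \<subseteq> conifold" "twisted_torus \<i> 1 \<subseteq> conifold"
    using twisted_torus_subset_cone twisted_torus_subset_conifold by blast+
qed (use limit_eqs_of_L_fam[OF assms] limit_eqs_iff_cases flat_torus_twisted special_lagrangian_cone in blast)+

end
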